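(* Let $\hbar>0$. For every quantum state $\psi$ (unit vector in $L^2(\mathbb{R})$) and every $\theta_x,\theta_p\in(0,1]$ with $\theta_x+\theta_p>1$, the following hold. (1) $$\Delta^{c}x(\theta_x,\psi)\cdot\Delta^{c}p(\theta_p,\psi)\;\ge\;2\pi\hbar\,\Bigl(\sqrt{\theta_x\theta_p}-\sqrt{(1-\theta_x)(1-\theta_p)}\Bigr)^{2}.$$ (2) For the interval version, the analogous bound is sharp and implicit: $$\lambda_0\!\left(\frac{\Delta^{I}x(\theta_x,\psi)\cdot\Delta^{I}p(\theta_p,\psi)}{4\hbar}\right)\ge \Bigl(\sqrt{\theta_x\theta_p}-\sqrt{(1-\theta_x)(1-\theta_p)}\Bigr)^{2},$$ equivalently $$\Delta^{I}x(\theta_x,\psi)\cdot\Delta^{I}p(\theta_p,\psi)\;\ge\;4\hbar\,\lambda_0^{-1}\!\Bigl(\bigl(\sqrt{\theta_x\theta_p}-\sqrt{(1-\theta_x)(1-\theta_p)}\bigr)^{2}\Bigr).$$ (3) The last bound is saturated by the leading Slepian function, i.e. the principal eigenfunction of the prolate-spheroidal kernel: equality holds in it when $\psi$ is the leading Slepian function with parameter $c=\lambda_0^{-1}\bigl((\sqrt{\theta_x\theta_p}-\sqrt{(1-\theta_x)(1-\theta_p)})^{2}\bigr)$.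
   Context: A (pure) quantum state is a unit vector $\psi\in L^2(\mathbb{R})$ (complex-valued). Its momentum wave function is $\hat\psi(p)=\frac{1}{\sqrt{2\pi\hbar}}\int_{\mathbb{R}} e^{-ipx/\hbar}\psi(x)\,dx$ (the unitary Fourier transform on $L^2(\mathbb{R})$), where $\hbar>0$ is a fixed constant. Let $\mu$ denote Lebesgue measure on $\mathbb{R}$. Confidence uncertainties: $$\Delta^{c}x(\theta_x,\psi)=\inf\Big\{\mu(X): X\subseteq\mathbb{R}\text{ Lebesgue measurable},\ \int_X|\psi(x)|^2\,dx\ge\theta_x\Big\},$$ and $\Delta^{c}p(\theta_p,\psi)$ is defined in the same way with $\hat\psi$ and $\theta_p$ in place of $\psi$ and $\theta_x$. Interval confidence uncertainties: $$\Delta^{I}x(\theta_x,\psi)=\inf\Big\{x_2-x_1: x_1\le x_2 \text{ real},\ \int_{x_1}^{x_2}|\psi(x)|^2\,dx\ge\theta_x\Big\},$$ and $\Delta^{I}p(\theta_p,\psi)$ is defined in the same way with $\hat\psi$ and $\theta_p$. All these quantities take values in $[0,+\infty]$, with $\inf\emptyset=+\infty$. For $c>0$, $\lambda_0(c)$ denotes the largest eigenvalue of the prolate-spheroidal integral operator on $L^2[-1,1]$, $$(K_c f)(u)=\int_{-1}^{1}\frac{\sin c(u-v)}{\pi(u-v)}\,f(v)\,dv$$ (the kernel equals $c/\pi$ at $u=v$). The function $\lambda_0$ is a strictly increasing continuous bijection from $(0,\infty)$ onto $(0,1)$, and $\lambda_0^{-1}$ is its inverse; by convention $\lambda_0(+\infty)=1$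 and $\lambda_0^{-1}(1)=+\infty$. The leading Slepian function with parameter $c$ is the principal eigenfunction $f_0$ of $K_c$ (eigenvalue $\lambda_0(c)$), regarded as a state: for an interval length $L>0$ it is the $L^2$-normalised multiple of $f_0(2x/L)$ on $[-L/2,L/2]$, extended by zero outside; the associated momentum interval is $[-W/2,W/2]$ with $c=LW/(4\hbar)$.
   Formalization: Part (3) is false for θ_x<1 (e.g. θ_p=1: Δ^I p=∞). Equality for the leading Slepian function is claimed only for θ_x=1, θ_p<1; for every pair except (1,1) it is attained by a state combining the Slepian function and its projection onto its momentum interval. *)

theory Defs
  imports "HOL-Analysis.Analysis"
begin

definition L2_on :: "real set \<Rightarrow> (real \<Rightarrow> complex) \<Rightarrow> bool" where
  "L2_on S f \<longleftrightarrow> f \<in> borel_measurable (lebesgue_on S) \<and>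
     integrable (lebesgue_on S) (\<lambda>x. (cmod (f x))\<^sup>2)"

definition quantum_state :: "(real \<Rightarrow> complex) \<Rightarrow> bool" where
  "quantum_state \<psi> \<longleftrightarrow> L2_on UNIV \<psi> \<and> (LINT x|lebesgue. (cmod (\<psi> x))\<^sup>2) = 1"

text \<open>
  The Fourier integral of a function in \<open>L\<^sup>2\<close> need not converge absolutely, so the unitary
  transform is the limit in mean square of the integrals over \<open>[-R, R]\<close> as \<open>R\<close> tends to infinity.
  It is determined up to null sets; \<open>momentum_wave\<close> picks a representative, and every
  quantity below is insensitive to this choice.
\<close>

definition truncated_fourier ::
    "real \<Rightarrow> real \<Rightarrow> (real \<Rightarrow> complex) \<Rightarrow> real \<Rightarrow> complex" where
  "truncated_fourier hbar R \<psi> p =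
     of_real (1 / sqrt (2 * pi * hbar)) *
     (LINT x|lebesgue_on {-R..R}. exp (- (\<i> * of_real (p * x / hbar))) * \<psi> x)"

definition is_fourier_transform ::
    "real \<Rightarrow> (real \<Rightarrow> complex) \<Rightarrow> (real \<Rightarrow> complex) \<Rightarrow> bool" where
  "is_fourier_transform hbar \<psi> \<phi> \<longleftrightarrow> L2_on UNIV \<phi> \<and>
     ((\<lambda>R. \<integral>\<^sup>+ p. ennreal ((cmod (\<phi> p - truncated_fourier hbar R \<psi> p))\<^sup>2) \<partial>lebesgue)
        \<longlongrightarrow> 0) at_top"

definition momentum_wave :: "real \<Rightarrow> (real \<Rightarrow> complex) \<Rightarrow> real \<Rightarrow> complex" where
  "momentum_wave hbar \<psi> = (SOME \<phi>. is_fourier_transform hbar \<psi> \<phi>)"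

text \<open>
  Uncertainties are extended nonnegative reals, where the infimum of the empty set is \<open>\<infinity>\<close>.
\<close>

definition confidence_width :: "real \<Rightarrow> (real \<Rightarrow> complex) \<Rightarrow> ennreal" where
  "confidence_width \<theta> f =
     Inf {emeasure lebesgue X | X. X \<in> sets lebesgue \<and>
            (LINT x|lebesgue_on X. (cmod (f x))\<^sup>2) \<ge> \<theta>}"

definition interval_width :: "real \<Rightarrow> (real \<Rightarrow> complex) \<Rightarrow> ennreal" where
  "interval_width \<theta> f =
     Inf {ennreal (b - a) | a b. a \<le> b \<and>
            (LINT x|lebesgue_on {a..b}. (cmod (f x))\<^sup>2) \<ge> \<theta>}"

abbreviation Delta_c_x :: "real \<Rightarrow> (real \<Rightarrow> complex) \<Rightarrow> ennreal" where
  "Delta_c_x \<theta> \<psi> \<equiv> confidence_width \<theta> \<psi>"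

abbreviation Delta_c_p :: "real \<Rightarrow> real \<Rightarrow> (real \<Rightarrow> complex) \<Rightarrow> ennreal" where
  "Delta_c_p hbar \<theta> \<psi> \<equiv> confidence_width \<theta> (momentum_wave hbar \<psi>)"

abbreviation Delta_I_x :: "real \<Rightarrow> (real \<Rightarrow> complex) \<Rightarrow> ennreal" where
  "Delta_I_x \<theta> \<psi> \<equiv> interval_width \<theta> \<psi>"

abbreviation Delta_I_p :: "real \<Rightarrow> real \<Rightarrow> (real \<Rightarrow> complex) \<Rightarrow> ennreal" where
  "Delta_I_p hbar \<theta> \<psi> \<equiv> interval_width \<theta> (momentum_wave hbar \<psi>)"

definition prolate_kernel :: "real \<Rightarrow> real \<Rightarrow> real \<Rightarrow> real" where
  "prolate_kernel c u v = (if u = v then c / pi else sin (c * (u - v)) / (pi * (u - v)))"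

definition prolate_operator :: "real \<Rightarrow> (real \<Rightarrow> complex) \<Rightarrow> real \<Rightarrow> complex" where
  "prolate_operator c f u =
     (LINT v|lebesgue_on {-1..1}. of_real (prolate_kernel c u v) * f v)"

definition prolate_eigenfunction :: "real \<Rightarrow> real \<Rightarrow> (real \<Rightarrow> complex) \<Rightarrow> bool" where
  "prolate_eigenfunction c lam f \<longleftrightarrow> L2_on {-1..1} f \<and>
     \<not> (AE u in lebesgue_on {-1..1}. f u = 0) \<and>
     (AE u in lebesgue_on {-1..1}. prolate_operator c f u = of_real lam * f u)"

text \<open>
  The operator is self-adjoint, so restricting to real eigenvalues loses nothing.
\<close>

definition lambda0 :: "real \<Rightarrow> real" where
  "lambda0 c = (GREATEST lam. \<exists>f. prolate_eigenfunction c lam f)"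

text \<open>
  The extensions by \<open>\<lambda>\<^sub>0(\<infinity>) = 1\<close> and \<open>\<lambda>\<^sub>0\<inverse>(1) = \<infinity>\<close>. They are meaningful on \<open>(0, \<infinity>]\<close> and on
  \<open>(0, 1]\<close> respectively.
\<close>

definition lambda0_ext :: "ennreal \<Rightarrow> real" where
  "lambda0_ext z = (if z = \<infinity> then 1 else lambda0 (enn2real z))"

definition lambda0_inv :: "real \<Rightarrow> ennreal" where
  "lambda0_inv y = (if y = 1 then \<infinity> else ennreal (inv_into {0<..} lambda0 y))"

definition leading_slepian :: "real \<Rightarrow> real \<Rightarrow> (real \<Rightarrow> complex) \<Rightarrow> bool" where
  "leading_slepian c L \<psi> \<longleftrightarrow> quantum_state \<psi> \<and>
     (\<exists>f0 k. prolate_eigenfunction c (lambda0 c) f0 \<and>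
        (AE x in lebesgue. \<psi> x = (if x \<in> {-L/2..L/2} then k * f0 (2 * x / L) else 0)))"

definition confidence_bound :: "real \<Rightarrow> real \<Rightarrow> real" where
  "confidence_bound \<theta>x \<theta>p = (sqrt (\<theta>x * \<theta>p) - sqrt ((1 - \<theta>x) * (1 - \<theta>p)))\<^sup>2"

text \<open>
  The state \<open>\<phi>\<close> is a real linear combination of \<open>s\<close> and of the projection of \<open>s\<close> onto the
  momentum band \<open>[-W/2, W/2]\<close>. For \<open>s\<close> a leading Slepian function supported in an interval, equality
  in the sharp bound at position confidence below 1 needs such a combination: a compactly supported
  state alone cannot attain it.
\<close>

definition band_combination ::
    "real \<Rightarrow> real \<Rightarrow> (real \<Rightarrow> complex) \<Rightarrow> (real \<Rightarrow> complex) \<Rightarrow> bool" where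
  "band_combination hbar W s \<phi> \<longleftrightarrow>
     (\<exists>\<alpha> \<beta> :: real. AE p in lebesgue.
        momentum_wave hbar \<phi> p =
          of_real (\<alpha> + \<beta> * indicator {-W/2..W/2} p) * momentum_wave hbar s p)"

end

theory Submission
  imports Defs "HOL-Probability.Characteristic_Functions" "HOL-Complex_Analysis.Great_Picard"
begin

text \<open>
  Write \<open>P\<close> and \<open>Q\<close> for the multiplications by the indicators of \<open>X\<close> in position and of \<open>Y\<close> in
  momentum, and let \<open>m\<close> bound the squared norm of the Fourier transform from \<open>P\<close> to \<open>Q\<close>. The unit
  vector \<open>\<psi>\<close> makes angles with \<open>P \<psi>\<close> and \<open>Q \<psi>\<close> whose squared cosines are the two confidences, while
  the angle between \<open>P \<psi>\<close> and \<open>Q \<psi>\<close> has squared cosine at most \<open>m\<close>. The triangle inequality for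
  angles thus bounds \<open>m\<close> from below by \<open>confidence_bound\<close>. For arbitrary sets one may take
  \<open>m = \<mu>(X) \<mu>(Y) / (2 \<pi> \<hbar>)\<close>. For intervals, rescaling reduces the best \<open>m\<close> to the largest eigenvalue
  \<open>\<lambda>\<^sub>0(c)\<close> of a compact positive operator. It is strictly increasing in \<open>c\<close>, because the transform of
  a compactly supported function is analytic and cannot vanish on an interval. Equality holds for the
  unit vector in the plane of \<open>s\<close> and \<open>Q s\<close>, for \<open>s\<close> a leading Slepian function, that divides their
  angle in the proportion prescribed by the two confidences.

  On the Hilbert space side everything rests on Plancherel's theorem. Gaussian summation gives a
  contraction that preserves the norm of indicators of intervals, and the vectors whose norm a
  contraction preserves form a closed subspace. Composed with complex conjugation the transform is a
  self-adjoint isometry, hence an involution, which yields inversion.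
\<close>

section \<open>The Hilbert space of square-integrable functions\<close>

text \<open>The inner product on \<open>l2\<close> is the real one, the integral of Re (cnj f * g).
  Norms and angles need no more, and for it conjugation is linear, so the conjugated transform is a
  bounded linear map; over the complex numbers it would be antilinear. The Fourier integral is
  available pointwise only for integrable functions, so explicit estimates are made for functions
  cut to bounded intervals and then passed to the limit. Inversion serves twice: it writes the
  product of cutoffs as the integral operator with the sine kernel, and it builds the saturating
  state from its momentum wave function. All estimates of \<open>lambda0\<close> compare trial
  vectors: \<open>lambda0 c\<close> is the largest share of energy in the band
  \<open>[-c, c]\<close>, and the maximiser for one parameter is inserted into the quotient for
  another. Widths live in [0, infinity], where 0 * infinity = 0. A bound for every pair of sets
  passes to the product of the infima only once both infima are known to be positive; this follows
  from the same bound applied with a large bounded momentum interval as one of the sets.\<close>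

abbreviation L2 :: "(real \<Rightarrow> complex) \<Rightarrow> bool" where
  "L2 \<equiv> L2_on UNIV"

abbreviation cut :: "real set \<Rightarrow> (real \<Rightarrow> complex) \<Rightarrow> real \<Rightarrow> complex" where
  "cut S f \<equiv> \<lambda>x. indicator S x * f x"

lemma L2_iff:
  "L2 f \<longleftrightarrow> f \<in> borel_measurable lebesgue \<and> integrable lebesgue (\<lambda>x. (cmod (f x))\<^sup>2)"
  by (simp add: L2_on_def lebesgue_on_UNIV_eq)

lemma L2_measurable: "L2 f \<Longrightarrow> f \<in> borel_measurable lebesgue"
  by (simp add: L2_iff)

lemma L2_bound:
  assumes "f \<in> borel_measurable lebesgue" "integrable lebesgue (g :: real \<Rightarrow> real)"
    and "\<And>x. (cmod (f x))\<^sup>2 \<le> g x"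
  shows "L2 f"
proof -
  note [measurable] = assms(1)
  have "integrable lebesgue (\<lambda>x. (cmod (f x))\<^sup>2)"
    by (rule Bochner_Integration.integrable_bound[OF assms(2)])
       (use assms(3) in \<open>auto intro!: AE_I2 order.trans[OF assms(3)]\<close>)
  then show ?thesis using assms(1) by (simp add: L2_iff)
qed

lemma L2_zero: "L2 (\<lambda>x. 0)"
  by (simp add: L2_iff)

lemma L2_add:
  assumes "L2 f" "L2 g"
  shows "L2 (\<lambda>x. f x + g x)"
proof (rule L2_bound)
  show "(\<lambda>x. f x + g x) \<in> borel_measurable lebesgue"
    using assms[THEN L2_measurable] by measurable
  show "integrable lebesgue (\<lambda>x. 2 * ((cmod (f x))\<^sup>2 + (cmod (g x))\<^sup>2))"
    using assms by (simp add: L2_iff)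
  fix x
  have "(cmod (f x + g x))\<^sup>2 \<le> (cmod (f x) + cmod (g x))\<^sup>2"
    by (intro power_mono norm_triangle_ineq norm_ge_zero)
  also have "\<dots> \<le> 2 * ((cmod (f x))\<^sup>2 + (cmod (g x))\<^sup>2)"
    using sum_squares_bound[of "cmod (f x)" "cmod (g x)"] by (simp add: power2_sum)
  finally show "(cmod (f x + g x))\<^sup>2 \<le> 2 * ((cmod (f x))\<^sup>2 + (cmod (g x))\<^sup>2)" .
qed

lemma L2_mult:
  assumes "L2 f" "m \<in> borel_measurable lebesgue" "\<And>x. cmod (m x) \<le> B"
  shows "L2 (\<lambda>x. m x * f x)"
proof (rule L2_bound)
  show "(\<lambda>x. m x * f x) \<in> borel_measurable lebesgue"
    using assms(1)[THEN L2_measurable] assms(2) by measurable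
  show "integrable lebesgue (\<lambda>x. B\<^sup>2 * (cmod (f x))\<^sup>2)"
    using assms by (simp add: L2_iff)
  fix x
  show "(cmod (m x * f x))\<^sup>2 \<le> B\<^sup>2 * (cmod (f x))\<^sup>2"
    unfolding norm_mult power_mult_distrib
    by (intro mult_right_mono power_mono assms) auto
qed

lemma L2_scaleR: "L2 f \<Longrightarrow> L2 (\<lambda>x. r *\<^sub>R f x)"
  using L2_mult[of f "\<lambda>_. of_real r" "\<bar>r\<bar>"] by (simp add: scaleR_conv_of_real)

lemma L2_cmult: "L2 f \<Longrightarrow> L2 (\<lambda>x. c * f x)"
  using L2_mult[of f "\<lambda>_. c" "cmod c"] by simp

lemma L2_uminus: "L2 f \<Longrightarrow> L2 (\<lambda>x. - f x)"
  using L2_scaleR[of f "-1"] by simp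

lemma L2_diff: "L2 f \<Longrightarrow> L2 g \<Longrightarrow> L2 (\<lambda>x. f x - g x)"
  using L2_add[of f "\<lambda>x. - g x"] L2_uminus[of g] by simp

lemma L2_indicator:
  assumes "L2 f" "X \<in> sets lebesgue"
  shows "L2 (cut X f)"
  by (rule L2_mult[where B=1]) (use assms in \<open>auto simp: indicator_def\<close>)

lemma integrable_L2_inner:
  assumes "L2 f" "L2 g"
  shows "integrable lebesgue (\<lambda>x. f x \<bullet> g x)"
proof -
  note [measurable] = assms[THEN L2_measurable]
  have "integrable lebesgue (\<lambda>x. (cmod (f x))\<^sup>2 + (cmod (g x))\<^sup>2)"
    using assms by (simp add: L2_iff)
  then show ?thesis
  proof (rule Bochner_Integration.integrable_bound)
    show "AE x in lebesgue. norm (f x \<bullet> g x) \<le> norm ((cmod (f x))\<^sup>2 + (cmod (g x))\<^sup>2)"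
    proof (intro AE_I2)
      fix x
      have "\<bar>f x \<bullet> g x\<bar> \<le> cmod (f x) * cmod (g x)" by (rule Cauchy_Schwarz_ineq2)
      also have "\<dots> \<le> (cmod (f x))\<^sup>2 + (cmod (g x))\<^sup>2"
        using sum_squares_bound[of "cmod (f x)" "cmod (g x)"]
          mult_nonneg_nonneg[OF norm_ge_zero[of "f x"] norm_ge_zero[of "g x"]] by linarith
      finally show "norm (f x \<bullet> g x) \<le> norm ((cmod (f x))\<^sup>2 + (cmod (g x))\<^sup>2)" by simp
    qed
  qed measurable
qed

section \<open>Functions modulo null sets as a complete inner product space\<close>

definition l2_equal :: "(real \<Rightarrow> complex) \<Rightarrow> (real \<Rightarrow> complex) \<Rightarrow> bool" where
  "l2_equal f g \<longleftrightarrow> L2 f \<and> L2 g \<and> (AE x in lebesgue. f x = g x)"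

\<comment> \<open>The quotient is partial because functions outside \<open>L2\<close> have no class.
  \<open>fn\<close> picks an arbitrary representative, hence every law about \<open>fn\<close> holds
  only almost everywhere.\<close>
quotient_type l2 = "real \<Rightarrow> complex" / partial: l2_equal
  morphisms fn mk
proof (rule part_equivpI)
  show "\<exists>f. l2_equal f f" using L2_zero by (auto simp: l2_equal_def)
  show "symp l2_equal" by (auto simp: l2_equal_def symp_def elim: AE_mp)
  show "transp l2_equal"
    unfolding l2_equal_def transp_def
    by (auto elim: eventually_elim2)
qed

lemma L2_fn [simp]: "L2 (fn f)"
  using Quotient3_rep_reflp[OF Quotient3_l2, of f] by (simp add: l2_equal_def)

lemma fn_measurable [measurable]: "fn f \<in> borel_measurable lebesgue"
  by (rule L2_measurable) simp

lemma fn_mk: "L2 f \<Longrightarrow> AE x in lebesgue. fn (mk f) x = f x"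
  using rep_abs_rsp_left[OF Quotient3_l2, of f f] by (simp add: l2_equal_def)

lemma mk_fn [simp]: "mk (fn f) = f"
  by (rule Quotient3_abs_rep[OF Quotient3_l2])

lemma mk_eqI: "L2 f \<Longrightarrow> L2 g \<Longrightarrow> AE x in lebesgue. f x = g x \<Longrightarrow> mk f = mk g"
  using Quotient3_rel_abs[OF Quotient3_l2, of f g] by (simp add: l2_equal_def)

lemma l2_eqI: "AE x in lebesgue. fn f x = fn g x \<Longrightarrow> f = g"
  using mk_eqI[of "fn f" "fn g"] by simp

instantiation l2 :: "{zero, plus, uminus, minus, scaleR}"
begin
definition "0 = mk (\<lambda>x. 0)"
definition "f + g = mk (\<lambda>x. fn f x + fn g x)"
definition "- f = mk (\<lambda>x. - fn f x)"
definition "f - g = mk (\<lambda>x. fn f x - fn g x)"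
definition "r *\<^sub>R f = mk (\<lambda>x. r *\<^sub>R fn f x)"
instance ..
end

lemma fn_zero: "AE x in lebesgue. fn 0 x = 0"
  unfolding zero_l2_def by (intro fn_mk L2_zero)
lemma fn_plus: "AE x in lebesgue. fn (f + g) x = fn f x + fn g x"
  unfolding plus_l2_def by (intro fn_mk L2_add) auto
lemma fn_uminus: "AE x in lebesgue. fn (- f) x = - fn f x"
  unfolding uminus_l2_def by (intro fn_mk L2_uminus) auto
lemma fn_minus: "AE x in lebesgue. fn (f - g) x = fn f x - fn g x"
  unfolding minus_l2_def by (intro fn_mk L2_diff) auto
lemma fn_scaleR: "AE x in lebesgue. fn (r *\<^sub>R f) x = r *\<^sub>R fn f x"
  unfolding scaleR_l2_def by (intro fn_mk L2_scaleR) auto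

lemma mk_add: "L2 f \<Longrightarrow> L2 g \<Longrightarrow> mk (\<lambda>x. f x + g x) = mk f + mk g"
  unfolding plus_l2_def using fn_mk[of f] fn_mk[of g]
  by (intro mk_eqI L2_add) (auto elim: eventually_elim2)

lemma mk_diff: "L2 f \<Longrightarrow> L2 g \<Longrightarrow> mk (\<lambda>x. f x - g x) = mk f - mk g"
  unfolding minus_l2_def using fn_mk[of f] fn_mk[of g]
  by (intro mk_eqI L2_diff) (auto elim: eventually_elim2)

lemma mk_scaleR: "L2 f \<Longrightarrow> mk (\<lambda>x. r *\<^sub>R f x) = r *\<^sub>R mk f"
  unfolding scaleR_l2_def using fn_mk[of f]
  by (intro mk_eqI L2_scaleR) (auto elim: eventually_mono)

instance l2 :: real_vector
proof
  fix f g h :: l2 and a b :: real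
  show "f + g + h = f + (g + h)"
    by (rule l2_eqI, use fn_plus[of "f + g" h] fn_plus[of f g] fn_plus[of f "g + h"] fn_plus[of g h] in \<open>eventually_elim, simp\<close>)
  show "f + g = g + f"
    by (rule l2_eqI, use fn_plus[of f g] fn_plus[of g f] in \<open>eventually_elim, simp\<close>)
  show "0 + f = f"
    by (rule l2_eqI, use fn_plus[of 0 f] fn_zero in \<open>eventually_elim, simp\<close>)
  show "- f + f = 0"
    by (rule l2_eqI, use fn_plus[of "- f" f] fn_zero fn_uminus[of f] in \<open>eventually_elim, simp\<close>)
  show "f - g = f + - g"
    by (rule l2_eqI, use fn_plus[of f "- g"] fn_minus[of f g] fn_uminus[of g] in \<open>eventually_elim, simp\<close>)
  show "a *\<^sub>R (f + g) = a *\<^sub>R f + a *\<^sub>R g"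
    by (rule l2_eqI, use fn_scaleR[of a "f + g"] fn_scaleR[of a f] fn_scaleR[of a g] fn_plus[of f g]
      fn_plus[of "a *\<^sub>R f" "a *\<^sub>R g"] in \<open>eventually_elim, simp add: scaleR_right_distrib\<close>)
  show "(a + b) *\<^sub>R f = a *\<^sub>R f + b *\<^sub>R f"
    by (rule l2_eqI, use fn_scaleR[of "a + b" f] fn_scaleR[of a f] fn_scaleR[of b f] fn_plus[of "a *\<^sub>R f" "b *\<^sub>R f"] in \<open>eventually_elim, simp add: scaleR_left_distrib\<close>)
  show "a *\<^sub>R b *\<^sub>R f = (a * b) *\<^sub>R f"
    by (rule l2_eqI, use fn_scaleR[of "a * b" f] fn_scaleR[of a "b *\<^sub>R f"] fn_scaleR[of b f] in \<open>eventually_elim, simp\<close>)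
  show "1 *\<^sub>R f = f"
    by (rule l2_eqI, use fn_scaleR[of 1 f] in \<open>eventually_elim, simp\<close>)
qed

instantiation l2 :: real_inner
begin
definition "inner f g = (LINT x|lebesgue. fn f x \<bullet> fn g x)"
definition "norm (f :: l2) = sqrt (f \<bullet> f)"
definition "sgn (f :: l2) = f /\<^sub>R norm f"
definition "dist f g = norm (f - g :: l2)"
definition "uniformity = (INF e\<in>{0<..}. principal {(f, g :: l2). dist f g < e})"
definition "open (U :: l2 set) \<longleftrightarrow> (\<forall>f\<in>U. eventually (\<lambda>(f', g). f' = f \<longrightarrow> g \<in> U) uniformity)"
instance
proof
  fix f g h :: l2 and r :: real
  show "dist f g = norm (f - g)" by (rule dist_l2_def)
  show "sgn f = f /\<^sub>R norm f" by (rule sgn_l2_def)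
  show "uniformity = (INF e\<in>{0<..}. principal {(f, g :: l2). dist f g < e})"
    by (rule uniformity_l2_def)
  show "open U \<longleftrightarrow> (\<forall>f\<in>U. eventually (\<lambda>(f', g). f' = f \<longrightarrow> g \<in> U) uniformity)" for U :: "l2 set"
    by (rule open_l2_def)
  show "norm f = sqrt (f \<bullet> f)" by (rule norm_l2_def)
  show "f \<bullet> g = g \<bullet> f" by (simp add: inner_l2_def inner_commute)
  have "(f + g) \<bullet> h = (LINT x|lebesgue. fn f x \<bullet> fn h x + fn g x \<bullet> fn h x)"
    unfolding inner_l2_def using fn_plus[of f g]
    by (intro integral_cong_AE) (auto elim: eventually_mono simp: inner_add_left)
  then show "(f + g) \<bullet> h = f \<bullet> h + g \<bullet> h"
    by (simp add: inner_l2_def integrable_L2_inner)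
  have "r *\<^sub>R f \<bullet> g = (LINT x|lebesgue. r * (fn f x \<bullet> fn g x))"
    unfolding inner_l2_def using fn_scaleR[of r f]
    by (intro integral_cong_AE) (auto elim: eventually_mono)
  then show "r *\<^sub>R f \<bullet> g = r * (f \<bullet> g)"
    by (simp add: inner_l2_def)
  show "0 \<le> f \<bullet> f" by (auto simp: inner_l2_def intro: Bochner_Integration.integral_nonneg)
  show "f \<bullet> f = 0 \<longleftrightarrow> f = 0"
  proof
    assume "f \<bullet> f = 0"
    then have "AE x in lebesgue. fn f x \<bullet> fn f x = 0"
      unfolding inner_l2_def by (subst (asm) integral_nonneg_eq_0_iff_AE) (auto simp: integrable_L2_inner)
    from this fn_zero have "AE x in lebesgue. fn f x = fn 0 x"
      by eventually_elim simp
    then show "f = 0"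
      by (rule l2_eqI)
  next
    assume "f = 0"
    then show "f \<bullet> f = 0"
      unfolding inner_l2_def using fn_zero
      by (intro integral_eq_zero_AE) (auto elim: eventually_mono)
  qed
qed
end

lemma norm_l2_sq: "(norm f)\<^sup>2 = (LINT x|lebesgue. (cmod (fn f x))\<^sup>2)"
  by (simp add: power2_norm_eq_inner inner_l2_def)

lemma integrable_fn_sq: "integrable lebesgue (\<lambda>x. (cmod (fn f x))\<^sup>2)"
  using L2_fn[of f] by (simp add: L2_iff)

lemma nn_integral_fn_sq: "(\<integral>\<^sup>+x. ennreal ((cmod (fn f x))\<^sup>2) \<partial>lebesgue) = ennreal ((norm f)\<^sup>2)"
  unfolding norm_l2_sq by (intro nn_integral_eq_integral integrable_fn_sq) auto

lemma inner_mk: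
  assumes "L2 f" "L2 g"
  shows "mk f \<bullet> mk g = (LINT x|lebesgue. f x \<bullet> g x)"
proof -
  note [measurable] = assms[THEN L2_measurable]
  show ?thesis
    unfolding inner_l2_def using fn_mk[OF assms(1)] fn_mk[OF assms(2)]
    by (intro integral_cong_AE) (measurable, auto elim: eventually_elim2)
qed

lemma norm_mk_sq: "L2 f \<Longrightarrow> (norm (mk f))\<^sup>2 = (LINT x|lebesgue. (cmod (f x))\<^sup>2)"
  by (simp add: power2_norm_eq_inner inner_mk)

text \<open>Instead of Minkowski's inequality for infinite sums: if \<open>\<parallel>g\<^sub>k\<parallel>\<^sup>2 \<le> 8\<^sup>-\<^sup>k\<close>, then \<open>\<Sum> 2\<^sup>k |g\<^sub>k|\<^sup>2\<close> is
  integrable, and \<open>2|g\<^sub>k| \<le> 2\<^sup>k |g\<^sub>k|\<^sup>2 + 2\<^sup>-\<^sup>k\<close>.\<close>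

lemma AE_summable_l2:
  assumes "\<And>k. (norm (g k :: l2))\<^sup>2 \<le> (1/8) ^ k"
  shows "AE x in lebesgue. summable (\<lambda>k. fn (g k) x)"
proof -
  have "(\<integral>\<^sup>+x. (\<Sum>k. ennreal (2 ^ k * (cmod (fn (g k) x))\<^sup>2)) \<partial>lebesgue)
      = (\<Sum>k. \<integral>\<^sup>+x. ennreal (2 ^ k * (cmod (fn (g k) x))\<^sup>2) \<partial>lebesgue)"
    by (intro nn_integral_suminf) measurable
  also have "\<dots> = (\<Sum>k. ennreal (2 ^ k * (norm (g k))\<^sup>2))"
    by (simp add: ennreal_mult nn_integral_cmult nn_integral_fn_sq)
  also have "\<dots> \<le> (\<Sum>k. ennreal ((1/4) ^ k))"
  proof (intro suminf_le allI ennreal_leI)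
    fix k
    have "2 ^ k * (norm (g k))\<^sup>2 \<le> 2 ^ k * (1/8) ^ k"
      by (intro mult_left_mono assms) auto
    also have "\<dots> = (1/4 :: real) ^ k" by (simp flip: power_mult_distrib)
    finally show "2 ^ k * (norm (g k))\<^sup>2 \<le> (1/4) ^ k" .
  qed auto
  also have "\<dots> = ennreal (\<Sum>k. (1/4) ^ k)"
    by (intro suminf_ennreal2 summable_geometric) auto
  finally have "(\<integral>\<^sup>+x. (\<Sum>k. ennreal (2 ^ k * (cmod (fn (g k) x))\<^sup>2)) \<partial>lebesgue) \<noteq> \<infinity>"
    by (auto simp: top_unique)
  then have "AE x in lebesgue. (\<Sum>k. ennreal (2 ^ k * (cmod (fn (g k) x))\<^sup>2)) \<noteq> \<infinity>"
    by (intro nn_integral_noteq_infinite) measurable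
  then show ?thesis
  proof eventually_elim
    fix x assume "(\<Sum>k. ennreal (2 ^ k * (cmod (fn (g k) x))\<^sup>2)) \<noteq> \<infinity>"
    then have "summable (\<lambda>k. 2 ^ k * (cmod (fn (g k) x))\<^sup>2)"
      by (intro summable_suminf_not_top) auto
    moreover have "summable (\<lambda>k. (1/2 :: real) ^ k)" by (intro summable_geometric) auto
    ultimately have "summable (\<lambda>k. 2 ^ k * (cmod (fn (g k) x))\<^sup>2 + (1/2) ^ k)"
      by (rule summable_add)
    then show "summable (\<lambda>k. fn (g k) x)"
    proof (rule summable_comparison_test'[where N=0])
      fix k
      have "2 * (sqrt (2 ^ k) * cmod (fn (g k) x)) * sqrt ((1/2) ^ k) \<le>
          (sqrt (2 ^ k) * cmod (fn (g k) x))\<^sup>2 + (sqrt ((1/2) ^ k))\<^sup>2"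
        by (rule sum_squares_bound)
      also have "2 * (sqrt (2 ^ k) * cmod (fn (g k) x)) * sqrt ((1/2) ^ k) = 2 * cmod (fn (g k) x)"
        by (simp add: real_sqrt_power power_one_over real_sqrt_divide)
      finally have "2 * cmod (fn (g k) x) \<le> 2 ^ k * (cmod (fn (g k) x))\<^sup>2 + (1/2) ^ k"
        by (simp add: power_mult_distrib)
      then show "norm (fn (g k) x) \<le> 2 ^ k * (cmod (fn (g k) x))\<^sup>2 + (1/2) ^ k"
        using norm_ge_zero[of "fn (g k) x"] by linarith
    qed
  qed
qed

text \<open>Riesz-Fischer: a subsequence with squared increments at most \<open>(1/8) ^ k\<close>
  converges almost everywhere by \<open>AE_summable_l2\<close>, and Fatou's lemma turns the
  pointwise limit into a limit in norm.\<close>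

instance l2 :: complete_space
proof
  fix X :: "nat \<Rightarrow> l2" assume "Cauchy X"
  have "\<exists>N. \<forall>m\<ge>N. \<forall>n\<ge>N. norm (X m - X n) < sqrt ((1/8) ^ k)" for k
    using \<open>Cauchy X\<close>[THEN CauchyD, of "sqrt ((1/8) ^ k)"] by simp
  then obtain N where N: "\<And>k m n. m \<ge> N k \<Longrightarrow> n \<ge> N k \<Longrightarrow> norm (X m - X n) < sqrt ((1/8) ^ k)"
    by metis
  \<comment> \<open>Summing \<open>Suc (N i)\<close> makes \<open>r\<close> strictly increasing
    while keeping \<open>r k \<ge> N k\<close>.\<close>
  define r where "r = (\<lambda>k. \<Sum>i\<le>k. Suc (N i))"
  have r_N: "r k \<ge> N k" for k
    unfolding r_def by (cases k) auto
  have r_mono: "strict_mono r" unfolding strict_mono_Suc_iff r_def by simp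
  have r_le: "r k \<le> r (Suc k)" for k using r_mono by (simp add: strict_mono_less_eq)
  have "(norm (X (r (Suc k)) - X (r k)))\<^sup>2 \<le> (1/8) ^ k" for k
  proof -
    have "norm (X (r (Suc k)) - X (r k)) \<le> sqrt ((1/8) ^ k)"
      by (intro N[THEN less_imp_le] r_N order.trans[OF r_N r_le])
    then have "(norm (X (r (Suc k)) - X (r k)))\<^sup>2 \<le> (sqrt ((1/8) ^ k))\<^sup>2"
      by (intro power_mono) auto
    then show ?thesis by simp
  qed
  then have "AE x in lebesgue. summable (\<lambda>k. fn (X (r (Suc k)) - X (r k)) x)"
    by (rule AE_summable_l2)
  moreover have "AE x in lebesgue. \<forall>k. fn (X (r (Suc k)) - X (r k)) x = fn (X (r (Suc k))) x - fn (X (r k)) x"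
    by (intro AE_all_countable[THEN iffD2] allI fn_minus)
  ultimately have conv: "AE x in lebesgue. convergent (\<lambda>k. fn (X (r k)) x)"
  proof eventually_elim
    case (elim x)
    then have "summable (\<lambda>k. fn (X (r (Suc k))) x - fn (X (r k)) x)" by simp
    then have "convergent (\<lambda>n. \<Sum>k<n. fn (X (r (Suc k))) x - fn (X (r k)) x)"
      by (rule summable_iff_convergent[THEN iffD1])
    then have "convergent (\<lambda>n. fn (X (r n)) x - fn (X (r 0)) x)"
      by (subst (asm) sum_lessThan_telescope)
    then show ?case by (simp add: convergent_diff_const_right_iff)
  qed
  define f where "f = (\<lambda>x. lim (\<lambda>k. fn (X (r k)) x))"
  have f_meas [measurable]: "f \<in> borel_measurable lebesgue"
    unfolding f_def by measurable
  have lim: "AE x in lebesgue. (\<lambda>k. fn (X (r k)) x) \<longlonglongrightarrow> f x"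
    using conv by eventually_elim (simp add: f_def convergent_LIMSEQ_iff)
  \<comment> \<open>The limit is compared with an arbitrary fixed \<open>g\<close>, later any late
    member \<open>X m\<close>; this yields convergence of the whole sequence and not only of the
    subsequence.\<close>
  have fatou: "(\<integral>\<^sup>+x. ennreal ((cmod (f x - fn g x))\<^sup>2) \<partial>lebesgue)
      \<le> liminf (\<lambda>k. ennreal ((norm (X (r k) - g))\<^sup>2))" for g
  proof -
    have "(\<integral>\<^sup>+x. ennreal ((cmod (f x - fn g x))\<^sup>2) \<partial>lebesgue) =
        (\<integral>\<^sup>+x. liminf (\<lambda>k. ennreal ((cmod (fn (X (r k)) x - fn g x))\<^sup>2)) \<partial>lebesgue)"
    proof (rule nn_integral_cong_AE, use lim in eventually_elim)
      case (elim x)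
      have "(\<lambda>k. ennreal ((cmod (fn (X (r k)) x - fn g x))\<^sup>2)) \<longlonglongrightarrow> ennreal ((cmod (f x - fn g x))\<^sup>2)"
        by (intro tendsto_intros tendsto_ennrealI elim)
      then show ?case by (intro lim_imp_Liminf[symmetric] trivial_limit_sequentially)
    qed
    also have "\<dots> \<le> liminf (\<lambda>k. \<integral>\<^sup>+x. ennreal ((cmod (fn (X (r k)) x - fn g x))\<^sup>2) \<partial>lebesgue)"
      by (intro nn_integral_liminf) measurable
    also have "(\<lambda>k. \<integral>\<^sup>+x. ennreal ((cmod (fn (X (r k)) x - fn g x))\<^sup>2) \<partial>lebesgue)
        = (\<lambda>k. ennreal ((norm (X (r k) - g))\<^sup>2))"
    proof
      fix k
      show "(\<integral>\<^sup>+x. ennreal ((cmod (fn (X (r k)) x - fn g x))\<^sup>2) \<partial>lebesgue) = ennreal ((norm (X (r k) - g))\<^sup>2)"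
        unfolding nn_integral_fn_sq[symmetric] using fn_minus[of "X (r k)" g]
        by (intro nn_integral_cong_AE) (auto elim: eventually_mono)
    qed
    finally show ?thesis .
  qed
  have close: "(\<integral>\<^sup>+x. ennreal ((cmod (f x - fn (X m) x))\<^sup>2) \<partial>lebesgue) \<le> ennreal ((1/8) ^ k)"
    if "m \<ge> N k" for k m
  proof -
    have "\<forall>\<^sub>F j in sequentially. ennreal ((norm (X (r j) - X m))\<^sup>2) \<le> ennreal ((1/8) ^ k)"
      using eventually_ge_at_top[of k]
    proof eventually_elim
      case (elim j)
      have "r j \<ge> N k" using elim r_mono r_N[of k] by (meson order.trans strict_mono_less_eq)
      then have "norm (X (r j) - X m) \<le> sqrt ((1/8) ^ k)" using that by (intro N[THEN less_imp_le])
      then have "(norm (X (r j) - X m))\<^sup>2 \<le> (sqrt ((1/8) ^ k))\<^sup>2" by (intro power_mono) auto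
      then show ?case by (intro ennreal_leI) simp
    qed
    then have "liminf (\<lambda>j. ennreal ((norm (X (r j) - X m))\<^sup>2)) \<le> ennreal ((1/8) ^ k)"
      by (rule Liminf_le[rotated]) simp
    then show ?thesis using fatou[of "X m"] by (rule order.trans[rotated])
  qed
  have "integrable lebesgue (\<lambda>x. (cmod (f x - fn (X (N 0)) x))\<^sup>2)"
    using close[of 0 "N 0"] by (intro integrableI_bounded) (auto simp: top_unique less_top[symmetric])
  then have "L2 (\<lambda>x. f x - fn (X (N 0)) x)"
    by (simp add: L2_iff)
  from L2_add[OF this L2_fn[of "X (N 0)"]] have L2f: "L2 f" by simp
  have norm_close: "norm (mk f - X m) \<le> sqrt ((1/8) ^ k)" if "m \<ge> N k" for k m
  proof -
    have "ennreal ((norm (mk f - X m))\<^sup>2) = (\<integral>\<^sup>+x. ennreal ((cmod (f x - fn (X m) x))\<^sup>2) \<partial>lebesgue)"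
      unfolding nn_integral_fn_sq[symmetric] using fn_minus[of "mk f" "X m"] fn_mk[OF L2f]
      by (intro nn_integral_cong_AE) (auto elim: eventually_elim2)
    with close[OF that] have "ennreal ((norm (mk f - X m))\<^sup>2) \<le> ennreal ((1/8) ^ k)" by metis
    then have "(norm (mk f - X m))\<^sup>2 \<le> (1/8) ^ k" by (subst (asm) ennreal_le_iff) auto
    then show ?thesis by (rule real_le_rsqrt)
  qed
  have "X \<longlonglongrightarrow> mk f"
  proof (rule LIMSEQ_I)
    fix e :: real assume "e > 0"
    have "(\<lambda>k. sqrt ((1/8) ^ k)) \<longlonglongrightarrow> sqrt 0"
      by (intro tendsto_intros LIMSEQ_realpow_zero) auto
    then obtain k where "sqrt ((1/8) ^ k) < e"
      using \<open>e > 0\<close> by (metis eventually_sequentially order_refl order_tendstoD(2) real_sqrt_zero)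
    then show "\<exists>n0. \<forall>n\<ge>n0. norm (X n - mk f) < e"
      using norm_close[of k] by (metis norm_minus_commute le_less_trans)
  qed
  then show "convergent X" by (auto simp: convergent_def)
qed

section \<open>The Fourier integral\<close>

lemma sigma_finite_lebesgue: "sigma_finite_measure (lebesgue :: real measure)"
proof (unfold_locales)
  show "\<exists>A. countable A \<and> A \<subseteq> sets (lebesgue :: real measure) \<and>
      \<Union> A = space lebesgue \<and> (\<forall>a\<in>A. emeasure lebesgue a \<noteq> \<infinity>)"
  proof (rule exI[of _ "range (\<lambda>n::nat. {- real n..real n})"], intro conjI)
    have "\<exists>n. x \<in> {- real n..real n}" for x
      using real_arch_simple[of "\<bar>x\<bar>"] by (metis abs_le_iff atLeastAtMost_iff minus_le_iff)
    then show "\<Union> (range (\<lambda>n::nat. {- real n..real n})) = space lebesgue" by auto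
  qed auto
qed

interpretation lebesgue: sigma_finite_measure "lebesgue :: real measure"
  by (rule sigma_finite_lebesgue)

interpretation lebesgue2: pair_sigma_finite "lebesgue :: real measure" "lebesgue :: real measure" ..

lemma lebesgue_measurable_ident [measurable]: "(\<lambda>x::real. x) \<in> borel_measurable lebesgue"
  by (rule measurable_completion) simp

lemma lebesgue_pair_measurable [measurable]:
  "fst \<in> borel_measurable ((lebesgue :: real measure) \<Otimes>\<^sub>M (lebesgue :: real measure))"
  "snd \<in> borel_measurable ((lebesgue :: real measure) \<Otimes>\<^sub>M (lebesgue :: real measure))"
  using measurable_compose[OF measurable_fst lebesgue_measurable_ident]
    measurable_compose[OF measurable_snd lebesgue_measurable_ident] by auto

lemma integrable_kernel:
  fixes f g :: "real \<Rightarrow> complex"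
  assumes f: "integrable lebesgue f" and g: "integrable lebesgue g"
    and k [measurable]: "(\<lambda>(x, y). k x y) \<in> borel_measurable (lebesgue \<Otimes>\<^sub>M lebesgue)"
    and bound: "\<And>x y. cmod (k x y) \<le> B"
  shows "integrable (lebesgue \<Otimes>\<^sub>M lebesgue) (\<lambda>(x, y). f x * k x y * g y)"
proof (rule lebesgue2.Fubini_integrable)
  note [measurable] = borel_measurable_integrable[OF f] borel_measurable_integrable[OF g]
  show [measurable]: "(\<lambda>(x, y). f x * k x y * g y) \<in> borel_measurable (lebesgue \<Otimes>\<^sub>M lebesgue)"
    by measurable
  have ky [measurable]: "k x \<in> borel_measurable lebesgue" for x
    using measurable_compose_Pair1[of x lebesgue "\<lambda>(x, y). k x y" lebesgue borel] k by simp
  have B: "B \<ge> 0" using bound[of 0 0] norm_ge_zero order.trans by blast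
  have int: "integrable lebesgue (\<lambda>y. f x * k x y * g y)" for x
  proof (rule Bochner_Integration.integrable_bound)
    show "integrable lebesgue (\<lambda>y. cmod (f x) * B * cmod (g y))" using g by simp
    show "AE y in lebesgue. norm (f x * k x y * g y) \<le> norm (cmod (f x) * B * cmod (g y))"
      using B bound by (auto simp: norm_mult intro!: mult_right_mono mult_left_mono)
  qed measurable
  then show "AE x in lebesgue. integrable lebesgue (\<lambda>y. case (x, y) of (x, y) \<Rightarrow> f x * k x y * g y)" by simp
  show "integrable lebesgue (\<lambda>x. LINT y|lebesgue. norm (case (x, y) of (x, y) \<Rightarrow> f x * k x y * g y))"
  proof (rule Bochner_Integration.integrable_bound)
    show "integrable lebesgue (\<lambda>x. cmod (f x) * B * (LINT y|lebesgue. cmod (g y)))" using f by simp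
    show "AE x in lebesgue. norm (LINT y|lebesgue. norm (case (x, y) of (x, y) \<Rightarrow> f x * k x y * g y))
      \<le> norm (cmod (f x) * B * (LINT y|lebesgue. cmod (g y)))"
    proof (intro AE_I2)
      fix x
      have "(LINT y|lebesgue. norm (f x * k x y * g y)) \<le> (LINT y|lebesgue. cmod (f x) * B * cmod (g y))"
        using int[of x] g B bound
        by (intro integral_mono integrable_norm) (auto simp: norm_mult intro!: mult_right_mono mult_left_mono)
      then show "norm (LINT y|lebesgue. norm (case (x, y) of (x, y) \<Rightarrow> f x * k x y * g y))
          \<le> norm (cmod (f x) * B * (LINT y|lebesgue. cmod (g y)))"
        using B by (simp add: Bochner_Integration.integral_nonneg)
    qed
  qed measurable
qed

lemma Fubini_kernel:
  fixes f g :: "real \<Rightarrow> complex"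
  assumes "integrable lebesgue f" "integrable lebesgue g"
    and "(\<lambda>(x, y). k x y) \<in> borel_measurable (lebesgue \<Otimes>\<^sub>M lebesgue)" "\<And>x y. cmod (k x y) \<le> B"
  shows "(LINT y|lebesgue. (LINT x|lebesgue. f x * k x y) * g y) =
    (LINT x|lebesgue. f x * (LINT y|lebesgue. k x y * g y))"
  using lebesgue2.Fubini_integral[OF integrable_kernel[OF assms]]
  by (simp only: integral_mult_left_zero[symmetric] integral_mult_right_zero[symmetric] mult.assoc)

text \<open>The Fourier integral evaluated at every point. If \<open>g\<close> is not integrable the
  integral is 0 by convention, so the value carries meaning only for integrable \<open>g\<close>;
  the transform on \<open>l2\<close> is obtained from it by truncation.\<close>

definition ft :: "real \<Rightarrow> (real \<Rightarrow> complex) \<Rightarrow> real \<Rightarrow> complex" where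
  "ft h g p = of_real (1 / sqrt (2 * pi * h)) *
     (LINT x|lebesgue. exp (- (\<i> * of_real (p * x / h))) * g x)"

lemma truncated_fourier_eq_ft: "truncated_fourier h R f = ft h (cut {-R..R} f)"
  unfolding truncated_fourier_def ft_def
  by (intro ext arg_cong2[where f="(*)"] refl)
     (simp add: integral_restrict_space scaleR_conv_of_real mult_ac of_real_indicator)

lemma cmod_exp_i [simp]: "cmod (exp (- (\<i> * of_real t))) = 1" "cmod (exp (\<i> * of_real t)) = 1"
  by (simp_all add: norm_exp_eq_Re)

lemma exp_kernel_measurable [measurable]:
  "(\<lambda>(x, y). exp (- (\<i> * of_real (x * y / h)))) \<in> borel_measurable (lebesgue \<Otimes>\<^sub>M (lebesgue :: real measure))"
  by measurable

lemma ft_integrand_measurable [measurable]: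
  assumes [measurable]: "g \<in> borel_measurable lebesgue"
  shows "(\<lambda>x. exp (- (\<i> * of_real (p * x / h))) * g x) \<in> borel_measurable lebesgue"
  by measurable

lemma ft_integrable:
  assumes "integrable lebesgue g"
  shows "integrable lebesgue (\<lambda>x. exp (- (\<i> * of_real (p * x / h))) * g x)"
proof (rule Bochner_Integration.integrable_bound[OF assms])
  note [measurable] = borel_measurable_integrable[OF assms]
  show "(\<lambda>x. exp (- (\<i> * of_real (p * x / h))) * g x) \<in> borel_measurable lebesgue" by measurable
qed (simp add: norm_mult)

lemma ft_bound:
  assumes "h > 0"
  shows "cmod (ft h g p) \<le> 1 / sqrt (2 * pi * h) * (LINT x|lebesgue. cmod (g x))"
proof -
  have "cmod (LINT x|lebesgue. exp (- (\<i> * of_real (p * x / h))) * g x)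
      \<le> (LINT x|lebesgue. cmod (exp (- (\<i> * of_real (p * x / h))) * g x))"
    by (rule integral_norm_bound)
  also have "\<dots> = (LINT x|lebesgue. cmod (g x))" by (simp add: norm_mult)
  finally show ?thesis
    unfolding ft_def norm_mult norm_of_real using assms by (intro mult_mono) auto
qed

lemma ft_measurable [measurable]:
  assumes [measurable]: "g \<in> borel_measurable lebesgue"
  shows "ft h g \<in> borel_measurable lebesgue"
  unfolding ft_def by measurable

lemma ft_mult_integrable:
  assumes "h > 0" "integrable lebesgue g" "integrable lebesgue u"
  shows "integrable lebesgue (\<lambda>p. ft h g p * u p)"
proof (rule Bochner_Integration.integrable_bound)
  note [measurable] = assms(2,3)[THEN borel_measurable_integrable]
  let ?B = "1 / sqrt (2 * pi * h) * (LINT x|lebesgue. cmod (g x))"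
  show "integrable lebesgue (\<lambda>p. ?B * cmod (u p))" using assms by simp
  show "(\<lambda>p. ft h g p * u p) \<in> borel_measurable lebesgue" by measurable
  show "AE p in lebesgue. norm (ft h g p * u p) \<le> norm (?B * cmod (u p))"
  proof (intro AE_I2)
    fix p
    have "cmod (ft h g p) * cmod (u p) \<le> ?B * cmod (u p)"
      by (intro mult_right_mono ft_bound assms) auto
    also have "\<dots> \<le> norm (?B * cmod (u p))" by (simp only: real_norm_def abs_ge_self)
    finally show "norm (ft h g p * u p) \<le> norm (?B * cmod (u p))" by (simp only: norm_mult)
  qed
qed

text \<open>Fubini for a kernel that is symmetric in its two variables. No conjugate appears; both
  the damped Plancherel identity and self-adjointness come from here.\<close>

lemma ft_multiplication_formula:
  assumes "integrable lebesgue g" "integrable lebesgue u"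
  shows "(LINT p|lebesgue. ft h g p * u p) = (LINT x|lebesgue. g x * ft h u x)"
proof -
  let ?c = "complex_of_real (1 / sqrt (2 * pi * h))"
  let ?k = "\<lambda>x y :: real. exp (- (\<i> * complex_of_real (x * y / h)))"
  have "(LINT p|lebesgue. (LINT x|lebesgue. g x * ?k x p) * u p) =
      (LINT x|lebesgue. g x * (LINT p|lebesgue. ?k x p * u p))"
    by (rule Fubini_kernel[OF assms exp_kernel_measurable, where B=1]) simp
  then have "?c * (LINT p|lebesgue. (LINT x|lebesgue. g x * ?k x p) * u p) =
      ?c * (LINT x|lebesgue. g x * (LINT p|lebesgue. ?k x p * u p))"
    by simp
  then show ?thesis
    unfolding ft_def by (simp only: integral_mult_right_zero[symmetric] mult_ac)
qed

lemma ft_cong_AE: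
  assumes [measurable]: "f \<in> borel_measurable lebesgue" "g \<in> borel_measurable lebesgue"
    and "AE x in lebesgue. f x = g x"
  shows "ft h f = ft h g"
  unfolding ft_def using assms(3)
  by (intro ext arg_cong2[where f="(*)"] refl integral_cong_AE ft_integrand_measurable assms) (elim eventually_mono, simp)

lemma ft_add: "integrable lebesgue f \<Longrightarrow> integrable lebesgue g \<Longrightarrow> ft h (\<lambda>x. f x + g x) p = ft h f p + ft h g p"
  unfolding ft_def by (simp add: distrib_left ft_integrable del: of_real_mult of_real_divide)

lemma ft_cmult: "ft h (\<lambda>x. c * f x) p = c * ft h f p"
  unfolding ft_def by (simp add: mult.left_commute[of _ c] del: of_real_mult of_real_divide)

text \<open>The characteristic function of the standard normal distribution, read through the
  substitution \<open>z = e / h * p\<close>. As \<open>e\<close> tends to 0 the Gaussian weight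
  tends to 1 and the density on the right becomes an approximate identity.\<close>

lemma ft_gaussian:
  assumes "h > 0" "e > 0"
  shows "ft h (\<lambda>p. of_real (1 / sqrt (2 * pi * h)) * of_real (exp (- (e * p / h)\<^sup>2 / 2)) * exp (\<i> * of_real (p * x / h))) y
    = of_real (normal_density 0 e (y - x))"
proof -
  let ?s = "std_normal_density"
  have "char std_normal_distribution (- (y - x) / e) = of_real (exp (- ((y - x) / e)\<^sup>2 / 2))"
    by (simp add: char_std_normal_distribution power_divide power2_commute)
  also have "char std_normal_distribution (- (y - x) / e) =
      (LINT z|lebesgue. ?s z *\<^sub>R iexp (- (y - x) / e * z))"
    unfolding char_def by (subst integral_density) (auto simp: integral_completion)
  also have "\<dots> = \<bar>e / h\<bar> *\<^sub>R (LINT p|lebesgue. ?s (0 + e / h * p) *\<^sub>R iexp (- (y - x) / e * (0 + e / h * p)))"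
    using assms by (intro lebesgue_integral_real_affine) auto
  also have "\<dots> = of_real (e / h / sqrt (2 * pi)) *
      (LINT p|lebesgue. of_real (exp (- (e * p / h)\<^sup>2 / 2)) * exp (\<i> * of_real (- (y - x) * p / h)))"
    using assms by (simp add: std_normal_density_def scaleR_conv_of_real mult.assoc)
  finally have *: "of_real (e / h / sqrt (2 * pi)) *
      (LINT p|lebesgue. of_real (exp (- (e * p / h)\<^sup>2 / 2)) * exp (\<i> * of_real (- (y - x) * p / h)))
       = complex_of_real (exp (- ((y - x) / e)\<^sup>2 / 2))" by simp
  have "ft h (\<lambda>p. of_real (1 / sqrt (2 * pi * h)) * of_real (exp (- (e * p / h)\<^sup>2 / 2)) * exp (\<i> * of_real (p * x / h))) y
    = of_real (1 / sqrt (2 * pi * h)) * of_real (1 / sqrt (2 * pi * h)) *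
      (LINT p|lebesgue. of_real (exp (- (e * p / h)\<^sup>2 / 2)) * exp (\<i> * of_real (- (y - x) * p / h)))"
  proof -
    have "exp (- (\<i> * of_real (y * p / h))) * (of_real (1 / sqrt (2 * pi * h)) * of_real (exp (- (e * p / h)\<^sup>2 / 2)) * exp (\<i> * of_real (p * x / h)))
      = of_real (1 / sqrt (2 * pi * h)) * (of_real (exp (- (e * p / h)\<^sup>2 / 2)) * exp (\<i> * of_real (- (y - x) * p / h)))" for p
    proof -
      have "exp (\<i> * of_real (- (y - x) * p / h)) = exp (- (\<i> * of_real (y * p / h))) * exp (\<i> * of_real (p * x / h))"
        unfolding exp_add[symmetric] by (simp add: algebra_simps diff_divide_distrib)
      then show ?thesis by (simp only: mult_ac)
    qed
    then show ?thesis unfolding ft_def by (simp only: integral_mult_right_zero mult.assoc)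
  qed
  also have "of_real (1 / sqrt (2 * pi * h)) * of_real (1 / sqrt (2 * pi * h))
      = complex_of_real (1 / (sqrt (2 * pi) * e) * (e / h / sqrt (2 * pi)))"
    unfolding of_real_mult[symmetric] using assms by (simp add: field_simps)
  also have "\<dots> * (LINT p|lebesgue. of_real (exp (- (e * p / h)\<^sup>2 / 2)) * exp (\<i> * of_real (- (y - x) * p / h)))
    = of_real (1 / (sqrt (2 * pi) * e)) * of_real (exp (- ((y - x) / e)\<^sup>2 / 2))"
    unfolding of_real_mult[of "1 / (sqrt (2 * pi) * e)"] mult.assoc * ..
  also have "\<dots> = of_real (normal_density 0 e (y - x))"
    using assms by (simp add: normal_density_def real_sqrt_mult power_divide)
  finally show ?thesis .
qed

section \<open>Projections and density\<close>

lemma l2_dominated_convergence: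
  assumes s [measurable]: "\<And>n. s n \<in> borel_measurable lebesgue" and f: "f \<in> borel_measurable lebesgue"
    and lim: "AE x in lebesgue. (\<lambda>n. s n x) \<longlonglongrightarrow> f x"
    and bound: "\<And>n. AE x in lebesgue. cmod (s n x) \<le> cmod (w x)" and w: "L2 w"
  shows "\<And>n. L2 (s n)" "L2 f" "(\<lambda>n. mk (s n)) \<longlonglongrightarrow> mk f"
proof -
  note [measurable] = f L2_measurable[OF w]
  have w2: "integrable lebesgue (\<lambda>x. (cmod (w x))\<^sup>2)" using w by (simp add: L2_iff)
  have sq: "(cmod a)\<^sup>2 \<le> (cmod b)\<^sup>2" if "cmod a \<le> cmod b" for a b
    using that by (intro power_mono) auto
  have "integrable lebesgue (\<lambda>x. (cmod (s n x))\<^sup>2)" for n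
    by (rule Bochner_Integration.integrable_bound[OF w2], measurable)
       (use bound[of n] in \<open>auto intro: sq elim!: eventually_mono\<close>)
  then show L2s: "L2 (s n)" for n by (simp add: L2_iff)
  have "AE x in lebesgue. \<forall>n. cmod (s n x) \<le> cmod (w x)"
    using bound by (simp add: AE_all_countable)
  then have bf: "AE x in lebesgue. cmod (f x) \<le> cmod (w x)"
    using lim
  proof eventually_elim
    case (elim x)
    from elim(2) have "(\<lambda>n. cmod (s n x)) \<longlonglongrightarrow> cmod (f x)" by (intro tendsto_norm)
    then show ?case using elim(1) by (intro LIMSEQ_le_const2) auto
  qed
  have "integrable lebesgue (\<lambda>x. (cmod (f x))\<^sup>2)"
    by (rule Bochner_Integration.integrable_bound[OF w2], measurable)
       (use bf in \<open>auto intro: sq elim!: eventually_mono\<close>)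
  then show L2f: "L2 f" using f by (simp add: L2_iff)
  have "(\<lambda>n. LINT x|lebesgue. (cmod (s n x - f x))\<^sup>2) \<longlonglongrightarrow> (LINT (x::real)|lebesgue. 0 :: real)"
  proof (rule integral_dominated_convergence[where w="\<lambda>x. 4 * (cmod (w x))\<^sup>2"])
    show "AE x in lebesgue. (\<lambda>n. (cmod (s n x - f x))\<^sup>2) \<longlonglongrightarrow> 0"
      using lim by eventually_elim (auto intro!: tendsto_eq_intros)
    show "AE x in lebesgue. norm ((cmod (s n x - f x))\<^sup>2) \<le> 4 * (cmod (w x))\<^sup>2" for n
      using bound[of n] bf
    proof eventually_elim
      case (elim x)
      have "cmod (s n x - f x) \<le> 2 * cmod (w x)"
        using norm_triangle_ineq4[of "s n x" "f x"] elim by linarith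
      then have "(cmod (s n x - f x))\<^sup>2 \<le> (2 * cmod (w x))\<^sup>2" by (intro power_mono) auto
      then show ?case by (simp add: power_mult_distrib)
    qed
    show "(\<lambda>x. (cmod (s n x - f x))\<^sup>2) \<in> borel_measurable lebesgue" for n by measurable
    show "integrable lebesgue (\<lambda>x. 4 * (cmod (w x))\<^sup>2)" using w2 by simp
  qed auto
  then have "(\<lambda>n. (norm (mk (s n) - mk f))\<^sup>2) \<longlonglongrightarrow> 0"
    using L2s L2f by (simp add: mk_diff[symmetric] norm_mk_sq L2_diff)
  then have "(\<lambda>n. sqrt ((norm (mk (s n) - mk f))\<^sup>2)) \<longlonglongrightarrow> sqrt 0"
    by (rule tendsto_real_sqrt)
  then show "(\<lambda>n. mk (s n)) \<longlonglongrightarrow> mk f"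
    by (simp add: LIM_zero_iff tendsto_norm_zero_iff)
qed

definition proj :: "real set \<Rightarrow> l2 \<Rightarrow> l2" where
  "proj X f = mk (cut X (fn f))"

lemma fn_proj: "X \<in> sets lebesgue \<Longrightarrow> AE x in lebesgue. fn (proj X f) x = indicator X x * fn f x"
  unfolding proj_def by (intro fn_mk L2_indicator) auto

lemma proj_mk:
  assumes "X \<in> sets lebesgue" "L2 f"
  shows "proj X (mk f) = mk (cut X f)"
  unfolding proj_def using assms fn_mk[OF assms(2)]
  by (intro mk_eqI L2_indicator) (auto elim: eventually_mono)

lemma proj_mk_indicator:
  assumes "S \<in> sets lebesgue" "L2 f"
  shows "proj S (mk (cut S f)) = mk (cut S f)"
  using assms by (simp add: proj_mk L2_indicator indicator_inter_arith[symmetric] mult.assoc[symmetric])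

lemma proj_add:
  assumes "X \<in> sets lebesgue"
  shows "proj X (f + g) = proj X f + proj X g"
proof -
  have "proj X (f + g) = mk (\<lambda>x. indicator X x * fn f x + indicator X x * fn g x)"
    unfolding proj_def using assms fn_plus[of f g]
    by (intro mk_eqI L2_indicator L2_add) (auto elim: eventually_mono simp: distrib_left)
  then show ?thesis using assms by (simp add: mk_add L2_indicator proj_def)
qed

lemma proj_scaleR:
  assumes "X \<in> sets lebesgue"
  shows "proj X (r *\<^sub>R f) = r *\<^sub>R proj X f"
proof -
  have "proj X (r *\<^sub>R f) = mk (\<lambda>x. r *\<^sub>R (indicator X x * fn f x))"
    unfolding proj_def using assms fn_scaleR[of r f]
    by (intro mk_eqI L2_indicator L2_scaleR) (auto elim: eventually_mono)
  then show ?thesis using assms by (simp add: mk_scaleR L2_indicator proj_def)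
qed

lemma proj_proj:
  assumes "X \<in> sets lebesgue" "Y \<in> sets lebesgue"
  shows "proj X (proj Y f) = proj (X \<inter> Y) f"
proof -
  have "proj X (proj Y f) = mk (\<lambda>x. indicator X x * (indicator Y x * fn f x))"
    unfolding proj_def[of Y] using assms by (simp add: proj_mk L2_indicator)
  then show ?thesis
    unfolding proj_def by (simp add: indicator_inter_arith mult.assoc)
qed

lemma inner_proj:
  assumes "X \<in> sets lebesgue"
  shows "proj X f \<bullet> g = (LINT x|lebesgue. indicator X x * (fn f x \<bullet> fn g x))"
proof -
  note [measurable] = assms
  show ?thesis
    unfolding inner_l2_def using fn_proj[OF assms, of f]
    by (intro integral_cong_AE) (measurable, auto elim!: eventually_mono simp: indicator_def)
qed

lemma proj_selfadjoint: "X \<in> sets lebesgue \<Longrightarrow> proj X f \<bullet> g = f \<bullet> proj X g"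
  using inner_proj[of X f g] inner_proj[of X g f] by (simp add: inner_commute)

lemma inner_proj_self:
  assumes "X \<in> sets lebesgue"
  shows "proj X f \<bullet> f = (norm (proj X f))\<^sup>2"
proof -
  have "proj X f \<bullet> proj X f = f \<bullet> proj X (proj X f)" by (rule proj_selfadjoint[OF assms])
  then show ?thesis using assms by (simp add: power2_norm_eq_inner proj_proj inner_commute)
qed

lemma norm_proj_le: "X \<in> sets lebesgue \<Longrightarrow> norm (proj X f) \<le> norm f"
proof -
  assume X: "X \<in> sets lebesgue"
  have "(norm (proj X f))\<^sup>2 = proj X f \<bullet> f"
    using X by (simp add: inner_proj_self)
  also have "\<dots> \<le> norm (proj X f) * norm f" by (rule norm_cauchy_schwarz)
  finally show ?thesis
    using norm_ge_zero[of "proj X f"] by (cases "norm (proj X f) = 0") (auto simp: power2_eq_square)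
qed

lemma bounded_linear_proj: "X \<in> sets lebesgue \<Longrightarrow> bounded_linear (proj X)"
  by (intro bounded_linear_intro[of _ 1]) (auto simp: proj_add proj_scaleR norm_proj_le)

lemma proj_tendsto: "((\<lambda>R. proj {-R..R} f) \<longlongrightarrow> f) at_top"
proof (rule tendsto_at_topI_sequentially)
  fix R :: "nat \<Rightarrow> real" assume R: "filterlim R at_top sequentially"
  have "(\<lambda>n. mk (cut {-R n..R n} (fn f))) \<longlonglongrightarrow> mk (fn f)"
  proof (rule l2_dominated_convergence[where w="fn f"])
    show "AE x in lebesgue. (\<lambda>n. indicator {-R n..R n} x * fn f x) \<longlonglongrightarrow> fn f x"
    proof (intro AE_I2 tendsto_eventually)
      fix x
      have "eventually (\<lambda>n. R n \<ge> \<bar>x\<bar>) sequentially"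
        using R by (simp add: filterlim_at_top)
      then show "eventually (\<lambda>n. indicator {-R n..R n} x * fn f x = fn f x) sequentially"
        by eventually_elim (auto simp: indicator_def)
    qed
    show "AE x in lebesgue. cmod (indicator {- R n..R n} x * fn f x) \<le> cmod (fn f x)" for n
      by (intro AE_I2) (auto simp: indicator_def)
  qed auto
  then show "(\<lambda>n. proj {-R n..R n} f) \<longlonglongrightarrow> f" by (simp add: proj_def)
qed

section \<open>Density of step functions\<close>

lemma borel_AE_rep:
  assumes "f \<in> borel_measurable (lebesgue :: real measure)"
  shows "\<exists>f'. (f' :: real \<Rightarrow> complex) \<in> borel_measurable borel \<and> (AE x in lebesgue. f x = f' x)"
proof -
  have "\<exists>g'\<in>borel_measurable lborel. AE x in lborel. Re (f x) = g' x"
    by (intro completion_ex_borel_measurable_real) (use assms in measurable)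
  moreover have "\<exists>g'\<in>borel_measurable lborel. AE x in lborel. Im (f x) = g' x"
    by (intro completion_ex_borel_measurable_real) (use assms in measurable)
  ultimately obtain u v where uv: "u \<in> borel_measurable borel" "v \<in> borel_measurable borel"
      "AE x in lborel. Re (f x) = u x" "AE x in lborel. Im (f x) = v x" by auto
  have "AE x in lborel. f x = of_real (u x) + \<i> * of_real (v x)"
    using uv(3,4) by eventually_elim (simp add: complex_eq_iff)
  then have "AE x in lebesgue. f x = of_real (u x) + \<i> * of_real (v x)"
    by (rule AE_completion)
  moreover have "(\<lambda>x. of_real (u x) + \<i> * of_real (v x)) \<in> borel_measurable borel"
    using uv by measurable
  ultimately show ?thesis by blast
qed

lemma L2_indicator_Int_Icc:
  assumes "A \<in> sets borel"
  shows "L2 (\<lambda>x::real. indicator (A \<inter> {-R..R}) x * c)"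
proof (rule L2_bound)
  have "emeasure lborel (A \<inter> {-R..R}) \<le> emeasure lborel {-R..R}"
    using assms by (intro emeasure_mono) auto
  also have "\<dots> < \<infinity>" by (simp add: emeasure_lborel_Icc_eq)
  finally show "integrable lebesgue (\<lambda>x. indicator (A \<inter> {-R..R}) x * (cmod c)\<^sup>2)"
    using assms by (intro integrable_mult_left integrable_real_indicator) auto
  show "(\<lambda>x. indicator (A \<inter> {- R..R}) x * c) \<in> borel_measurable lebesgue"
    using assms by (intro measurable_completion) (auto simp: measurable_lborel1)
qed (auto simp: indicator_def)

text \<open>Dynkin's argument for vectors: indicators of Borel sets are reached from intervals by
  complements and disjoint unions, simple functions by linearity, and the rest by dominated
  convergence. The representative from \<open>borel_AE_rep\<close> is what reduces Lebesgue
  measurability to Borel sets.\<close>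

theorem l2_subspace_dense:
  assumes V: "subspace V" "closed V"
    and intervals: "\<And>a b c. a \<le> b \<Longrightarrow> mk (\<lambda>x. indicator {a..b} x * c) \<in> V"
  shows "f \<in> V"
proof -
  \<comment> \<open>Cutting every set to \<open>{-R..R}\<close> keeps its indicator
    square-integrable, in particular that of a complement.\<close>
  have sets: "mk (\<lambda>x. indicator (A \<inter> {-R..R}) x * c) \<in> V" if "A \<in> sets borel" for A R c
  proof -
    have "mk (\<lambda>x. 0 * c) \<in> V" using subspace_0[OF V(1)] by (simp add: zero_l2_def)
    then have z: "mk (\<lambda>x. 0) \<in> V" by simp
    have int: "mk (\<lambda>x. indicator {a..b} x * c) \<in> V" for a b
      using intervals[of a b c] z by (cases "a \<le> b") auto
    have "Int_stable (range (\<lambda>(a, b). {a..b} :: real set))"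
      by (auto simp: Int_stable_def)
    moreover have "range (\<lambda>(a, b). {a..b} :: real set) \<subseteq> Pow UNIV" by simp
    moreover have "A \<in> sigma_sets UNIV (range (\<lambda>(a, b). {a..b}))"
      using that by (simp add: borel_eq_atLeastAtMost)
    ultimately show ?thesis
    proof (induction rule: sigma_sets_induct_disjoint[consumes 3])
      case (basic A)
      then obtain a b where "A = {a..b}" by auto
      then show ?case using int[of "max a (-R)" "min b R"] by simp
    next
      case empty
      then show ?case using z by simp
    next
      case (compl A)
      then have A: "A \<in> sets borel" by (simp add: borel_eq_atLeastAtMost)
      have "mk (\<lambda>x. indicator (UNIV \<inter> {-R..R}) x * c) - mk (\<lambda>x. indicator (A \<inter> {-R..R}) x * c) \<in> V"
        using int compl by (intro subspace_diff V) auto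
      also have "mk (\<lambda>x. indicator (UNIV \<inter> {-R..R}) x * c) - mk (\<lambda>x. indicator (A \<inter> {-R..R}) x * c)
        = mk (\<lambda>x. indicator ((UNIV - A) \<inter> {-R..R}) x * c)"
        unfolding mk_diff[symmetric, OF L2_indicator_Int_Icc[OF sets.top] L2_indicator_Int_Icc[OF A], simplified space_borel]
        by (intro arg_cong[where f=mk] ext) (auto simp: indicator_def)
      finally show ?case .
    next
      case (union A)
      then have A: "A i \<in> sets borel" for i by (auto simp: borel_eq_atLeastAtMost)
      let ?S = "\<lambda>n x. indicator ((\<Union>i<n. A i) \<inter> {-R..R}) x * c"
      have "mk (?S n) \<in> V" for n
      proof (induction n)
        case 0
        then show ?case using z by simp
      next
        case (Suc n)
        have "mk (?S n) + mk (\<lambda>x. indicator (A n \<inter> {-R..R}) x * c) \<in> V"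
          by (intro subspace_add V Suc union)
        also have "mk (?S n) + mk (\<lambda>x. indicator (A n \<inter> {-R..R}) x * c) = mk (?S (Suc n))"
        proof -
          have "x \<in> A n \<Longrightarrow> i < n \<Longrightarrow> x \<notin> A i" for x i
            using disjoint_family_onD[OF union.hyps(1), of i n] by auto
          then have "?S n x + indicator (A n \<inter> {-R..R}) x * c = ?S (Suc n) x" for x
            by (auto simp: indicator_def less_Suc_eq)
          then show ?thesis
            using A by (subst mk_add[symmetric]) (auto intro!: L2_indicator_Int_Icc)
        qed
        finally show ?case .
      qed
      moreover have "(\<lambda>n. mk (?S n)) \<longlonglongrightarrow> mk (\<lambda>x. indicator ((\<Union>i. A i) \<inter> {-R..R}) x * c)"
      proof (rule l2_dominated_convergence[where w="\<lambda>x. indicator (UNIV \<inter> {-R..R}) x * c"])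
        show "?S n \<in> borel_measurable lebesgue" for n
          using A by (intro L2_measurable L2_indicator_Int_Icc) auto
        show "(\<lambda>x. indicator ((\<Union>i. A i) \<inter> {-R..R}) x * c) \<in> borel_measurable lebesgue"
          using A by (intro L2_measurable L2_indicator_Int_Icc) auto
        show "AE x in lebesgue. (\<lambda>n. ?S n x) \<longlonglongrightarrow> indicator ((\<Union>i. A i) \<inter> {-R..R}) x * c"
        proof (intro AE_I2 tendsto_eventually)
          fix x
          show "\<forall>\<^sub>F n in sequentially. ?S n x = indicator ((\<Union>i. A i) \<inter> {-R..R}) x * c"
          proof (cases "\<exists>i. x \<in> A i")
            case True
            then obtain i where "x \<in> A i" by auto
            then show ?thesis
              by (intro eventually_mono[OF eventually_gt_at_top[of i]]) (auto simp: indicator_def)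
          qed (auto simp: indicator_def)
        qed
        show "L2 (\<lambda>x. indicator (UNIV \<inter> {-R..R}) x * c)" by (intro L2_indicator_Int_Icc) auto
        show "AE x in lebesgue. cmod (?S n x) \<le> cmod (indicator (UNIV \<inter> {-R..R}) x * c)" for n
          by (intro AE_I2) (simp add: indicator_def)
      qed
      ultimately show ?case by (rule closed_sequentially[OF V(2)])
    qed
  qed
  obtain f' where f' [measurable]: "f' \<in> borel_measurable borel" and ff': "AE x in lebesgue. fn f x = f' x"
    using borel_AE_rep[OF fn_measurable] by blast
  have f'_leb [measurable]: "f' \<in> borel_measurable lebesgue"
    by (rule measurable_completion) (simp add: measurable_lborel1)
  have L2f': "L2 f'"
    unfolding L2_iff using integrable_fn_sq[of f] ff'
    by (auto intro: integrable_cong_AE_imp elim: eventually_mono)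
  have f_eq: "f = mk f'" using mk_eqI[OF L2_fn L2f' ff'] by simp
  obtain F where F: "\<And>i. simple_function borel (F i)" "\<And>x. (\<lambda>i. F i x) \<longlonglongrightarrow> f' x"
      "\<And>i x. cmod (F i x) \<le> 2 * cmod (f' x)"
    using borel_measurable_implies_sequence_metric[OF f', of 0] by auto
  note [measurable] = borel_measurable_simple_function[OF F(1)]
  \<comment> \<open>The cut to \<open>{- real n..real n}\<close> brings the level sets of
    \<open>F n\<close> into the form handled by \<open>sets\<close>.\<close>
  define s where "s = (\<lambda>n x. indicator {- real n..real n} x * F n x)"
  have s_meas: "s n \<in> borel_measurable lebesgue" for n
    unfolding s_def by (rule measurable_completion) (simp add: measurable_lborel1)
  have "mk (s n) \<in> V" for n
  proof -
    have fin: "finite (range (F n))" using F(1)[of n] by (simp add: simple_function_def)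
    have vim: "F n -` {y} \<in> sets borel" for y
      using measurable_sets[OF borel_measurable_simple_function[OF F(1)], of "{y}" n] by simp
    note L2 = L2_indicator_Int_Icc[OF vim] and in_V = sets[OF vim]
    define q where "q = (\<lambda>y x. indicator (F n -` {y} \<inter> {- real n..real n}) x * y)"
    have "finite Y \<Longrightarrow> L2 (\<lambda>x. \<Sum>y\<in>Y. q y x) \<and> mk (\<lambda>x. \<Sum>y\<in>Y. q y x) \<in> V" for Y
    proof (induction Y rule: finite_induct)
      case empty
      then show ?case using subspace_0[OF V(1)] by (simp add: zero_l2_def L2_zero)
    next
      case (insert y Y)
      have "L2 (q y)" "mk (q y) \<in> V" unfolding q_def by (rule L2, rule in_V)
      with insert show ?case
        by (auto simp: mk_add L2_add intro!: subspace_add[OF V(1)])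
    qed
    from this[OF fin] have "mk (\<lambda>x. \<Sum>y\<in>range (F n). indicator (F n -` {y} \<inter> {- real n..real n}) x * y) \<in> V"
      by (simp add: q_def)
    also have "(\<lambda>x. \<Sum>y\<in>range (F n). indicator (F n -` {y} \<inter> {- real n..real n}) x * y) = s n"
    proof
      fix x
      have "(\<Sum>y\<in>range (F n). indicator (F n -` {y} \<inter> {- real n..real n}) x * y)
          = (\<Sum>y\<in>range (F n). if y = F n x then indicator {- real n..real n} x * y else 0)"
        by (intro sum.cong) (auto simp: indicator_def)
      then show "(\<Sum>y\<in>range (F n). indicator (F n -` {y} \<inter> {- real n..real n}) x * y) = s n x"
        using fin by (simp add: s_def sum.delta)
    qed
    finally show ?thesis .
  qed
  moreover have "(\<lambda>n. mk (s n)) \<longlonglongrightarrow> mk f'"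
  proof (rule l2_dominated_convergence[where w="\<lambda>x. 2 * f' x"])
    show "AE x in lebesgue. (\<lambda>n. s n x) \<longlonglongrightarrow> f' x"
    proof (intro AE_I2)
      fix x
      have "eventually (\<lambda>n. real n \<ge> \<bar>x\<bar>) sequentially"
        using filterlim_real_sequentially by (simp add: filterlim_at_top)
      then have "eventually (\<lambda>n. F n x = s n x) sequentially"
        by eventually_elim (auto simp: s_def indicator_def)
      then show "(\<lambda>n. s n x) \<longlonglongrightarrow> f' x" using F(2)[of x] by (rule Lim_transform_eventually[rotated])
    qed
    show "AE x in lebesgue. cmod (s n x) \<le> cmod (2 * f' x)" for n
      using F(3) by (intro AE_I2) (auto simp: s_def indicator_def norm_mult)
  qed (use s_meas L2f' L2_cmult in auto)
  ultimately have "mk f' \<in> V" by (rule closed_sequentially[OF V(2)])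
  then show ?thesis using f_eq by simp
qed

section \<open>Gaussian summation\<close>

lemma norm_integral_le_nn_integral:
  fixes f :: "'a \<Rightarrow> 'b::{banach, second_countable_topology}"
  shows "ennreal (norm (integral\<^sup>L M f)) \<le> (\<integral>\<^sup>+x. ennreal (norm (f x)) \<partial>M)"
  by (cases "integrable M f") (auto simp: not_integrable_integral_eq intro: integral_norm_bound_ennreal)

text \<open>Holds because |f| is at most 1 + |f|^2, which is integrable over a set of finite
  measure.\<close>

lemma integrable_indicator_L2:
  assumes f: "L2 f" and X: "X \<in> sets lebesgue" "emeasure lebesgue X < \<infinity>"
  shows "integrable lebesgue (cut X f)"
proof (rule Bochner_Integration.integrable_bound)
  note [measurable] = L2_measurable[OF f] X(1)
  show "(cut X f) \<in> borel_measurable lebesgue" by measurable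
  show "integrable lebesgue (\<lambda>x. indicator X x + (cmod (f x))\<^sup>2)"
    using f X by (intro Bochner_Integration.integrable_add integrable_real_indicator) (auto simp: L2_iff)
  show "AE x in lebesgue. cmod (indicator X x * f x) \<le> norm (indicator X x + (cmod (f x))\<^sup>2)"
  proof (intro AE_I2)
    fix x
    have "cmod (f x) \<le> 1 + (cmod (f x))\<^sup>2"
      using sum_squares_bound[of 1 "cmod (f x)"] norm_ge_zero[of "f x"] unfolding power_one mult_1_right by linarith
    then show "cmod (indicator X x * f x) \<le> norm (indicator X x + (cmod (f x))\<^sup>2)"
      by (auto simp: indicator_def)
  qed
qed

lemma integrable_gaussian:
  assumes "h > 0" "e > 0"
  shows "integrable lebesgue (\<lambda>p::real. exp (- (e * p / h)\<^sup>2 / 2))"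
proof -
  have "integrable lebesgue std_normal_density"
    by (subst integrable_completion) auto
  then have "integrable lebesgue (\<lambda>p. sqrt (2 * pi) * std_normal_density (0 + e / h * p))"
    using assms by (intro integrable_mult_right lebesgue_integrable_real_affine) auto
  then show ?thesis by (simp add: std_normal_density_def)
qed

lemma cnj_ft: "cnj (ft h g p) = ft h (\<lambda>x. cnj (g x)) (- p)"
proof -
  have "cnj (LINT x|lebesgue. exp (- (\<i> * of_real (p * x / h))) * g x) =
      (LINT x|lebesgue. cnj (exp (- (\<i> * of_real (p * x / h))) * g x))"
    by (rule Bochner_Integration.integral_cnj[symmetric])
  then show ?thesis unfolding ft_def by (simp add: exp_cnj del: Bochner_Integration.integral_cnj)
qed

lemma borel_measurable_cnj [measurable (raw)]:
  "f \<in> borel_measurable M \<Longrightarrow> (\<lambda>x. cnj (f x)) \<in> borel_measurable M"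
  by (rule measurable_compose[of f M borel cnj]) (auto intro!: borel_measurable_continuous_onI continuous_intros)

text \<open>The Gaussian weight restores integrability in momentum, so the multiplication formula
  applies twice. The damped squared norm of the transform becomes the pairing of \<open>g\<close>
  with its convolution by a normal density of width \<open>e\<close>.\<close>

lemma ft_damped:
  assumes "h > 0" "e > 0" and g: "integrable lebesgue g"
  shows "of_real (LINT p|lebesgue. (cmod (ft h g p))\<^sup>2 * exp (- (e * p / h)\<^sup>2 / 2)) =
    (LINT x|lebesgue. g x * (LINT y|lebesgue. cnj (g y) * of_real (normal_density 0 e (y - x))))"
proof -
  define W :: "real \<Rightarrow> complex" where "W = (\<lambda>p. of_real (exp (- (e * p / h)\<^sup>2 / 2)))"
  note [measurable] = borel_measurable_integrable[OF g]
  have W: "integrable lebesgue W"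
    unfolding W_def by (intro integrable_of_real integrable_gaussian assms)
  have W_even: "W (- p) = W p" for p by (simp add: W_def)
  define u where "u = (\<lambda>p. cnj (ft h g p) * W p)"
  have u_eq: "u p = ft h (\<lambda>x. cnj (g x)) (- p) * W p" for p
    by (simp add: u_def cnj_ft)
  have cg: "integrable lebesgue (\<lambda>x. cnj (g x))" using g by simp
  have u: "integrable lebesgue u"
  proof -
    have "integrable lebesgue (\<lambda>p. ft h (\<lambda>x. cnj (g x)) p * W p)"
      by (intro ft_mult_integrable assms cg W)
    from lebesgue_integrable_real_affine[OF this, of "-1" 0] show ?thesis
      by (simp add: u_eq[abs_def] W_even)
  qed
  have *: "ft h u x = (LINT y|lebesgue. cnj (g y) * of_real (normal_density 0 e (y - x)))" for x
  proof -
    \<comment> \<open>\<open>V\<close> is the weight times a character. The multiplication formula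
      moves the transform from \<open>cnj g\<close> onto \<open>V\<close>, and by
      \<open>ft_gaussian\<close> the transform of \<open>V\<close> is a normal density centred at
      \<open>x\<close>.\<close>
    define V where "V = (\<lambda>p. of_real (1 / sqrt (2 * pi * h)) * of_real (exp (- (e * p / h)\<^sup>2 / 2)) * exp (\<i> * of_real (p * x / h)))"
    have V: "integrable lebesgue V"
    proof (rule Bochner_Integration.integrable_bound)
      show "integrable lebesgue (\<lambda>p. 1 / sqrt (2 * pi * h) * exp (- (e * p / h)\<^sup>2 / 2))"
        by (intro integrable_mult_right integrable_gaussian assms)
      show "V \<in> borel_measurable lebesgue" unfolding V_def by measurable
      show "AE p in lebesgue. norm (V p) \<le> norm (1 / sqrt (2 * pi * h) * exp (- (e * p / h)\<^sup>2 / 2))"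
        unfolding V_def norm_mult by (intro AE_I2) (simp only: cmod_exp_i norm_of_real real_norm_def mult_1_right order_refl)
    qed
    have "ft h u x = of_real (1 / sqrt (2 * pi * h)) * (LINT p|lebesgue. exp (- (\<i> * of_real (x * p / h))) * u p)"
      by (simp add: ft_def)
    also have "(LINT p|lebesgue. exp (- (\<i> * of_real (x * p / h))) * u p) =
        (LINT p|lebesgue. exp (\<i> * of_real (p * x / h)) * (ft h (\<lambda>x. cnj (g x)) p * W p))"
      by (subst lebesgue_integral_real_affine[of "-1" _ 0]) (simp_all add: u_eq W_even mult.commute)
    also have "of_real (1 / sqrt (2 * pi * h)) * \<dots> = (LINT p|lebesgue. ft h (\<lambda>x. cnj (g x)) p * V p)"
      unfolding integral_mult_right_zero[symmetric] V_def W_def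
      by (intro Bochner_Integration.integral_cong refl) (simp only: mult_ac)
    also have "\<dots> = (LINT y|lebesgue. cnj (g y) * ft h V y)"
      by (rule ft_multiplication_formula[OF cg V])
    also have "\<dots> = (LINT y|lebesgue. cnj (g y) * of_real (normal_density 0 e (y - x)))"
      unfolding V_def ft_gaussian[OF assms(1,2)] ..
    finally show ?thesis .
  qed
  have "of_real (LINT p|lebesgue. (cmod (ft h g p))\<^sup>2 * exp (- (e * p / h)\<^sup>2 / 2))
     = (LINT p|lebesgue. complex_of_real ((cmod (ft h g p))\<^sup>2 * exp (- (e * p / h)\<^sup>2 / 2)))"
    by (rule integral_complex_of_real[symmetric])
  also have "\<dots> = (LINT p|lebesgue. ft h g p * u p)"
    unfolding of_real_mult complex_norm_square u_def W_def
    by (simp only: mult.assoc)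
  also have "\<dots> = (LINT x|lebesgue. g x * ft h u x)"
    by (rule ft_multiplication_formula[OF g u])
  finally show ?thesis by (simp only: *)
qed

lemma ft_damped_integrable:
  assumes "h > 0" "e > 0" and g: "integrable lebesgue g"
  shows "integrable lebesgue (\<lambda>p. (cmod (ft h g p))\<^sup>2 * exp (- (e * p / h)\<^sup>2 / 2))"
proof (rule Bochner_Integration.integrable_bound)
  note [measurable] = borel_measurable_integrable[OF g]
  let ?B = "1 / sqrt (2 * pi * h) * (LINT x|lebesgue. cmod (g x))"
  show "integrable lebesgue (\<lambda>p. ?B\<^sup>2 * exp (- (e * p / h)\<^sup>2 / 2))"
    by (intro integrable_mult_right integrable_gaussian assms)
  show "(\<lambda>p. (cmod (ft h g p))\<^sup>2 * exp (- (e * p / h)\<^sup>2 / 2)) \<in> borel_measurable lebesgue" by measurable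
  show "AE p in lebesgue. norm ((cmod (ft h g p))\<^sup>2 * exp (- (e * p / h)\<^sup>2 / 2))
      \<le> norm (?B\<^sup>2 * exp (- (e * p / h)\<^sup>2 / 2))"
    unfolding norm_mult
  proof (intro AE_I2 mult_right_mono)
    fix p
    have "(cmod (ft h g p))\<^sup>2 \<le> ?B\<^sup>2"
      by (intro power_mono ft_bound assms) auto
    then show "norm ((cmod (ft h g p))\<^sup>2) \<le> norm (?B\<^sup>2)" by (simp only: real_norm_def abs_power2)
  qed auto
qed

lemma nn_integral_normal_density:
  assumes "e > 0"
  shows "(\<integral>\<^sup>+y. ennreal (normal_density 0 e (y - x)) \<partial>lebesgue) = 1"
    "(\<integral>\<^sup>+y. ennreal (normal_density 0 e (x - y)) \<partial>lebesgue) = 1"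
proof -
  have eq: "normal_density 0 e (y - x) = normal_density x e y" "normal_density 0 e (x - y) = normal_density x e y" for y
    by (auto simp: normal_density_def power2_commute)
  have "(\<integral>\<^sup>+y. ennreal (normal_density x e y) \<partial>lebesgue) = ennreal (LINT y|lborel. normal_density x e y)"
    using assms by (subst nn_integral_completion, intro nn_integral_eq_integral) auto
  then show "(\<integral>\<^sup>+y. ennreal (normal_density 0 e (y - x)) \<partial>lebesgue) = 1"
    "(\<integral>\<^sup>+y. ennreal (normal_density 0 e (x - y)) \<partial>lebesgue) = 1"
    unfolding eq using assms by simp_all
qed

text \<open>Schur's test: \<open>f x * f y\<close> is at most the mean of the two squares, and the
  kernel has mass 1 in each variable.\<close>

lemma schur_normal_density:
  assumes "e > 0" and [measurable]: "f \<in> borel_measurable lebesgue" and f0: "\<And>x. f x \<ge> 0"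
  shows "(\<integral>\<^sup>+x. \<integral>\<^sup>+y. ennreal (f x * f y * normal_density 0 e (y - x)) \<partial>lebesgue \<partial>lebesgue)
    \<le> (\<integral>\<^sup>+x. ennreal ((f x)\<^sup>2) \<partial>lebesgue)"
proof -
  let ?N = "\<lambda>x y. ennreal (normal_density 0 e (y - x))"
  have meas [measurable]: "(\<lambda>z. normal_density 0 e (snd z - fst z)) \<in> borel_measurable (lebesgue \<Otimes>\<^sub>M lebesgue)"
    by measurable
  have "(\<integral>\<^sup>+x. \<integral>\<^sup>+y. ennreal (f x * f y * normal_density 0 e (y - x)) \<partial>lebesgue \<partial>lebesgue)
    \<le> (\<integral>\<^sup>+x. \<integral>\<^sup>+y. ennreal ((f x)\<^sup>2 / 2) * ?N x y + ennreal ((f y)\<^sup>2 / 2) * ?N x y \<partial>lebesgue \<partial>lebesgue)"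
  proof (intro nn_integral_mono)
    fix x y
    have "f x * f y \<le> (f x)\<^sup>2 / 2 + (f y)\<^sup>2 / 2"
      using sum_squares_bound[of "f x" "f y"] by simp
    then have "f x * f y * normal_density 0 e (y - x) \<le> ((f x)\<^sup>2 / 2 + (f y)\<^sup>2 / 2) * normal_density 0 e (y - x)"
      by (intro mult_right_mono) auto
    then have "ennreal (f x * f y * normal_density 0 e (y - x))
        \<le> ennreal ((f x)\<^sup>2 / 2 * normal_density 0 e (y - x) + (f y)\<^sup>2 / 2 * normal_density 0 e (y - x))"
      by (intro ennreal_leI) (simp add: distrib_right)
    then show "ennreal (f x * f y * normal_density 0 e (y - x))
        \<le> ennreal ((f x)\<^sup>2 / 2) * ?N x y + ennreal ((f y)\<^sup>2 / 2) * ?N x y"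
      by (simp add: ennreal_mult''[symmetric] ennreal_plus[symmetric] del: ennreal_plus)
  qed
  also have "\<dots> = (\<integral>\<^sup>+x. \<integral>\<^sup>+y. ennreal ((f x)\<^sup>2 / 2) * ?N x y \<partial>lebesgue \<partial>lebesgue) +
      (\<integral>\<^sup>+x. \<integral>\<^sup>+y. ennreal ((f y)\<^sup>2 / 2) * ?N x y \<partial>lebesgue \<partial>lebesgue)"
    by (subst nn_integral_add[symmetric]) (auto simp: nn_integral_add)
  also have "(\<integral>\<^sup>+x. \<integral>\<^sup>+y. ennreal ((f y)\<^sup>2 / 2) * ?N x y \<partial>lebesgue \<partial>lebesgue) =
      (\<integral>\<^sup>+y. \<integral>\<^sup>+x. ennreal ((f y)\<^sup>2 / 2) * ?N x y \<partial>lebesgue \<partial>lebesgue)"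
    by (rule lebesgue2.Fubini'[symmetric]) measurable
  finally show ?thesis
    by (simp add: nn_integral_cmult nn_integral_normal_density[OF assms(1)] nn_integral_add[symmetric]
        ennreal_plus[symmetric] del: ennreal_plus)
qed

text \<open>The damped norms are bounded through \<open>schur_normal_density\<close> uniformly in
  the width, and Fatou's lemma removes the damping. Fatou gives only an inequality, so the isometry
  needs a separate lower bound.\<close>

lemma ft_bessel:
  assumes h: "h > 0" and g: "integrable lebesgue g" "L2 g"
  shows "L2 (ft h g)" "(LINT p|lebesgue. (cmod (ft h g p))\<^sup>2) \<le> (LINT x|lebesgue. (cmod (g x))\<^sup>2)"
proof -
  note [measurable] = borel_measurable_integrable[OF g(1)]
  let ?n = "\<integral>\<^sup>+x. ennreal ((cmod (g x))\<^sup>2) \<partial>lebesgue"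
  have n: "?n = ennreal (LINT x|lebesgue. (cmod (g x))\<^sup>2)"
    using g(2) by (intro nn_integral_eq_integral) (auto simp: L2_iff)
  define e where "e = (\<lambda>n. 1 / real (Suc n))"
  have e: "e n > 0" for n by (simp add: e_def)
  have damped: "(\<integral>\<^sup>+p. ennreal ((cmod (ft h g p))\<^sup>2 * exp (- (e n * p / h)\<^sup>2 / 2)) \<partial>lebesgue) \<le> ?n" for n
  proof -
    let ?A = "LINT p|lebesgue. (cmod (ft h g p))\<^sup>2 * exp (- (e n * p / h)\<^sup>2 / 2)"
    have "(\<integral>\<^sup>+p. ennreal ((cmod (ft h g p))\<^sup>2 * exp (- (e n * p / h)\<^sup>2 / 2)) \<partial>lebesgue) = ennreal ?A"
      by (intro nn_integral_eq_integral ft_damped_integrable h e g) auto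
    also have "\<dots> = ennreal (cmod (of_real ?A))"
      by (simp add: Bochner_Integration.integral_nonneg)
    also have "\<dots> = ennreal (cmod (LINT x|lebesgue. g x * (LINT y|lebesgue. cnj (g y) * of_real (normal_density 0 (e n) (y - x)))))"
      by (simp only: ft_damped[OF h e g(1)])
    also have "\<dots> \<le> (\<integral>\<^sup>+x. ennreal (cmod (g x * (LINT y|lebesgue. cnj (g y) * of_real (normal_density 0 (e n) (y - x))))) \<partial>lebesgue)"
      by (rule norm_integral_le_nn_integral)
    also have "\<dots> \<le> (\<integral>\<^sup>+x. \<integral>\<^sup>+y. ennreal (cmod (g x) * cmod (g y) * normal_density 0 (e n) (y - x)) \<partial>lebesgue \<partial>lebesgue)"
    proof (intro nn_integral_mono)
      fix x
      have "ennreal (cmod (g x * (LINT y|lebesgue. cnj (g y) * of_real (normal_density 0 (e n) (y - x)))))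
        = ennreal (cmod (g x)) * ennreal (cmod (LINT y|lebesgue. cnj (g y) * of_real (normal_density 0 (e n) (y - x))))"
        by (simp add: norm_mult ennreal_mult)
      also have "\<dots> \<le> ennreal (cmod (g x)) * (\<integral>\<^sup>+y. ennreal (cmod (cnj (g y) * of_real (normal_density 0 (e n) (y - x)))) \<partial>lebesgue)"
        by (intro mult_left_mono norm_integral_le_nn_integral) auto
      also have "\<dots> = (\<integral>\<^sup>+y. ennreal (cmod (g x)) * ennreal (cmod (cnj (g y) * of_real (normal_density 0 (e n) (y - x)))) \<partial>lebesgue)"
        by (rule nn_integral_cmult[symmetric]) measurable
      also have "\<dots> = (\<integral>\<^sup>+y. ennreal (cmod (g x) * cmod (g y) * normal_density 0 (e n) (y - x)) \<partial>lebesgue)"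
        by (intro nn_integral_cong) (simp add: norm_mult ennreal_mult[symmetric] mult.assoc)
      finally show "ennreal (cmod (g x * (LINT y|lebesgue. cnj (g y) * of_real (normal_density 0 (e n) (y - x)))))
        \<le> (\<integral>\<^sup>+y. ennreal (cmod (g x) * cmod (g y) * normal_density 0 (e n) (y - x)) \<partial>lebesgue)" .
    qed
    also have "\<dots> \<le> ?n" by (rule schur_normal_density[OF e]) auto
    finally show ?thesis .
  qed
  have "(\<integral>\<^sup>+p. ennreal ((cmod (ft h g p))\<^sup>2) \<partial>lebesgue)
     = (\<integral>\<^sup>+p. liminf (\<lambda>n. ennreal ((cmod (ft h g p))\<^sup>2 * exp (- (e n * p / h)\<^sup>2 / 2))) \<partial>lebesgue)"
  proof (intro nn_integral_cong)
    fix p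
    have "e \<longlonglongrightarrow> 0" unfolding e_def by (rule LIMSEQ_Suc[OF lim_1_over_n])
    then have "(\<lambda>n. (cmod (ft h g p))\<^sup>2 * exp (- (e n * p / h)\<^sup>2 / 2)) \<longlonglongrightarrow> (cmod (ft h g p))\<^sup>2 * exp (- (0 * p / h)\<^sup>2 / 2)"
      using h by (intro tendsto_intros) auto
    then have "(\<lambda>n. ennreal ((cmod (ft h g p))\<^sup>2 * exp (- (e n * p / h)\<^sup>2 / 2))) \<longlonglongrightarrow> ennreal ((cmod (ft h g p))\<^sup>2)"
      by (intro tendsto_ennrealI) simp
    then show "ennreal ((cmod (ft h g p))\<^sup>2) = liminf (\<lambda>n. ennreal ((cmod (ft h g p))\<^sup>2 * exp (- (e n * p / h)\<^sup>2 / 2)))"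
      by (intro lim_imp_Liminf[symmetric] trivial_limit_sequentially)
  qed
  also have "\<dots> \<le> liminf (\<lambda>n. \<integral>\<^sup>+p. ennreal ((cmod (ft h g p))\<^sup>2 * exp (- (e n * p / h)\<^sup>2 / 2)) \<partial>lebesgue)"
    by (intro nn_integral_liminf) measurable
  also have "\<dots> \<le> ?n"
    by (intro Liminf_le always_eventually allI damped) simp
  finally have le: "(\<integral>\<^sup>+p. ennreal ((cmod (ft h g p))\<^sup>2) \<partial>lebesgue) \<le> ?n" .
  have int: "integrable lebesgue (\<lambda>p. (cmod (ft h g p))\<^sup>2)"
    using le n by (intro integrableI_bounded) (auto simp: top_unique less_top[symmetric])
  then show "L2 (ft h g)" by (simp add: L2_iff)
  have "(\<integral>\<^sup>+p. ennreal ((cmod (ft h g p))\<^sup>2) \<partial>lebesgue) = ennreal (LINT p|lebesgue. (cmod (ft h g p))\<^sup>2)"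
    using int by (intro nn_integral_eq_integral) auto
  with le n have "ennreal (LINT p|lebesgue. (cmod (ft h g p))\<^sup>2) \<le> ennreal (LINT x|lebesgue. (cmod (g x))\<^sup>2)" by simp
  then show "(LINT p|lebesgue. (cmod (ft h g p))\<^sup>2) \<le> (LINT x|lebesgue. (cmod (g x))\<^sup>2)"
    by (subst (asm) ennreal_le_iff) (auto intro: Bochner_Integration.integral_nonneg)
qed

text \<open>For an indicator the limit in \<open>ft_damped\<close> can be computed: its convolution
  with a narrowing normal density tends to 1 inside the interval. The damping factor is at most 1,
  so every damped norm is a lower bound for the full one.\<close>

lemma ft_interval_lower:
  assumes h: "h > 0" and "a \<le> b"
  shows "(cmod c)\<^sup>2 * (b - a) \<le> (LINT p|lebesgue. (cmod (ft h (\<lambda>x. indicator {a..b} x * c) p))\<^sup>2)"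
proof -
  let ?g = "\<lambda>x. indicator {a..b} x * c"
  have L2: "L2 ?g"
  proof -
    have "{a..b} \<inter> {- max \<bar>a\<bar> \<bar>b\<bar>..max \<bar>a\<bar> \<bar>b\<bar>} = {a..b}" by auto
    then show ?thesis using L2_indicator_Int_Icc[of "{a..b}" "max \<bar>a\<bar> \<bar>b\<bar>" c] by simp
  qed
  have g: "integrable lebesgue ?g"
    using integrable_indicator_L2[OF L2, of "{a..b}"] by (simp add: indicator_inter_arith[symmetric] mult.assoc[symmetric] emeasure_lborel_Icc_eq)
  define e where "e = (\<lambda>n. 1 / real (Suc n))"
  have e: "e n > 0" for n by (simp add: e_def)
  have e0: "e \<longlonglongrightarrow> 0" unfolding e_def by (rule LIMSEQ_Suc[OF lim_1_over_n])
  \<comment> \<open>The convolution of the indicator with the density of width \<open>e n\<close>,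
    after the substitution \<open>y = x + e n * z\<close>; the dominating function
    \<open>std_normal_density\<close> is then independent of \<open>n\<close>.\<close>
  define \<Phi> where "\<Phi> = (\<lambda>n x. LINT z|lebesgue. indicator {a..b} (x + e n * z) * std_normal_density z)"
  have std: "integrable lebesgue std_normal_density" "(LINT z|lebesgue. std_normal_density z) = 1"
    by (subst integrable_completion integral_completion; simp)+
  have [measurable]: "std_normal_density \<in> borel_measurable lebesgue"
    by (rule borel_measurable_integrable[OF std(1)])
  have ind_meas [measurable]: "(\<lambda>z. indicator {a..b} (x + e n * z) * std_normal_density z) \<in> borel_measurable lebesgue" for n x
    by measurable
  have \<Phi>_eq: "(LINT y|lebesgue. cnj (?g y) * of_real (normal_density 0 (e n) (y - x))) = cnj c * of_real (\<Phi> n x)" for n x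
  proof -
    have "(LINT y|lebesgue. cnj (?g y) * of_real (normal_density 0 (e n) (y - x)))
      = (LINT y|lebesgue. cnj c * of_real (indicator {a..b} y * normal_density 0 (e n) (y - x)))"
      by (intro Bochner_Integration.integral_cong refl) (auto simp: indicator_def)
    also have "\<dots> = cnj c * of_real (LINT y|lebesgue. indicator {a..b} y * normal_density 0 (e n) (y - x))"
      by (simp only: integral_mult_right_zero integral_complex_of_real)
    also have "(LINT y|lebesgue. indicator {a..b} y * normal_density 0 (e n) (y - x))
       = \<bar>e n\<bar> *\<^sub>R (LINT z|lebesgue. indicator {a..b} (x + e n * z) * normal_density 0 (e n) (x + e n * z - x))"
      using e[of n] by (intro lebesgue_integral_real_affine) auto
    also have "\<dots> = (LINT z|lebesgue. e n * (indicator {a..b} (x + e n * z) * normal_density 0 (e n) (e n * z)))"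
      using e[of n] by simp
    also have "\<dots> = \<Phi> n x"
    proof -
      have "e n * normal_density 0 (e n) (e n * z) = std_normal_density z" for z
        using e[of n] by (simp add: normal_density_def real_sqrt_mult power_mult_distrib field_simps)
      then show ?thesis unfolding \<Phi>_def by (intro Bochner_Integration.integral_cong refl) (metis mult.left_commute)
    qed
    finally show ?thesis .
  qed
  have \<Phi>_le: "\<Phi> n x \<le> 1" "\<Phi> n x \<ge> 0" for n x
  proof -
    have "\<Phi> n x \<le> (LINT z|lebesgue. std_normal_density z)"
      unfolding \<Phi>_def
      by (intro integral_mono std Bochner_Integration.integrable_bound[OF std(1)])
         (auto simp: indicator_def)
    then show "\<Phi> n x \<le> 1" using std by simp
    show "\<Phi> n x \<ge> 0" unfolding \<Phi>_def by (intro Bochner_Integration.integral_nonneg) auto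
  qed
  have \<Phi>_lim: "(\<lambda>n. \<Phi> n x) \<longlonglongrightarrow> 1" if "a < x" "x < b" for x
  proof -
    have "(\<lambda>n. \<Phi> n x) \<longlonglongrightarrow> (LINT z|lebesgue. std_normal_density z)"
      unfolding \<Phi>_def
    proof (rule integral_dominated_convergence[where w=std_normal_density])
      show "AE z in lebesgue. (\<lambda>n. indicator {a..b} (x + e n * z) * std_normal_density z) \<longlonglongrightarrow> std_normal_density z"
      proof (intro AE_I2 tendsto_eventually)
        fix z
        have "(\<lambda>n. x + e n * z) \<longlonglongrightarrow> x + 0 * z" by (intro tendsto_intros e0)
        then have "(\<lambda>n. x + e n * z) \<longlonglongrightarrow> x" by simp
        then have "eventually (\<lambda>n. x + e n * z > a) sequentially" "eventually (\<lambda>n. x + e n * z < b) sequentially"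
          using that by (auto intro: order_tendstoD)
        then show "eventually (\<lambda>n. indicator {a..b} (x + e n * z) * std_normal_density z = std_normal_density z) sequentially"
          by eventually_elim auto
      qed
    qed (use std in \<open>auto simp: indicator_def\<close>)
    then show ?thesis using std by simp
  qed
  have \<Phi>_meas [measurable]: "\<Phi> n \<in> borel_measurable lebesgue" for n
  proof -
    have "(\<lambda>z. indicator {a..b} (fst z + e n * snd z) * std_normal_density (snd z)) \<in> borel_measurable (lebesgue \<Otimes>\<^sub>M lebesgue)"
      by measurable
    then have "(\<lambda>(x, z). indicator {a..b} (x + e n * z) * std_normal_density z) \<in> borel_measurable (lebesgue \<Otimes>\<^sub>M lebesgue)"
      by (simp add: split_def)
    then show ?thesis unfolding \<Phi>_def by (rule lebesgue.borel_measurable_lebesgue_integral)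
  qed
  have "(\<lambda>n. LINT x|lebesgue. indicator {a..b} x * \<Phi> n x) \<longlonglongrightarrow> (LINT x|lebesgue. indicator {a..b} x)"
  proof (rule integral_dominated_convergence[where w="indicator {a..b}"])
    \<comment> \<open>At the endpoints the limit need not be 1, but they form a null set.\<close>
    have "AE x in lebesgue. x \<noteq> a \<and> x \<noteq> b"
      by (intro AE_conjI AE_completion AE_lborel_singleton)
    then show "AE x in lebesgue. (\<lambda>n. indicator {a..b} x * \<Phi> n x) \<longlonglongrightarrow> indicator {a..b} x"
    proof eventually_elim
      case (elim x)
      then show ?case using tendsto_mult[OF tendsto_const \<Phi>_lim, of x "indicator {a..b} x"]
        by (cases "x \<in> {a..b}") auto
    qed
    show "AE x in lebesgue. norm (indicator {a..b} x * \<Phi> n x) \<le> indicator {a..b} x" for n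
      using \<Phi>_le by (auto simp: indicator_def)
    show "integrable lebesgue (indicat_real {a..b})"
      by (intro integrable_real_indicator) (auto simp: emeasure_lborel_Icc_eq)
  qed auto
  then have "(\<lambda>n. (cmod c)\<^sup>2 * (LINT x|lebesgue. indicator {a..b} x * \<Phi> n x)) \<longlonglongrightarrow> (cmod c)\<^sup>2 * (b - a)"
    using \<open>a \<le> b\<close> by (intro tendsto_mult tendsto_const) simp
  moreover have "(cmod c)\<^sup>2 * (LINT x|lebesgue. indicator {a..b} x * \<Phi> n x) \<le> (LINT p|lebesgue. (cmod (ft h ?g p))\<^sup>2)" for n
  proof -
    have "complex_of_real (LINT p|lebesgue. (cmod (ft h ?g p))\<^sup>2 * exp (- (e n * p / h)\<^sup>2 / 2)) =
       (LINT x|lebesgue. ?g x * (cnj c * of_real (\<Phi> n x)))"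
      unfolding ft_damped[OF h e g] \<Phi>_eq ..
    also have "\<dots> = (LINT x|lebesgue. complex_of_real ((cmod c)\<^sup>2 * (indicator {a..b} x * \<Phi> n x)))"
      unfolding of_real_mult complex_norm_square
      by (intro Bochner_Integration.integral_cong refl) (simp add: indicator_def)
    also have "\<dots> = complex_of_real ((cmod c)\<^sup>2 * (LINT x|lebesgue. indicator {a..b} x * \<Phi> n x))"
      by (simp only: integral_complex_of_real integral_mult_right_zero)
    finally have "(cmod c)\<^sup>2 * (LINT x|lebesgue. indicator {a..b} x * \<Phi> n x) =
        (LINT p|lebesgue. (cmod (ft h ?g p))\<^sup>2 * exp (- (e n * p / h)\<^sup>2 / 2))"
      by (simp only: of_real_eq_iff)
    also have "\<dots> \<le> (LINT p|lebesgue. (cmod (ft h ?g p))\<^sup>2)"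
      using ft_bessel(1)[OF h g L2]
      by (intro integral_mono ft_damped_integrable h e g) (auto simp: L2_iff intro: mult_right_le_one_le)
    finally show ?thesis .
  qed
  ultimately show ?thesis by (intro LIMSEQ_le_const2) auto
qed

section \<open>The Fourier transform on square-integrable functions\<close>

text \<open>By the parallelogram law the squared norms of the images of \<open>f + g\<close> and
  \<open>f - g\<close> have the same sum as those of the vectors themselves; a contraction raises
  neither, so it preserves both.\<close>

lemma isometric_subspace:
  fixes A :: "'a::real_inner \<Rightarrow> 'b::real_inner"
  assumes A: "bounded_linear A" and contr: "\<And>f. norm (A f) \<le> norm f"
  shows "subspace {f. norm (A f) = norm f}" "closed {f. norm (A f) = norm f}"
proof -
  interpret bounded_linear A by fact
  show "closed {f. norm (A f) = norm f}"
    by (intro closed_Collect_eq continuous_on_norm linear_continuous_on[OF A] continuous_on_id)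
  have par: "(norm (x + y))\<^sup>2 + (norm (x - y))\<^sup>2 = 2 * (norm x)\<^sup>2 + 2 * (norm y)\<^sup>2" for x y :: "'c::real_inner"
    by (simp add: power2_norm_eq_inner inner_simps inner_commute)
  show "subspace {f. norm (A f) = norm f}"
  proof (rule subspaceI)
    fix f g assume fg: "f \<in> {f. norm (A f) = norm f}" "g \<in> {f. norm (A f) = norm f}"
    have "(norm (A (f + g)))\<^sup>2 + (norm (A (f - g)))\<^sup>2 = (norm (f + g))\<^sup>2 + (norm (f - g))\<^sup>2"
      using fg by (simp add: add diff par)
    moreover have "(norm (A (f + g)))\<^sup>2 \<le> (norm (f + g))\<^sup>2" "(norm (A (f - g)))\<^sup>2 \<le> (norm (f - g))\<^sup>2"
      by (intro power_mono contr norm_ge_zero)+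
    ultimately have "(norm (A (f + g)))\<^sup>2 = (norm (f + g))\<^sup>2" by linarith
    then show "f + g \<in> {f. norm (A f) = norm f}" by simp
  qed (auto simp: zero scale scaleR)
qed

definition trunc_fourier :: "real \<Rightarrow> real \<Rightarrow> l2 \<Rightarrow> l2" where
  "trunc_fourier h R f = mk (truncated_fourier h R (fn f))"

lemma integrable_truncated: "integrable lebesgue (cut {-R..R} (fn f))"
  by (intro integrable_indicator_L2) (auto simp: emeasure_lborel_Icc_eq)

lemma truncated_L2:
  assumes "h > 0"
  shows "L2 (truncated_fourier h R (fn f))"
  unfolding truncated_fourier_eq_ft
  by (intro ft_bessel assms integrable_truncated L2_indicator) auto

lemma norm_trunc_fourier_le:
  assumes "h > 0"
  shows "norm (trunc_fourier h R f) \<le> norm (proj {-R..R} f)"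
proof -
  have L2: "L2 (cut {-R..R} (fn f))" by (intro L2_indicator) auto
  have "(norm (trunc_fourier h R f))\<^sup>2 \<le> (norm (proj {-R..R} f))\<^sup>2"
    unfolding trunc_fourier_def proj_def norm_mk_sq[OF truncated_L2[OF assms]] norm_mk_sq[OF L2]
    unfolding truncated_fourier_eq_ft
    by (intro ft_bessel assms integrable_truncated L2)
  then show ?thesis by (rule power2_le_imp_le) simp
qed

lemma trunc_fourier_mk:
  assumes "L2 f"
  shows "trunc_fourier h R (mk f) = mk (truncated_fourier h R f)"
  unfolding trunc_fourier_def truncated_fourier_eq_ft using fn_mk[OF assms] L2_measurable[OF assms]
  by (intro arg_cong[where f=mk] ft_cong_AE) (auto elim: eventually_mono)

lemma truncated_fourier_indicator:
  "-R \<le> a \<Longrightarrow> b \<le> R \<Longrightarrow> truncated_fourier h R (cut {a..b} f) = ft h (cut {a..b} f)"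
  unfolding truncated_fourier_eq_ft by (intro arg_cong[where f="ft h"]) (auto simp: indicator_def)

lemma trunc_fourier_proj:
  assumes "R \<le> R'"
  shows "trunc_fourier h R' (proj {-R..R} f) = trunc_fourier h R f"
  using assms unfolding proj_def
  by (simp add: trunc_fourier_mk L2_indicator truncated_fourier_indicator)
     (simp add: trunc_fourier_def truncated_fourier_eq_ft)

lemma trunc_fourier_add:
  assumes "h > 0"
  shows "trunc_fourier h R (f + g) = trunc_fourier h R f + trunc_fourier h R g"
proof -
  have "truncated_fourier h R (fn (f + g)) =
      ft h (\<lambda>x. indicator {-R..R} x * fn f x + indicator {-R..R} x * fn g x)"
    unfolding truncated_fourier_eq_ft using fn_plus[of f g]
    by (intro ft_cong_AE) (measurable, auto elim!: eventually_mono simp: distrib_left)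
  also have "\<dots> = (\<lambda>p. truncated_fourier h R (fn f) p + truncated_fourier h R (fn g) p)"
    unfolding truncated_fourier_eq_ft by (intro ext ft_add integrable_truncated)
  finally show ?thesis
    unfolding trunc_fourier_def using assms by (simp add: mk_add truncated_L2)
qed

lemma trunc_fourier_scaleR:
  assumes "h > 0"
  shows "trunc_fourier h R (r *\<^sub>R f) = r *\<^sub>R trunc_fourier h R f"
proof -
  have "truncated_fourier h R (fn (r *\<^sub>R f)) = ft h (\<lambda>x. of_real r * (indicator {-R..R} x * fn f x))"
    unfolding truncated_fourier_eq_ft using fn_scaleR[of r f]
    by (intro ft_cong_AE) (measurable, auto elim!: eventually_mono simp: scaleR_conv_of_real)
  also have "\<dots> = (\<lambda>p. r *\<^sub>R truncated_fourier h R (fn f) p)"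
    unfolding truncated_fourier_eq_ft by (intro ext) (simp add: ft_cmult scaleR_conv_of_real)
  finally show ?thesis
    unfolding trunc_fourier_def using assms by (simp add: mk_scaleR truncated_L2)
qed

lemma trunc_fourier_diff:
  "h > 0 \<Longrightarrow> trunc_fourier h R (f - g) = trunc_fourier h R f - trunc_fourier h R g"
  using trunc_fourier_add[of h R f "- g"] trunc_fourier_scaleR[of h R "-1" g] by simp

text \<open>Integer cutoffs suffice here, since completeness speaks of sequences;
  \<open>trunc_fourier_tendsto\<close> extends the limit to real cutoffs, as
  \<open>is_fourier_transform\<close> requires.\<close>

definition fourier :: "real \<Rightarrow> l2 \<Rightarrow> l2" where
  "fourier h f = lim (\<lambda>n. trunc_fourier h (real n) f)"

text \<open>The difference is, up to sign, the transform over \<open>[-R', R']\<close> of the tail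
  of \<open>f\<close> beyond \<open>R\<close>. The contraction bound is therefore uniform in
  \<open>R'\<close>, which gives the Cauchy property.\<close>

lemma trunc_fourier_dist:
  assumes "h > 0" "R \<le> R'"
  shows "norm (trunc_fourier h R f - trunc_fourier h R' f) \<le> norm (proj {-R..R} f - f)"
proof -
  have "norm (trunc_fourier h R f - trunc_fourier h R' f) = norm (trunc_fourier h R' (proj {-R..R} f - f))"
    using assms by (simp add: trunc_fourier_diff trunc_fourier_proj)
  also have "\<dots> \<le> norm (proj {-R'..R'} (proj {-R..R} f - f))"
    by (rule norm_trunc_fourier_le[OF assms(1)])
  also have "\<dots> \<le> norm (proj {-R..R} f - f)" by (rule norm_proj_le) auto
  finally show ?thesis .
qed

lemma proj_dist_tendsto: "((\<lambda>R. norm (proj {-R..R} f - f)) \<longlongrightarrow> 0) at_top"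
  using proj_tendsto[of f] by (simp add: LIM_zero_iff tendsto_norm_zero_iff)

lemma trunc_fourier_LIMSEQ:
  assumes "h > 0"
  shows "(\<lambda>n. trunc_fourier h (real n) f) \<longlonglongrightarrow> fourier h f"
proof -
  have "Cauchy (\<lambda>n. trunc_fourier h (real n) f)"
  proof (rule CauchyI')
    fix e :: real assume "e > 0"
    have "(\<lambda>n. norm (proj {-real n..real n} f - f)) \<longlonglongrightarrow> 0"
      by (rule filterlim_compose[OF proj_dist_tendsto filterlim_real_sequentially])
    then have "eventually (\<lambda>n. norm (proj {-real n..real n} f - f) < e) sequentially"
      using \<open>e > 0\<close> by (rule order_tendstoD)
    then obtain N where N: "\<And>n. n \<ge> N \<Longrightarrow> norm (proj {-real n..real n} f - f) < e"
      by (auto simp: eventually_sequentially)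
    have "norm (trunc_fourier h (real m) f - trunc_fourier h (real n) f) < e" if "m \<ge> N" "n > m" for m n
      using trunc_fourier_dist[OF assms, of "real m" "real n" f] N[of m] that by force
    then show "\<exists>M. \<forall>m\<ge>M. \<forall>n>m. dist (trunc_fourier h (real m) f) (trunc_fourier h (real n) f) < e"
      unfolding dist_norm by blast
  qed
  then show ?thesis
    unfolding fourier_def by (simp add: Cauchy_convergent_iff convergent_LIMSEQ_iff)
qed

lemma trunc_fourier_dist_fourier:
  assumes "h > 0"
  shows "norm (trunc_fourier h R f - fourier h f) \<le> norm (proj {-R..R} f - f)"
proof (rule LIMSEQ_le_const2)
  show "(\<lambda>n. norm (trunc_fourier h R f - trunc_fourier h (real n) f)) \<longlonglongrightarrow> norm (trunc_fourier h R f - fourier h f)"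
    by (intro tendsto_intros trunc_fourier_LIMSEQ assms)
  obtain N :: nat where "R \<le> real N" using real_arch_simple by blast
  then show "\<exists>N. \<forall>n\<ge>N. norm (trunc_fourier h R f - trunc_fourier h (real n) f) \<le> norm (proj {-R..R} f - f)"
    by (intro exI[of _ N]) (auto intro!: trunc_fourier_dist assms)
qed

lemma trunc_fourier_tendsto:
  assumes "h > 0"
  shows "((\<lambda>R. trunc_fourier h R f) \<longlongrightarrow> fourier h f) at_top"
proof -
  have "((\<lambda>R. trunc_fourier h R f - fourier h f) \<longlongrightarrow> 0) at_top"
    by (rule Lim_null_comparison[OF always_eventually proj_dist_tendsto])
       (use trunc_fourier_dist_fourier[OF assms] in auto)
  then show ?thesis by (simp add: LIM_zero_iff)
qed

lemma fourier_add: "h > 0 \<Longrightarrow> fourier h (f + g) = fourier h f + fourier h g"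
  by (rule LIMSEQ_unique[OF trunc_fourier_LIMSEQ])
     (auto simp: trunc_fourier_add intro!: tendsto_add trunc_fourier_LIMSEQ)

lemma fourier_scaleR: "h > 0 \<Longrightarrow> fourier h (r *\<^sub>R f) = r *\<^sub>R fourier h f"
  by (rule LIMSEQ_unique[OF trunc_fourier_LIMSEQ])
     (auto simp: trunc_fourier_scaleR intro!: tendsto_scaleR trunc_fourier_LIMSEQ)

lemma norm_fourier_le:
  assumes "h > 0"
  shows "norm (fourier h f) \<le> norm f"
proof (rule LIMSEQ_le_const2)
  show "(\<lambda>n. norm (trunc_fourier h (real n) f)) \<longlonglongrightarrow> norm (fourier h f)"
    by (intro tendsto_norm trunc_fourier_LIMSEQ assms)
  show "\<exists>N. \<forall>n\<ge>N. norm (trunc_fourier h (real n) f) \<le> norm f"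
    using norm_trunc_fourier_le[OF assms] norm_proj_le order.trans by (metis lmeasurable_cbox fmeasurableD interval_cbox)
qed

lemma bounded_linear_fourier: "h > 0 \<Longrightarrow> bounded_linear (fourier h)"
  by (intro bounded_linear_intro[of _ 1]) (auto simp: fourier_add fourier_scaleR norm_fourier_le)

lemma fourier_proj:
  assumes "h > 0"
  shows "fourier h (proj {-R..R} f) = trunc_fourier h R f"
proof (rule LIMSEQ_unique[OF trunc_fourier_LIMSEQ[OF assms]])
  obtain N :: nat where "R \<le> real N" using real_arch_simple by blast
  then have "eventually (\<lambda>n. trunc_fourier h R f = trunc_fourier h (real n) (proj {-R..R} f)) sequentially"
    by (intro eventually_sequentiallyI[of N]) (auto simp: trunc_fourier_proj)
  then show "(\<lambda>n. trunc_fourier h (real n) (proj {-R..R} f)) \<longlonglongrightarrow> trunc_fourier h R f"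
    by (rule tendsto_eventually[OF eventually_mono]) simp
qed

text \<open>On a bounded interval the truncations stabilise, so the pointwise integral represents
  the abstract limit. Explicit computations with \<open>fourier\<close> go through this
  lemma.\<close>

lemma fourier_mk_interval:
  assumes h: "h > 0" and f: "L2 f"
  shows "fourier h (mk (cut {a..b} f)) = mk (ft h (cut {a..b} f))"
proof -
  define R where "R = max \<bar>a\<bar> \<bar>b\<bar>"
  have R: "-R \<le> a" "b \<le> R" by (auto simp: R_def)
  let ?g = "cut {a..b} f"
  have L2: "L2 ?g" using f by (intro L2_indicator) auto
  have "mk ?g = proj {-R..R} (mk ?g)"
    unfolding proj_mk[OF lmeasurable_interval(1)[THEN fmeasurableD] L2] using R
    by (intro arg_cong[where f=mk] ext) (auto simp: indicator_def)
  then have "fourier h (mk ?g) = trunc_fourier h R (mk ?g)"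
    using fourier_proj[OF h, of R "mk ?g"] by simp
  also have "\<dots> = mk (ft h ?g)"
    using R L2 by (simp add: trunc_fourier_mk truncated_fourier_indicator)
  finally show ?thesis .
qed

theorem norm_fourier:
  assumes h: "h > 0"
  shows "norm (fourier h f) = norm f"
proof -
  have "f \<in> {f. norm (fourier h f) = norm f}"
  proof (rule l2_subspace_dense)
    show "subspace {f. norm (fourier h f) = norm f}" "closed {f. norm (fourier h f) = norm f}"
      by (intro isometric_subspace bounded_linear_fourier norm_fourier_le h)+
    fix a b :: real and c :: complex assume "a \<le> b"
    let ?g = "\<lambda>x. indicator {a..b} x * c"
    have "{a..b} \<inter> {- max \<bar>a\<bar> \<bar>b\<bar>..max \<bar>a\<bar> \<bar>b\<bar>} = {a..b}" by auto
    then have L2: "L2 ?g" using L2_indicator_Int_Icc[of "{a..b}" "max \<bar>a\<bar> \<bar>b\<bar>" c] by simp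
    have gg: "(\<lambda>x. indicator {a..b} x * ?g x) = ?g" by (auto simp: indicator_def)
    have int: "integrable lebesgue ?g"
      using integrable_indicator_L2[OF L2, of "{a..b}"] unfolding gg by (simp add: emeasure_lborel_Icc_eq)
    have F: "fourier h (mk ?g) = mk (ft h ?g)"
      using fourier_mk_interval[OF h L2, of a b] unfolding gg .
    have "(norm (mk ?g))\<^sup>2 = (cmod c)\<^sup>2 * (b - a)"
    proof -
      have "(norm (mk ?g))\<^sup>2 = (LINT x|lebesgue. (cmod c)\<^sup>2 * indicator {a..b} x)"
        unfolding norm_mk_sq[OF L2] by (intro Bochner_Integration.integral_cong) (auto simp: indicator_def)
      then show ?thesis using \<open>a \<le> b\<close> by simp
    qed
    also have "\<dots> \<le> (norm (fourier h (mk ?g)))\<^sup>2"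
      unfolding F norm_mk_sq[OF ft_bessel(1)[OF h int L2]] by (rule ft_interval_lower[OF h \<open>a \<le> b\<close>])
    finally have "norm (mk ?g) \<le> norm (fourier h (mk ?g))" by (rule power2_le_imp_le) simp
    with norm_fourier_le[OF h, of "mk ?g"] show "mk ?g \<in> {f. norm (fourier h f) = norm f}" by simp
  qed
  then show ?thesis by simp
qed

lemma inner_fourier:
  assumes "h > 0"
  shows "fourier h f \<bullet> fourier h g = f \<bullet> g"
proof -
  have "(norm (fourier h (f + g)))\<^sup>2 = (norm (f + g))\<^sup>2" "(norm (fourier h f))\<^sup>2 = (norm f)\<^sup>2"
      "(norm (fourier h g))\<^sup>2 = (norm g)\<^sup>2"
    using assms by (simp_all add: norm_fourier)
  then show ?thesis
    using assms by (simp add: power2_norm_eq_inner inner_simps inner_commute fourier_add)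
qed

section \<open>Conjugation and Fourier inversion\<close>

definition l2_cnj :: "l2 \<Rightarrow> l2" where
  "l2_cnj f = mk (\<lambda>x. cnj (fn f x))"

lemma L2_cnj: "L2 f \<Longrightarrow> L2 (\<lambda>x. cnj (f x))"
  by (auto simp: L2_iff)

lemma fn_l2_cnj: "AE x in lebesgue. fn (l2_cnj f) x = cnj (fn f x)"
  unfolding l2_cnj_def by (intro fn_mk L2_cnj) auto

lemma l2_cnj_mk: "L2 f \<Longrightarrow> l2_cnj (mk f) = mk (\<lambda>x. cnj (f x))"
  unfolding l2_cnj_def using fn_mk[of f] by (intro mk_eqI L2_cnj) (auto elim: eventually_mono)

lemma l2_cnj_l2_cnj [simp]: "l2_cnj (l2_cnj f) = f"
  by (subst (2) l2_cnj_def) (simp add: l2_cnj_mk L2_cnj)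

lemma l2_cnj_add: "l2_cnj (f + g) = l2_cnj f + l2_cnj g"
  by (rule l2_eqI, use fn_l2_cnj[of "f + g"] fn_l2_cnj[of f] fn_l2_cnj[of g] fn_plus[of f g]
    fn_plus[of "l2_cnj f" "l2_cnj g"] in \<open>eventually_elim, simp\<close>)

lemma l2_cnj_scaleR: "l2_cnj (r *\<^sub>R f) = r *\<^sub>R l2_cnj f"
  by (rule l2_eqI, use fn_l2_cnj[of "r *\<^sub>R f"] fn_l2_cnj[of f] fn_scaleR[of r f]
    fn_scaleR[of r "l2_cnj f"] in \<open>eventually_elim, simp\<close>)

lemma inner_l2_cnj: "l2_cnj f \<bullet> l2_cnj g = f \<bullet> g"
  unfolding inner_l2_def using fn_l2_cnj[of f] fn_l2_cnj[of g]
  by (intro integral_cong_AE) (measurable, auto elim!: eventually_elim2 simp: inner_complex_def)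

lemma norm_l2_cnj [simp]: "norm (l2_cnj f) = norm f"
  by (simp add: norm_eq_sqrt_inner inner_l2_cnj)

lemma bounded_linear_l2_cnj: "bounded_linear l2_cnj"
  by (intro bounded_linear_intro[of _ 1]) (auto simp: l2_cnj_add l2_cnj_scaleR)

text \<open>\<open>a \<bullet> b\<close> is Re (cnj a * b), so conjugating the transform cancels the
  conjugate in the inner product and leaves the real part of the multiplication formula. This is
  done for truncated functions and passed to the limit.\<close>

lemma l2_cnj_fourier_selfadjoint:
  assumes h: "h > 0"
  shows "l2_cnj (fourier h f) \<bullet> g = f \<bullet> l2_cnj (fourier h g)"
proof -
  have "l2_cnj (trunc_fourier h R f) \<bullet> proj {-R..R} g = proj {-R..R} f \<bullet> l2_cnj (trunc_fourier h R g)" for R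
  proof -
    let ?f = "cut {-R..R} (fn f)" and ?g = "cut {-R..R} (fn g)"
    have L2: "L2 ?f" "L2 ?g" by (intro L2_indicator; simp)+
    have int: "integrable lebesgue ?f" "integrable lebesgue ?g" by (rule integrable_truncated)+
    have L2': "L2 (ft h ?f)" "L2 (ft h ?g)" by (intro ft_bessel h int L2)+
    have "l2_cnj (trunc_fourier h R f) \<bullet> proj {-R..R} g = (LINT p|lebesgue. cnj (ft h ?f p) \<bullet> ?g p)"
      unfolding trunc_fourier_def truncated_fourier_eq_ft proj_def l2_cnj_mk[OF L2'(1)]
      by (intro inner_mk L2_cnj L2 L2')
    also have "\<dots> = (LINT p|lebesgue. Re (ft h ?f p * ?g p))" by (simp add: inner_complex_def)
    also have "\<dots> = Re (LINT p|lebesgue. ft h ?f p * ?g p)"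
      by (intro integral_Re ft_mult_integrable h int)
    also have "\<dots> = Re (LINT x|lebesgue. ?f x * ft h ?g x)" by (simp only: ft_multiplication_formula[OF int])
    also have "\<dots> = (LINT x|lebesgue. Re (?f x * ft h ?g x))"
      using ft_mult_integrable[OF h int(2,1)] by (intro integral_Re[symmetric]) (simp add: mult.commute)
    also have "\<dots> = (LINT x|lebesgue. ?f x \<bullet> cnj (ft h ?g x))" by (simp add: inner_complex_def)
    also have "\<dots> = proj {-R..R} f \<bullet> l2_cnj (trunc_fourier h R g)"
      unfolding trunc_fourier_def truncated_fourier_eq_ft proj_def l2_cnj_mk[OF L2'(2)]
      by (intro inner_mk[symmetric] L2_cnj L2 L2')
    finally show ?thesis .
  qed
  moreover have "((\<lambda>R. l2_cnj (trunc_fourier h R f) \<bullet> proj {-R..R} g) \<longlongrightarrow> l2_cnj (fourier h f) \<bullet> g) at_top"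
      "((\<lambda>R. proj {-R..R} f \<bullet> l2_cnj (trunc_fourier h R g)) \<longlongrightarrow> f \<bullet> l2_cnj (fourier h g)) at_top"
    by (intro tendsto_inner proj_tendsto trunc_fourier_tendsto h bounded_linear.tendsto[OF bounded_linear_l2_cnj])+
  ultimately show ?thesis
    by (intro tendsto_unique[of at_top]) auto
qed

text \<open>A self-adjoint isometry is an involution; applied to \<open>l2_cnj \<circ> fourier h\<close> this is Fourier inversion.\<close>

theorem l2_cnj_fourier_involution:
  assumes h: "h > 0"
  shows "l2_cnj (fourier h (l2_cnj (fourier h f))) = f"
proof -
  let ?J = "\<lambda>f. l2_cnj (fourier h f)"
  have "(norm (?J (?J f) - f))\<^sup>2 = ?J (?J f) \<bullet> ?J (?J f) - 2 * (?J (?J f) \<bullet> f) + f \<bullet> f"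
    by (simp add: power2_norm_eq_inner inner_simps inner_commute)
  also have "?J (?J f) \<bullet> f = ?J f \<bullet> ?J f" by (rule l2_cnj_fourier_selfadjoint[OF h])
  finally have "(norm (?J (?J f) - f))\<^sup>2 = 0"
    using h by (simp add: inner_l2_cnj inner_fourier)
  then show ?thesis by simp
qed

text \<open>Limits in \<open>l2\<close> are unique, so the mean-square definition determines exactly
  one class. This makes the choice in \<open>momentum_wave\<close> harmless.\<close>

lemma is_fourier_transform_iff:
  assumes h: "h > 0" and \<psi>: "L2 \<psi>"
  shows "is_fourier_transform h \<psi> \<phi> \<longleftrightarrow> L2 \<phi> \<and> mk \<phi> = fourier h (mk \<psi>)"
proof (cases "L2 \<phi>")
  case True
  have L2t: "L2 (truncated_fourier h R \<psi>)" for R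
    unfolding truncated_fourier_eq_ft using \<psi>
    by (intro ft_bessel h integrable_indicator_L2 L2_indicator) (auto simp: emeasure_lborel_Icc_eq)
  have "(\<integral>\<^sup>+p. ennreal ((cmod (\<phi> p - truncated_fourier h R \<psi> p))\<^sup>2) \<partial>lebesgue)
      = ennreal ((norm (mk \<phi> - trunc_fourier h R (mk \<psi>)))\<^sup>2)" for R
    using True L2t \<psi> L2_diff[OF True L2t[of R]]
    by (simp add: trunc_fourier_mk mk_diff[symmetric] norm_mk_sq L2_iff nn_integral_eq_integral)
  then have "is_fourier_transform h \<psi> \<phi> \<longleftrightarrow> ((\<lambda>R. ennreal ((norm (mk \<phi> - trunc_fourier h R (mk \<psi>)))\<^sup>2)) \<longlongrightarrow> ennreal 0) at_top"
    using True by (simp add: is_fourier_transform_def)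
  also have "\<dots> \<longleftrightarrow> mk \<phi> = fourier h (mk \<psi>)"
  proof
    assume "mk \<phi> = fourier h (mk \<psi>)"
    have "((\<lambda>R. (norm (mk \<phi> - trunc_fourier h R (mk \<psi>)))\<^sup>2) \<longlongrightarrow> (norm (mk \<phi> - fourier h (mk \<psi>)))\<^sup>2) at_top"
      by (intro tendsto_intros trunc_fourier_tendsto h)
    then show "((\<lambda>R. ennreal ((norm (mk \<phi> - trunc_fourier h R (mk \<psi>)))\<^sup>2)) \<longlongrightarrow> ennreal 0) at_top"
      using \<open>mk \<phi> = _\<close> by (intro tendsto_ennrealI) simp
  next
    assume "((\<lambda>R. ennreal ((norm (mk \<phi> - trunc_fourier h R (mk \<psi>)))\<^sup>2)) \<longlongrightarrow> ennreal 0) at_top"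
    moreover have "((\<lambda>R. ennreal ((norm (mk \<phi> - trunc_fourier h R (mk \<psi>)))\<^sup>2)) \<longlongrightarrow> ennreal ((norm (mk \<phi> - fourier h (mk \<psi>)))\<^sup>2)) at_top"
      by (intro tendsto_ennrealI tendsto_intros trunc_fourier_tendsto h)
    ultimately have "ennreal 0 = ennreal ((norm (mk \<phi> - fourier h (mk \<psi>)))\<^sup>2)"
      by (intro tendsto_unique[of at_top]) auto
    then show "mk \<phi> = fourier h (mk \<psi>)" by (simp add: ennreal_eq_0_iff[symmetric] eq_commute[of "0::ennreal"])
  qed
  finally show ?thesis using True by simp
qed (simp add: is_fourier_transform_def)

lemma momentum_wave:
  assumes h: "h > 0" and \<psi>: "L2 \<psi>"
  shows "L2 (momentum_wave h \<psi>)" "mk (momentum_wave h \<psi>) = fourier h (mk \<psi>)"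
proof -
  have "is_fourier_transform h \<psi> (fn (fourier h (mk \<psi>)))"
    by (simp add: is_fourier_transform_iff[OF assms])
  then have "is_fourier_transform h \<psi> (momentum_wave h \<psi>)"
    unfolding momentum_wave_def by (rule someI[of "is_fourier_transform h \<psi>"])
  then show "L2 (momentum_wave h \<psi>)" "mk (momentum_wave h \<psi>) = fourier h (mk \<psi>)"
    by (simp_all add: is_fourier_transform_iff[OF assms])
qed

section \<open>Uncertainty from concentration bounds\<close>

text \<open>With s = cos^2 a and t = cos^2 b the expression is cos (a + b), which decreases in both
  angles.\<close>

lemma confidence_root_mono:
  fixes s t s' t' :: real
  assumes "0 \<le> s" "s \<le> s'" "s' \<le> 1" "0 \<le> t" "t \<le> t'" "t' \<le> 1"
  shows "sqrt (s * t) - sqrt ((1 - s) * (1 - t)) \<le> sqrt (s' * t') - sqrt ((1 - s') * (1 - t'))"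
  using assms by (intro diff_mono real_sqrt_le_mono mult_mono) auto

text \<open>The condition \<open>s + t > 1\<close> says that the two angles add up to less than a
  right angle. Positivity is what allows inequalities between the roots to be squared.\<close>

lemma confidence_root_pos:
  fixes s t :: real
  assumes "s + t > 1" "s \<le> 1" "t \<le> 1"
  shows "sqrt ((1 - s) * (1 - t)) < sqrt (s * t)"
  using assms by (intro real_sqrt_less_mono) (simp add: algebra_simps)

lemma confidence_bound_pos:
  "s + t > 1 \<Longrightarrow> s \<le> 1 \<Longrightarrow> t \<le> 1 \<Longrightarrow> confidence_bound s t > 0"
  unfolding confidence_bound_def using confidence_root_pos[of s t] by simp

lemma confidence_bound_le_1:
  assumes "0 \<le> s" "s \<le> 1" "0 \<le> t" "t \<le> 1" "s + t > 1"
  shows "confidence_bound s t \<le> 1"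
  using confidence_root_mono[of s 1 t 1] confidence_root_pos[of s t] assms
  unfolding confidence_bound_def by (intro power_le_one) auto

text \<open>At the value 1 \<open>lambda0_inv\<close> is infinite, so this identifies the case in
  which no finite Slepian parameter exists.\<close>

lemma confidence_bound_eq_1_iff:
  assumes "0 < s" "s \<le> 1" "0 < t" "t \<le> 1" "s + t > 1"
  shows "confidence_bound s t = 1 \<longleftrightarrow> s = 1 \<and> t = 1"
proof
  assume eq: "confidence_bound s t = 1"
  have "sqrt (s * t) \<le> 1" using assms by (simp add: mult_le_one)
  moreover have "sqrt ((1 - s) * (1 - t)) \<ge> 0" using assms by simp
  moreover have "sqrt (s * t) - sqrt ((1 - s) * (1 - t)) = 1"
    using eq confidence_root_pos[of s t] assms unfolding confidence_bound_def power2_eq_1_iff by linarith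
  ultimately have "sqrt (s * t) = 1" by linarith
  then have "s * t = 1" by simp
  moreover have "s * t \<le> s" "s * t \<le> t" using assms by (auto simp: mult_left_le mult_left_le_one_le)
  ultimately show "s = 1 \<and> t = 1" using assms by linarith
qed (simp add: confidence_bound_def)

text \<open>The triangle inequality for angles, without angles: \<open>a\<close> and
  \<open>b\<close> are split into multiples of \<open>\<psi>\<close> and remainders orthogonal to
  it, and Cauchy-Schwarz is applied to the remainders.\<close>

lemma angle_bound:
  fixes a b \<psi> :: "'a::real_inner"
  assumes "norm \<psi> = 1" and a: "a \<bullet> \<psi> = (norm a)\<^sup>2" "s \<le> (norm a)\<^sup>2" and b: "b \<bullet> \<psi> = (norm b)\<^sup>2" "t \<le> (norm b)\<^sup>2"
    and st: "0 < s" "0 < t" "s + t > 1" "s \<le> 1" "t \<le> 1" and ab: "a \<bullet> b \<le> sqrt m * norm a * norm b" "m \<ge> 0"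
  shows "confidence_bound s t \<le> m"
proof -
  define s' t' where "s' = (norm a)\<^sup>2" and "t' = (norm b)\<^sup>2"
  have le1: "(norm v)\<^sup>2 \<le> 1" if "v \<bullet> \<psi> = (norm v)\<^sup>2" for v
  proof -
    have "norm v * norm v \<le> norm v * 1"
      using norm_cauchy_schwarz[of v \<psi>] that assms(1) by (simp add: power2_eq_square)
    then have "norm v \<le> 1" by (cases "norm v = 0") auto
    then show ?thesis by (simp add: power_le_one)
  qed
  have s': "s \<le> s'" "s' \<le> 1" and t': "t \<le> t'" "t' \<le> 1"
    using a b le1 by (auto simp: s'_def t'_def)
  have \<psi>\<psi>: "\<psi> \<bullet> \<psi> = 1" using assms(1) by (simp add: power2_norm_eq_inner[symmetric])
  \<comment> \<open>Both \<open>v \<bullet> v\<close> and \<open>v \<bullet> \<psi>\<close> equal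
    |v|^2, so the part of \<open>v\<close> orthogonal to \<open>\<psi>\<close> has squared norm
    |v|^2 - |v|^4.\<close>
  have rest: "norm (v - (norm v)\<^sup>2 *\<^sub>R \<psi>) = sqrt ((norm v)\<^sup>2 * (1 - (norm v)\<^sup>2))" if "v \<bullet> \<psi> = (norm v)\<^sup>2" for v
  proof -
    define w where "w = (norm v)\<^sup>2"
    have "v \<bullet> v = w" "v \<bullet> \<psi> = w" using that by (simp_all add: w_def power2_norm_eq_inner)
    then have "(v - w *\<^sub>R \<psi>) \<bullet> (v - w *\<^sub>R \<psi>) = w * (1 - w)"
      using \<psi>\<psi> by (simp add: inner_simps inner_commute[of \<psi> v] algebra_simps)
    then show ?thesis unfolding norm_eq_sqrt_inner[of "v - _"] w_def by simp
  qed
  have "a \<bullet> \<psi> = s'" "\<psi> \<bullet> b = t'" using a b by (simp_all add: s'_def t'_def inner_commute)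
  then have "a \<bullet> b = s' * t' + (a - s' *\<^sub>R \<psi>) \<bullet> (b - t' *\<^sub>R \<psi>)"
    using \<psi>\<psi> by (simp add: inner_simps algebra_simps)
  moreover have "\<bar>(a - s' *\<^sub>R \<psi>) \<bullet> (b - t' *\<^sub>R \<psi>)\<bar> \<le> sqrt (s' * (1 - s')) * sqrt (t' * (1 - t'))"
    using Cauchy_Schwarz_ineq2[of "a - s' *\<^sub>R \<psi>" "b - t' *\<^sub>R \<psi>"] rest[OF a(1)] rest[OF b(1)]
    by (simp add: s'_def t'_def)
  ultimately have le: "s' * t' - sqrt (s' * (1 - s')) * sqrt (t' * (1 - t')) \<le> sqrt m * norm a * norm b"
    using ab by linarith
  have norms: "norm a = sqrt s'" "norm b = sqrt t'" by (simp_all add: s'_def t'_def)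
  have alg: "(x * y) * (x * y - u * v) = (x * x) * (y * y) - (x * u) * (y * v)" for x y u v :: real
    by (simp add: algebra_simps)
  \<comment> \<open>Dividing the estimate by \<open>norm a * norm b\<close> leaves the cosine of the
    sum of the two angles.\<close>
  have "(sqrt s' * sqrt t') * (sqrt (s' * t') - sqrt ((1 - s') * (1 - t'))) =
      s' * t' - sqrt (s' * (1 - s')) * sqrt (t' * (1 - t'))"
    unfolding real_sqrt_mult alg using s' t' st by simp
  also have "\<dots> \<le> (sqrt s' * sqrt t') * sqrt m"
    using le unfolding norms by (simp add: mult.commute mult.left_commute)
  finally have "(sqrt s' * sqrt t') * (sqrt (s' * t') - sqrt ((1 - s') * (1 - t'))) \<le> (sqrt s' * sqrt t') * sqrt m" .
  then have "sqrt (s' * t') - sqrt ((1 - s') * (1 - t')) \<le> sqrt m"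
    by (rule mult_left_le_imp_le) (use s' t' st in auto)
  \<comment> \<open>\<open>s'\<close> and \<open>t'\<close> are the actual confidences; lowering
    them to the prescribed \<open>s\<close> and \<open>t\<close> can only decrease the root.\<close>
  then have "sqrt (s * t) - sqrt ((1 - s) * (1 - t)) \<le> sqrt m"
    using confidence_root_mono[of s s' t t'] s' t' st by linarith
  then have "(sqrt (s * t) - sqrt ((1 - s) * (1 - t)))\<^sup>2 \<le> (sqrt m)\<^sup>2"
    using confidence_root_pos[of s t] st by (intro power_mono) auto
  then show ?thesis using ab(2) by (simp add: confidence_bound_def)
qed

text \<open>\<open>angle_bound\<close> for the transformed state: the isometry carries the position
  cutoff to momentum space with its norms, so both projections act on the same unit vector.\<close>

lemma concentration_bound:
  assumes h: "h > 0" and \<psi>: "norm \<psi> = 1" and X: "X \<in> sets lebesgue" and Y: "Y \<in> sets lebesgue"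
    and s: "s \<le> (norm (proj X \<psi>))\<^sup>2" and t: "t \<le> (norm (proj Y (fourier h \<psi>)))\<^sup>2"
    and st: "0 < s" "0 < t" "s + t > 1" "s \<le> 1" "t \<le> 1"
    and m: "(norm (proj Y (fourier h (proj X \<psi>))))\<^sup>2 \<le> m * (norm (proj X \<psi>))\<^sup>2" "m \<ge> 0"
  shows "confidence_bound s t \<le> m"
proof -
  let ?a = "fourier h (proj X \<psi>)" and ?b = "proj Y (fourier h \<psi>)"
  have b: "proj Y ?b = ?b" using Y by (simp add: proj_proj)
  show ?thesis
  proof (rule angle_bound[of "fourier h \<psi>" ?a s ?b t m])
    show "norm (fourier h \<psi>) = 1" using \<psi> h by (simp add: norm_fourier)
    show "?a \<bullet> fourier h \<psi> = (norm ?a)\<^sup>2"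
      using h X by (simp add: inner_fourier inner_proj_self norm_fourier)
    show "?b \<bullet> fourier h \<psi> = (norm ?b)\<^sup>2"
      using Y by (rule inner_proj_self)
    show "s \<le> (norm ?a)\<^sup>2" using s h by (simp add: norm_fourier)
    show "?a \<bullet> ?b \<le> sqrt m * norm ?a * norm ?b"
    proof -
      \<comment> \<open>\<open>?b\<close> is fixed by the projection onto \<open>Y\<close>, so the
        projection can be moved onto \<open>?a\<close>, where \<open>m\<close> controls it.\<close>
      have "?a \<bullet> ?b = proj Y ?a \<bullet> ?b" using Y b by (metis proj_selfadjoint)
      also have "\<dots> \<le> norm (proj Y ?a) * norm ?b" by (rule norm_cauchy_schwarz)
      also have "norm (proj Y ?a) \<le> sqrt (m * (norm (proj X \<psi>))\<^sup>2)" using m by (intro real_le_rsqrt) auto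
      also have "\<dots> = sqrt m * norm ?a" using h by (simp add: real_sqrt_mult norm_fourier)
      finally show ?thesis by (simp add: mult_right_mono)
    qed
  qed (use t st m in auto)
qed

lemma L2_indicator_const:
  assumes "X \<in> sets lebesgue" "emeasure lebesgue X < \<infinity>"
  shows "L2 (\<lambda>x. indicator X x * c)"
proof (rule L2_bound)
  show "integrable lebesgue (\<lambda>x. indicator X x * (cmod c)\<^sup>2)"
    using assms by (intro integrable_mult_left integrable_real_indicator) auto
  show "(\<lambda>x. indicator X x * c) \<in> borel_measurable lebesgue" using assms(1) by measurable
qed (auto simp: indicator_def)

lemma integral_indicator_L2_le:
  assumes f: "L2 f" and X: "X \<in> sets lebesgue" "emeasure lebesgue X < \<infinity>"
  shows "(LINT x|lebesgue. cmod (indicator X x * f x))\<^sup>2 \<le> measure lebesgue X * (norm (mk f))\<^sup>2"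
proof -
  let ?i = "\<lambda>x. indicator X x * (1 :: complex)" and ?f = "\<lambda>x. complex_of_real (cmod (f x))"
  note [measurable] = L2_measurable[OF f]
  have i: "L2 ?i" by (intro L2_indicator_const X)
  have f': "L2 ?f" using f by (auto simp: L2_iff)
  have "(LINT x|lebesgue. cmod (indicator X x * f x)) = mk ?i \<bullet> mk ?f"
    unfolding inner_mk[OF i f'] by (intro Bochner_Integration.integral_cong) (auto simp: indicator_def)
  moreover have "\<bar>mk ?i \<bullet> mk ?f\<bar> \<le> norm (mk ?i) * norm (mk ?f)" by (rule Cauchy_Schwarz_ineq2)
  then have "\<bar>mk ?i \<bullet> mk ?f\<bar>\<^sup>2 \<le> (norm (mk ?i) * norm (mk ?f))\<^sup>2" by (intro power_mono) auto
  ultimately have "(LINT x|lebesgue. cmod (indicator X x * f x))\<^sup>2 \<le> (norm (mk ?i))\<^sup>2 * (norm (mk ?f))\<^sup>2"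
    by (simp add: power_mult_distrib)
  also have "(norm (mk ?i))\<^sup>2 = (LINT x|lebesgue. indicator X x)"
    unfolding norm_mk_sq[OF i] by (intro Bochner_Integration.integral_cong) (auto simp: indicator_def)
  also have "\<dots> = measure lebesgue X" using X by simp
  also have "(norm (mk ?f))\<^sup>2 = (norm (mk f))\<^sup>2" unfolding norm_mk_sq[OF f] norm_mk_sq[OF f'] by simp
  finally show ?thesis .
qed

lemma ft_sq_bound:
  assumes h: "h > 0" and f: "L2 f" and X: "X \<in> sets lebesgue" "emeasure lebesgue X < \<infinity>"
  shows "(cmod (ft h (cut X f) p))\<^sup>2 \<le> measure lebesgue X / (2 * pi * h) * (norm (mk f))\<^sup>2"
proof -
  have "(cmod (ft h (cut X f) p))\<^sup>2 \<le> (1 / sqrt (2 * pi * h) * (LINT x|lebesgue. cmod (indicator X x * f x)))\<^sup>2"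
    using h by (intro power_mono ft_bound) auto
  also have "\<dots> = 1 / (2 * pi * h) * (LINT x|lebesgue. cmod (indicator X x * f x))\<^sup>2"
    using h by (simp add: power_mult_distrib power_divide)
  also have "\<dots> \<le> 1 / (2 * pi * h) * (measure lebesgue X * (norm (mk f))\<^sup>2)"
    using h by (intro mult_left_mono integral_indicator_L2_le f X) auto
  finally show ?thesis by simp
qed

lemma norm_proj_mk_sq:
  assumes "X \<in> sets lebesgue" "L2 f"
  shows "(norm (proj X (mk f)))\<^sup>2 = (LINT x|lebesgue. indicator X x * (cmod (f x))\<^sup>2)"
  unfolding proj_mk[OF assms] norm_mk_sq[OF L2_indicator[OF assms(2,1)]]
  by (intro Bochner_Integration.integral_cong) (auto simp: indicator_def)

text \<open>The constant is the squared Hilbert-Schmidt norm of the Fourier kernel on the product of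
  \<open>X\<close> and \<open>Y\<close>: Cauchy-Schwarz over \<open>X\<close> bounds the transform
  at each \<open>p\<close>, and integration over \<open>Y\<close> supplies the factor
  \<open>measure lebesgue Y\<close>.\<close>

lemma hilbert_schmidt_bound:
  assumes h: "h > 0" and X: "X \<in> sets lebesgue" "emeasure lebesgue X < \<infinity>" and Y: "Y \<in> sets lebesgue" "emeasure lebesgue Y < \<infinity>"
  shows "(norm (proj Y (fourier h (proj X f))))\<^sup>2 \<le> measure lebesgue X * measure lebesgue Y / (2 * pi * h) * (norm (proj X f))\<^sup>2"
proof -
  \<comment> \<open>The transform is known pointwise only for functions cut to a bounded interval,
    so \<open>X\<close> is first intersected with \<open>{-R..R}\<close>; the bound does not depend
    on \<open>R\<close>.\<close>
  have X_R: "(norm (proj Y (fourier h (proj {-R..R} (proj X f)))))\<^sup>2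
      \<le> measure lebesgue X * measure lebesgue Y / (2 * pi * h) * (norm (proj X f))\<^sup>2" for R
  proof -
    have X': "X \<inter> {-R..R} \<in> sets lebesgue" "emeasure lebesgue (X \<inter> {-R..R}) < \<infinity>"
    proof -
      have "emeasure lebesgue (X \<inter> {-R..R}) \<le> emeasure lebesgue X"
        using X(1) by (intro emeasure_mono) auto
      then show "emeasure lebesgue (X \<inter> {-R..R}) < \<infinity>" using X(2) by (rule le_less_trans)
    qed (use X in auto)
    have eq: "(\<lambda>x. indicator {-R..R} x * (indicator X x * fn f x)) = (\<lambda>x. indicator (X \<inter> {-R..R}) x * (indicator X x * fn f x))"
      by (auto simp: indicator_def)
    let ?G = "ft h (\<lambda>x. indicator (X \<inter> {-R..R}) x * (indicator X x * fn f x))"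
    have L2X: "L2 (cut X (fn f))" using X by (intro L2_indicator) auto
    have "proj {-R..R} (proj X f) = mk (\<lambda>x. indicator {-R..R} x * (indicator X x * fn f x))"
      unfolding proj_def[of X] by (intro proj_mk L2X) auto
    then have F: "fourier h (proj {-R..R} (proj X f)) = mk ?G"
      unfolding eq[symmetric] using fourier_mk_interval[OF h L2X, of "-R" R] by simp
    have L2G: "L2 ?G"
      by (intro ft_bessel h integrable_indicator_L2 X' L2X L2_indicator)
    let ?B = "measure lebesgue X / (2 * pi * h) * (norm (proj X f))\<^sup>2"
    have B: "(cmod (?G p))\<^sup>2 \<le> ?B" for p
    proof -
      have "(cmod (?G p))\<^sup>2 \<le> measure lebesgue (X \<inter> {-R..R}) / (2 * pi * h) * (norm (mk (cut X (fn f))))\<^sup>2"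
        by (intro ft_sq_bound h L2X X')
      also have "\<dots> \<le> ?B"
      proof -
        have "measure lebesgue (X \<inter> {-R..R}) \<le> measure lebesgue X"
          using X X'(1) by (intro measure_mono_fmeasurable fmeasurableI) (auto simp: less_top)
        then show ?thesis
          unfolding proj_def[symmetric] using h by (intro mult_right_mono divide_right_mono) auto
      qed
      finally show ?thesis .
    qed
    have "(norm (proj Y (mk ?G)))\<^sup>2 = (LINT p|lebesgue. indicator Y p * (cmod (?G p))\<^sup>2)"
      by (rule norm_proj_mk_sq[OF Y(1) L2G])
    also have "\<dots> \<le> (LINT p|lebesgue. indicator Y p * ?B)"
    proof (rule integral_mono)
      show int: "integrable lebesgue (\<lambda>p. indicator Y p * ?B)"
        using Y by (intro integrable_mult_left integrable_real_indicator)
      show "integrable lebesgue (\<lambda>p. indicator Y p * (cmod (?G p))\<^sup>2)"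
      proof -
        have "indicator Y p * (cmod (?G p))\<^sup>2 = (cmod (indicator Y p * ?G p))\<^sup>2" for p
          by (simp add: indicator_def)
        then show ?thesis using L2_indicator[OF L2G Y(1)] unfolding L2_iff by simp
      qed
      show "indicator Y p * (cmod (?G p))\<^sup>2 \<le> indicator Y p * ?B" for p
        by (intro mult_left_mono B) auto
    qed
    also have "\<dots> = (LINT p|lebesgue. indicator Y p) * ?B" by (rule integral_mult_left_zero)
    also have "(LINT p|lebesgue. indicator Y p) = measure lebesgue Y" by simp
    finally show ?thesis unfolding F by (simp add: mult_ac)
  qed
  have "((\<lambda>R. (norm (proj Y (fourier h (proj {-R..R} (proj X f)))))\<^sup>2) \<longlongrightarrow> (norm (proj Y (fourier h (proj X f))))\<^sup>2) at_top"
    by (intro tendsto_intros bounded_linear.tendsto[OF bounded_linear_proj]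
        bounded_linear.tendsto[OF bounded_linear_fourier] proj_tendsto h Y)
  then show ?thesis
    by (rule tendsto_upperbound) (intro always_eventually allI X_R trivial_limit_at_top_linorder)+
qed

section \<open>The prolate operator\<close>

lemma cmod_exp_i_diff_le: "cmod (exp (\<i> * of_real s) - exp (\<i> * of_real t)) \<le> \<bar>s - t\<bar>"
proof -
  have "exp (\<i> * of_real s) - exp (\<i> * of_real t) = exp (\<i> * of_real t) * (exp (\<i> * of_real (s - t)) - 1)"
    by (simp add: right_diff_distrib exp_add[symmetric])
  then have "cmod (exp (\<i> * of_real s) - exp (\<i> * of_real t)) = cmod (exp (\<i> * of_real (s - t)) - 1)"
    by (simp only: norm_mult cmod_exp_i mult_1)
  also have "\<dots> \<le> \<bar>s - t\<bar>" using iexp_approx1[of "s - t" 0] by simp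
  finally show ?thesis .
qed

text \<open>This is what makes the prolate operator compact.\<close>

lemma ft_lipschitz:
  assumes h: "h > 0" and g: "integrable lebesgue g" and supp: "\<And>x. \<bar>x\<bar> > c \<Longrightarrow> g x = 0"
  shows "cmod (ft h g p - ft h g q) \<le> 1 / sqrt (2 * pi * h) * (c / h * (LINT x|lebesgue. cmod (g x))) * \<bar>p - q\<bar>"
proof -
  note [measurable] = borel_measurable_integrable[OF g]
  let ?k = "\<lambda>p x. exp (- (\<i> * complex_of_real (p * x / h)))"
  have "ft h g p - ft h g q = of_real (1 / sqrt (2 * pi * h)) * (LINT x|lebesgue. ?k p x * g x - ?k q x * g x)"
    unfolding ft_def right_diff_distrib[symmetric]
    by (subst Bochner_Integration.integral_diff[OF ft_integrable[OF g] ft_integrable[OF g]]) simp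
  then have "cmod (ft h g p - ft h g q) = 1 / sqrt (2 * pi * h) * cmod (LINT x|lebesgue. ?k p x * g x - ?k q x * g x)"
    using h by (simp only: norm_mult norm_of_real) simp
  also have "\<dots> \<le> 1 / sqrt (2 * pi * h) * (LINT x|lebesgue. cmod (?k p x * g x - ?k q x * g x))"
    using h by (intro mult_left_mono integral_norm_bound) auto
  also have "\<dots> \<le> 1 / sqrt (2 * pi * h) * (LINT x|lebesgue. (c / h * \<bar>p - q\<bar>) * cmod (g x))"
  proof (intro mult_left_mono integral_mono)
    show "integrable lebesgue (\<lambda>x. cmod (?k p x * g x - ?k q x * g x))"
      by (intro integrable_norm Bochner_Integration.integrable_diff ft_integrable g)
    show "integrable lebesgue (\<lambda>x. (c / h * \<bar>p - q\<bar>) * cmod (g x))" using g by simp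
    fix x
    have "cmod (?k p x - ?k q x) \<le> c / h * \<bar>p - q\<bar>" if "\<bar>x\<bar> \<le> c"
    proof -
      have "cmod (?k p x - ?k q x) \<le> \<bar>- (p * x / h) - - (q * x / h)\<bar>"
        using cmod_exp_i_diff_le[of "- (p * x / h)" "- (q * x / h)"] by simp
      also have "\<dots> = \<bar>x\<bar> / h * \<bar>p - q\<bar>"
      proof -
        have "- (p * x / h) - - (q * x / h) = x / h * (q - p)" by (simp add: algebra_simps diff_divide_distrib)
        then show ?thesis using h by (simp add: abs_mult abs_minus_commute)
      qed
      also have "\<dots> \<le> c / h * \<bar>p - q\<bar>" using h that by (intro mult_right_mono divide_right_mono) auto
      finally show ?thesis .
    qed
    moreover have "cmod (?k p x * g x - ?k q x * g x) = cmod (?k p x - ?k q x) * cmod (g x)"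
      by (simp only: left_diff_distrib[symmetric] norm_mult)
    ultimately show "cmod (?k p x * g x - ?k q x * g x) \<le> (c / h * \<bar>p - q\<bar>) * cmod (g x)"
      using supp[of x] mult_right_mono[OF _ norm_ge_zero[of "g x"]]
      by (cases "\<bar>x\<bar> \<le> c") (simp_all only: not_le norm_zero mult_zero_right order_refl)
  qed (use h in auto)
  also have "(LINT x|lebesgue. (c / h * \<bar>p - q\<bar>) * cmod (g x)) = (c / h * \<bar>p - q\<bar>) * (LINT x|lebesgue. cmod (g x))"
    by simp
  finally show ?thesis by (simp only: mult_ac)
qed

lemma integral_exp_Icc:
  assumes "c \<ge> 0" "t \<noteq> 0"
  shows "(LBINT p. indicator {-c..c} p *\<^sub>R exp (\<i> * of_real (p * t))) = of_real (2 * sin (c * t) / t)"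
proof -
  let ?F = "\<lambda>p. exp (\<i> * of_real (p * t)) / (\<i> * of_real t)"
  have "(LBINT p. indicator {-c..c} p *\<^sub>R exp (\<i> * of_real (p * t))) = ?F c - ?F (- c)"
  proof (rule integral_FTC_Icc)
    show "- c \<le> c" using assms by simp
    fix p
    have "((\<lambda>z. exp (\<i> * (z * of_real t)) / (\<i> * of_real t)) has_field_derivative exp (\<i> * (of_real p * of_real t))) (at (of_real p))"
      using assms by (auto intro!: derivative_eq_intros simp: mult.commute[of _ \<i>])
    then have "((\<lambda>p. exp (\<i> * (of_real p * of_real t)) / (\<i> * of_real t)) has_vector_derivative exp (\<i> * (of_real p * of_real t))) (at p within {-c..c})"
      by (rule has_vector_derivative_real_field)
    then show "(?F has_vector_derivative exp (\<i> * of_real (p * t))) (at p within {-c..c})"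
      by simp
    show "continuous_on {-c..c} (\<lambda>p. exp (\<i> * of_real (p * t)))"
      by (intro continuous_intros)
  qed
  also have "?F c - ?F (- c) = of_real (2 * sin (c * t) / t)"
  proof -
    have "exp (\<i> * of_real (c * t)) - exp (\<i> * of_real (- c * t)) = 2 * \<i> * of_real (sin (c * t))"
      unfolding exp_Euler by (simp add: complex_eq_iff flip: of_real_mult sin_of_real cos_of_real)
    then show ?thesis using assms by (simp flip: diff_divide_distrib)
  qed
  finally show ?thesis .
qed

text \<open>The origin of the sine kernel: it is the transform of a character cut to the band
  \<open>[-c, c]\<close>.\<close>

lemma ft_interval_inverse:
  assumes "c > 0"
  shows "ft 1 (\<lambda>p. indicator {-c..c} p * (of_real (1 / sqrt (2 * pi)) * exp (\<i> * of_real (p * x)))) y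
    = of_real (prolate_kernel c x y)"
proof -
  let ?t = "x - y"
  have "ft 1 (\<lambda>p. indicator {-c..c} p * (of_real (1 / sqrt (2 * pi)) * exp (\<i> * of_real (p * x)))) y =
     of_real (1 / (2 * pi)) * (LINT p|lebesgue. indicator {-c..c} p *\<^sub>R exp (\<i> * of_real (p * ?t)))"
  proof -
    have "exp (- (\<i> * of_real (y * p / 1))) * (indicator {-c..c} p * (of_real (1 / sqrt (2 * pi)) * exp (\<i> * of_real (p * x))))
      = of_real (1 / sqrt (2 * pi)) * (indicator {-c..c} p *\<^sub>R exp (\<i> * of_real (p * ?t)))" for p
    proof -
      have "exp (\<i> * of_real (p * ?t)) = exp (- (\<i> * of_real (y * p / 1))) * exp (\<i> * of_real (p * x))"
        unfolding exp_add[symmetric] by (simp add: algebra_simps)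
      then show ?thesis by (simp add: scaleR_conv_of_real of_real_indicator)
    qed
    then have "ft 1 (\<lambda>p. indicator {-c..c} p * (of_real (1 / sqrt (2 * pi)) * exp (\<i> * of_real (p * x)))) y =
      of_real (1 / sqrt (2 * pi)) * (of_real (1 / sqrt (2 * pi)) * (LINT p|lebesgue. indicator {-c..c} p *\<^sub>R exp (\<i> * of_real (p * ?t))))"
      unfolding ft_def by (simp only: integral_mult_right_zero mult_1_right)
    also have "\<dots> = of_real (1 / sqrt (2 * pi) * (1 / sqrt (2 * pi))) * (LINT p|lebesgue. indicator {-c..c} p *\<^sub>R exp (\<i> * of_real (p * ?t)))"
      by (simp only: of_real_mult mult.assoc)
    also have "1 / sqrt (2 * pi) * (1 / sqrt (2 * pi)) = 1 / (2 * pi)" by simp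
    finally show ?thesis .
  qed
  also have "(LINT p|lebesgue. indicator {-c..c} p *\<^sub>R exp (\<i> * of_real (p * ?t)))
      = (LBINT p. indicator {-c..c} p *\<^sub>R exp (\<i> * of_real (p * ?t)))"
    by (rule integral_completion) (auto intro!: borel_measurable_continuous_onI continuous_intros)
  also have "of_real (1 / (2 * pi)) * \<dots> = of_real (prolate_kernel c x y)"
  proof (cases "x = y")
    case True
    have "(LBINT p. indicator {-c..c} p *\<^sub>R (1 :: complex)) = (LBINT p. indicator {-c..c} p) *\<^sub>R 1"
      by (intro integral_scaleR_left integrable_real_indicator) (auto simp: emeasure_lborel_Icc_eq)
    then show ?thesis using True assms by (simp add: prolate_kernel_def scaleR_conv_of_real)
  next
    case False
    have "2 * pi * (x - y) \<noteq> 0" using False by simp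
    then show ?thesis
      using integral_exp_Icc[of c ?t] assms False by (simp add: prolate_kernel_def flip: of_real_mult of_real_divide)
  qed
  finally show ?thesis .
qed

section \<open>The sine-kernel operator from band limiting\<close>

definition band_op :: "real \<Rightarrow> l2 \<Rightarrow> l2" where
  "band_op c f = proj {-c..c} (fourier 1 (proj {-1..1} f))"

text \<open>\<open>l2_cnj\<close>, \<open>fourier 1\<close> and \<open>l2_cnj\<close> in succession
  form the inverse transform, so this is \<open>band_op c\<close> followed by its adjoint.\<close>

definition prolate_op :: "real \<Rightarrow> l2 \<Rightarrow> l2" where
  "prolate_op c f = proj {-1..1} (l2_cnj (fourier 1 (l2_cnj (band_op c f))))"

lemma bounded_linear_band_op: "bounded_linear (band_op c)"
  unfolding band_op_def
  by (intro bounded_linear_compose[OF bounded_linear_proj] bounded_linear_compose[OF bounded_linear_fourier]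
      bounded_linear_proj) auto

lemma bounded_linear_prolate_op: "bounded_linear (prolate_op c)"
  unfolding prolate_op_def
  by (intro bounded_linear_compose[OF bounded_linear_proj] bounded_linear_compose[OF bounded_linear_l2_cnj]
      bounded_linear_compose[OF bounded_linear_fourier] bounded_linear_band_op) auto

text \<open>The factorisation gives symmetry and positivity at once, and it identifies the Rayleigh
  quotients of \<open>prolate_op c\<close> with shares of energy in the band.\<close>

lemma inner_prolate_op: "prolate_op c f \<bullet> g = band_op c f \<bullet> band_op c g"
proof -
  have "prolate_op c f \<bullet> g = l2_cnj (fourier 1 (l2_cnj (band_op c f))) \<bullet> proj {-1..1} g"
    unfolding prolate_op_def by (rule proj_selfadjoint) auto
  also have "\<dots> = l2_cnj (band_op c f) \<bullet> l2_cnj (fourier 1 (proj {-1..1} g))"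
    by (rule l2_cnj_fourier_selfadjoint) simp
  also have "\<dots> = band_op c f \<bullet> fourier 1 (proj {-1..1} g)" by (rule inner_l2_cnj)
  also have "\<dots> = proj {-c..c} (band_op c f) \<bullet> fourier 1 (proj {-1..1} g)"
    by (simp add: band_op_def proj_proj)
  also have "\<dots> = band_op c f \<bullet> band_op c g"
    unfolding band_op_def[of c g] by (rule proj_selfadjoint) auto
  finally show ?thesis .
qed

text \<open>Evaluating \<open>ft 1\<close> at \<open>- x\<close> inverts the transform. The result
  is a representative defined at every point and Lipschitz there, which the compactness proof
  exploits.\<close>

definition prolate_fun :: "real \<Rightarrow> (real \<Rightarrow> complex) \<Rightarrow> real \<Rightarrow> complex" where
  "prolate_fun c f x = ft 1 (\<lambda>p. indicator {-c..c} p * ft 1 (cut {-1..1} f) p) (- x)"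

lemma emeasure_Icc_finite [simp]: "emeasure lebesgue {a..b :: real} < \<infinity>" "emeasure lborel {a..b :: real} < top"
  by (auto simp: emeasure_lborel_Icc_eq)

lemma L2_ft_Icc:
  assumes "h > 0" "L2 f"
  shows "L2 (ft h (cut {a..b} f))"
  using assms by (intro ft_bessel integrable_indicator_L2 L2_indicator) auto

lemma prolate_fun_alt:
  "cnj (ft 1 (\<lambda>p. indicator {-c..c} p * cnj (ft 1 (cut {-1..1} f) p)) x) = prolate_fun c f x"
proof -
  have "cnj (indicator {-c..c} p) = indicator {-c..c} p" for p by (simp add: indicator_def)
  then show ?thesis unfolding prolate_fun_def by (subst cnj_ft) simp
qed

lemma L2_prolate_fun: "L2 f \<Longrightarrow> L2 (prolate_fun c f)"
  unfolding prolate_fun_alt[symmetric] by (intro L2_cnj L2_ft_Icc) auto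

lemma prolate_op_mk:
  assumes f: "L2 f"
  shows "prolate_op c (mk f) = mk (\<lambda>x. indicator {-1..1} x * prolate_fun c f x)"
proof -
  let ?u = "ft 1 (cut {-1..1} f)"
  have u: "L2 ?u" by (intro L2_ft_Icc f) auto
  have "fourier 1 (proj {-1..1} (mk f)) = mk ?u"
    using f by (simp add: proj_mk fourier_mk_interval)
  then have "band_op c (mk f) = mk (\<lambda>p. indicator {-c..c} p * ?u p)"
    using u by (simp add: band_op_def proj_mk)
  then have "l2_cnj (band_op c (mk f)) = mk (\<lambda>p. indicator {-c..c} p * cnj (?u p))"
    using u by (simp add: l2_cnj_mk L2_indicator)
      (intro arg_cong[where f=mk] ext, auto simp: indicator_def)
  moreover have cu: "L2 (\<lambda>p. cnj (?u p))" by (intro L2_cnj u)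
  ultimately have "fourier 1 (l2_cnj (band_op c (mk f))) = mk (ft 1 (\<lambda>p. indicator {-c..c} p * cnj (?u p)))"
    by (simp add: fourier_mk_interval)
  then have "l2_cnj (fourier 1 (l2_cnj (band_op c (mk f)))) = mk (\<lambda>x. cnj (ft 1 (\<lambda>p. indicator {-c..c} p * cnj (?u p)) x))"
    using cu by (simp add: l2_cnj_mk L2_ft_Icc)
  then have "l2_cnj (fourier 1 (l2_cnj (band_op c (mk f)))) = mk (prolate_fun c f)"
    unfolding prolate_fun_alt .
  then show ?thesis using L2_prolate_fun[OF f] by (simp add: prolate_op_def proj_mk)
qed

text \<open>The multiplication formula carries the inner transform from \<open>f\<close> over to the
  cut character, whose own transform is the kernel by \<open>ft_interval_inverse\<close>.\<close>

lemma prolate_fun_eq_operator: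
  assumes c: "c > 0" and f: "L2 f"
  shows "prolate_fun c f = prolate_operator c f"
proof
  fix x
  let ?f = "cut {-1..1} f" and ?W = "\<lambda>p. indicator {-c..c} p * (of_real (1 / sqrt (2 * pi)) * exp (\<i> * of_real (p * x)))"
  have int: "integrable lebesgue ?f" by (intro integrable_indicator_L2 f) auto
  have W: "integrable lebesgue ?W"
  proof (rule Bochner_Integration.integrable_bound)
    show "integrable lebesgue (\<lambda>p. indicator {-c..c} p * (1 / sqrt (2 * pi)))"
      by (intro integrable_mult_left integrable_real_indicator) auto
    show "?W \<in> borel_measurable lebesgue" by measurable
    show "AE p in lebesgue. norm (?W p) \<le> norm (indicator {-c..c} p * (1 / sqrt (2 * pi)))"
      by (intro AE_I2) (simp only: norm_mult cmod_exp_i norm_of_real mult_1_right, simp add: indicator_def)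
  qed
  have "prolate_fun c f x = (LINT p|lebesgue. ft 1 ?f p * ?W p)"
    unfolding prolate_fun_def ft_def[of 1 _ "- x"] integral_mult_right_zero[symmetric]
    by (intro Bochner_Integration.integral_cong refl) (simp add: mult_ac)
  also have "\<dots> = (LINT y|lebesgue. ?f y * ft 1 ?W y)"
    by (rule ft_multiplication_formula[OF int W])
  also have "\<dots> = (LINT y|lebesgue. ?f y * of_real (prolate_kernel c x y))"
    unfolding ft_interval_inverse[OF c] ..
  also have "\<dots> = prolate_operator c f x"
    unfolding prolate_operator_def
    by (simp add: integral_restrict_space scaleR_conv_of_real of_real_indicator mult_ac)
  finally show "prolate_fun c f x = prolate_operator c f x" .
qed

lemma AE_fn_prolate_op:
  assumes "c > 0"
  shows "AE x in lebesgue. fn (prolate_op c f) x = indicator {-1..1} x * prolate_operator c (fn f) x"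
proof -
  have eq: "prolate_op c f = mk (\<lambda>x. indicator {-1..1} x * prolate_fun c (fn f) x)"
    using prolate_op_mk[OF L2_fn] by simp
  have "L2 (prolate_fun c (fn f))" by (intro L2_prolate_fun) simp
  then show ?thesis
    unfolding eq prolate_fun_eq_operator[OF assms L2_fn, symmetric] by (intro fn_mk L2_indicator) auto
qed

section \<open>Compactness and analyticity\<close>

text \<open>The supremum \<open>m\<close> of the Rayleigh quotient is attained: along a maximising
  sequence \<open>A (X n) - m *\<^sub>R X n\<close> tends to 0, and where \<open>A (X n)\<close>
  converges along a subsequence, so does \<open>X n\<close>, because \<open>m > 0\<close>.\<close>

lemma compact_selfadjoint_max_eigenvalue:
  fixes A :: "'a::real_inner \<Rightarrow> 'a"
  assumes A: "bounded_linear A" and sym: "\<And>f g. A f \<bullet> g = f \<bullet> A g" and psd: "\<And>f. 0 \<le> A f \<bullet> f"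
    and compact: "\<And>X :: nat \<Rightarrow> 'a. (\<And>n. norm (X n) \<le> 1) \<Longrightarrow> \<exists>k l. strict_mono k \<and> (\<lambda>n. A (X (k n))) \<longlonglongrightarrow> l"
    and nz: "A f0 \<bullet> f0 > 0"
  obtains m f where "m > 0" "f \<noteq> 0" "A f = m *\<^sub>R f" "\<forall>g. A g \<bullet> g \<le> m * (norm g)\<^sup>2"
proof -
  interpret A: bounded_linear A by fact
  define S where "S = (\<lambda>f. A f \<bullet> f) ` {f. norm f = 1}"
  define m where "m = Sup S"
  obtain K where K: "\<And>f. norm (A f) \<le> norm f * K" using A.bounded by blast
  have bdd: "bdd_above S"
  proof (rule bdd_aboveI[of _ K])
    fix y assume "y \<in> S"
    then obtain f where f: "y = A f \<bullet> f" "norm f = 1" by (auto simp: S_def)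
    show "y \<le> K" using norm_cauchy_schwarz[of "A f" f] K[of f] f by simp
  qed
  have normalize: "A g \<bullet> g = (A (g /\<^sub>R norm g) \<bullet> (g /\<^sub>R norm g)) * (norm g)\<^sup>2" if "g \<noteq> 0" for g
    using that by (simp add: A.scaleR power2_eq_square field_simps)
  have in_S: "A (g /\<^sub>R norm g) \<bullet> (g /\<^sub>R norm g) \<in> S" if "g \<noteq> 0" for g
    unfolding S_def using that by (intro image_eqI[of _ _ "g /\<^sub>R norm g"]) auto
  have "f0 \<noteq> 0" using nz by auto
  note S_ne = in_S[OF this]
  have m_upper: "A g \<bullet> g \<le> m * (norm g)\<^sup>2" for g
  proof (cases "g = 0")
    case False
    then have "A (g /\<^sub>R norm g) \<bullet> (g /\<^sub>R norm g) \<in> S" by (rule in_S)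
    then have "A (g /\<^sub>R norm g) \<bullet> (g /\<^sub>R norm g) \<le> m" unfolding m_def by (intro cSup_upper bdd)
    then show ?thesis unfolding normalize[OF False] by (intro mult_right_mono) auto
  qed (simp add: A.zero)
  have "m > 0"
  proof (rule ccontr)
    assume "\<not> m > 0"
    then have "m * (norm f0)\<^sup>2 \<le> 0" by (intro mult_nonpos_nonneg) auto
    with m_upper[of f0] nz show False by linarith
  qed
  text \<open>Cauchy-Schwarz for the semi-inner product \<open>\<langle>A f, g\<rangle>\<close>, applied to \<open>f\<close> and \<open>A f\<close>.\<close>
  have normA: "(norm (A f))\<^sup>2 \<le> m * (A f \<bullet> f)" for f
  proof (cases "A f = 0")
    case False
    define g where "g = A f"
    have "0 \<le> A (f - (1 / m) *\<^sub>R g) \<bullet> (f - (1 / m) *\<^sub>R g)" by (rule psd)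
    also have "\<dots> = A f \<bullet> f - 2 / m * (g \<bullet> g) + (1 / m)\<^sup>2 * (A g \<bullet> g)"
    proof -
      have "A g \<bullet> f = g \<bullet> g" unfolding sym[of g f] by (simp add: g_def)
      then show ?thesis
        by (simp add: A.diff A.scaleR inner_simps g_def[symmetric] power2_eq_square diff_divide_distrib algebra_simps)
    qed
    also have "\<dots> \<le> A f \<bullet> f - 2 / m * (g \<bullet> g) + (1 / m)\<^sup>2 * (m * (g \<bullet> g))"
      using m_upper[of g] by (intro add_left_mono mult_left_mono) (auto simp: power2_norm_eq_inner)
    also have "\<dots> = A f \<bullet> f - 1 / m * (g \<bullet> g)"
      using \<open>m > 0\<close> by (simp add: power2_eq_square field_simps)
    finally have "1 / m * (g \<bullet> g) \<le> A f \<bullet> f" by simp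
    then show ?thesis using \<open>m > 0\<close> by (simp add: g_def power2_norm_eq_inner field_simps)
  qed (use \<open>m > 0\<close> psd in auto)
  have "\<exists>f. norm f = 1 \<and> A f \<bullet> f > m - 1 / real (Suc n)" for n
  proof -
    have "\<exists>y\<in>S. m - 1 / real (Suc n) < y"
      unfolding m_def using S_ne bdd by (subst less_cSup_iff[symmetric]) (auto simp: divide_simps)
    then show ?thesis by (auto simp: S_def)
  qed
  then obtain X where X: "\<And>n. norm (X n) = 1" "\<And>n. A (X n) \<bullet> X n > m - 1 / real (Suc n)" by metis
  obtain k l where k: "strict_mono k" and l: "(\<lambda>n. A (X (k n))) \<longlonglongrightarrow> l"
    using compact[of X] X(1) by (metis order_refl)
  \<comment> \<open>By \<open>normA\<close> the squared norm of the defect is at most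
    \<open>m * (m - A (X n) \<bullet> X n)\<close>, which tends to 0.\<close>
  have "(\<lambda>n. A (X n) - m *\<^sub>R X n) \<longlonglongrightarrow> 0"
  proof (rule Lim_null_comparison)
    show "\<forall>\<^sub>F n in sequentially. norm (A (X n) - m *\<^sub>R X n) \<le> sqrt (m * (1 / real (Suc n)))"
    proof (intro always_eventually allI real_le_rsqrt)
      fix n
      have "(norm (A (X n) - m *\<^sub>R X n))\<^sup>2 = (norm (A (X n)))\<^sup>2 - 2 * m * (A (X n) \<bullet> X n) + m\<^sup>2"
      proof -
        have "X n \<bullet> X n = 1" using X(1)[of n] by (simp add: power2_norm_eq_inner[symmetric])
        then show ?thesis
          unfolding power2_norm_eq_inner by (simp add: inner_simps inner_commute[of "X n" "A (X n)"] power2_eq_square algebra_simps)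
      qed
      also have "\<dots> \<le> m * (m - A (X n) \<bullet> X n)"
        using normA[of "X n"] by (simp add: power2_eq_square algebra_simps)
      also have "\<dots> \<le> m * (1 / real (Suc n))"
        using X(2)[of n] \<open>m > 0\<close> by (intro mult_left_mono) auto
      finally show "(norm (A (X n) - m *\<^sub>R X n))\<^sup>2 \<le> m * (1 / real (Suc n))" .
    qed
    have "(\<lambda>n. sqrt (m * (1 / real (Suc n)))) \<longlonglongrightarrow> sqrt (m * 0)"
      by (intro tendsto_intros LIMSEQ_Suc[OF lim_1_over_n])
    then show "(\<lambda>n. sqrt (m * (1 / real (Suc n)))) \<longlonglongrightarrow> 0" by simp
  qed
  then have "(\<lambda>n. A (X (k n)) - m *\<^sub>R X (k n)) \<longlonglongrightarrow> 0"
    using LIMSEQ_subseq_LIMSEQ[OF _ k] by (fastforce simp: o_def)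
  with l have "(\<lambda>n. A (X (k n)) - (A (X (k n)) - m *\<^sub>R X (k n))) \<longlonglongrightarrow> l - 0"
    by (rule tendsto_diff)
  then have mX: "(\<lambda>n. m *\<^sub>R X (k n)) \<longlonglongrightarrow> l" by simp
  have "(\<lambda>n. (1 / m) *\<^sub>R (m *\<^sub>R X (k n))) \<longlonglongrightarrow> (1 / m) *\<^sub>R l"
    by (intro tendsto_scaleR tendsto_const mX)
  then have Xk: "(\<lambda>n. X (k n)) \<longlonglongrightarrow> (1 / m) *\<^sub>R l" using \<open>m > 0\<close> by simp
  define f where "f = (1 / m) *\<^sub>R l"
  have "(\<lambda>n. norm (X (k n))) \<longlonglongrightarrow> norm f" using Xk unfolding f_def by (rule tendsto_norm)
  then have "norm f = 1" using X(1) by (simp add: LIMSEQ_const_iff)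
  have "(\<lambda>n. A (X (k n))) \<longlonglongrightarrow> A f" using Xk unfolding f_def by (rule A.tendsto)
  then have "A f = l" using l LIMSEQ_unique by blast
  then have "A f = m *\<^sub>R f" using \<open>m > 0\<close> by (simp add: f_def)
  show thesis
    by (rule that[of m f]) (use \<open>m > 0\<close> \<open>norm f = 1\<close> \<open>A f = m *\<^sub>R f\<close> m_upper in auto)
qed

lemma integral_L2_Icc_le:
  assumes "L2 f" "a \<le> b" "norm (mk f) \<le> B"
  shows "(LINT x|lebesgue. cmod (indicator {a..b} x * f x)) \<le> sqrt (b - a) * B"
proof -
  have "(LINT x|lebesgue. cmod (indicator {a..b} x * f x))\<^sup>2 \<le> measure lebesgue {a..b} * (norm (mk f))\<^sup>2"
    by (intro integral_indicator_L2_le assms) auto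
  also have "\<dots> \<le> (b - a) * B\<^sup>2"
    using assms by (intro mult_mono power_mono) auto
  finally have "(LINT x|lebesgue. cmod (indicator {a..b} x * f x)) \<le> sqrt ((b - a) * B\<^sup>2)"
    by (rule real_le_rsqrt)
  also have "\<dots> = sqrt (b - a) * B"
    using order.trans[OF norm_ge_zero assms(3)] by (simp add: real_sqrt_mult)
  finally show ?thesis .
qed

text \<open>Arzela-Ascoli: band-limited functions of bounded norm are uniformly bounded and share a
  Lipschitz constant. Uniform convergence on \<open>[-1, 1]\<close> then gives convergence in
  \<open>l2\<close>.\<close>

lemma prolate_op_compact:
  assumes c: "c > 0" and X: "\<And>n :: nat. norm (X n) \<le> 1"
  shows "\<exists>k l. strict_mono k \<and> (\<lambda>n. prolate_op c (X (k n))) \<longlonglongrightarrow> l"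
proof -
  define u where "u = (\<lambda>n. ft 1 (\<lambda>y. indicator {-1..1} y * fn (X n) y))"
  define F where "F = (\<lambda>n. prolate_fun c (fn (X n)))"
  have u: "L2 (u n)" for n unfolding u_def by (intro L2_ft_Icc) auto
  have "norm (mk (u n)) \<le> 1" for n
  proof -
    have "mk (u n) = fourier 1 (proj {-1..1} (X n))"
      unfolding u_def proj_def by (intro fourier_mk_interval[symmetric]) auto
    then show ?thesis using norm_proj_le[of "{-1..1}" "X n"] X[of n] by (simp add: norm_fourier)
  qed
  then have u_int: "(LINT p|lebesgue. cmod (indicator {-c..c} p * u n p)) \<le> sqrt (2 * c)" for n
    using integral_L2_Icc_le[OF u, of "-c" c n 1] c by simp
  have int: "integrable lebesgue (cut {-c..c} (u n))" for n
    by (intro integrable_indicator_L2 u) auto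
  have F: "F n x = ft 1 (cut {-c..c} (u n)) (- x)" for n x
    by (simp add: F_def prolate_fun_def u_def)
  \<comment> \<open>\<open>sqrt (2 * c)\<close> is the Cauchy-Schwarz bound \<open>u_int\<close>;
    \<open>M\<close> and later \<open>K\<close> are the constants of \<open>ft_bound\<close> and
    \<open>ft_lipschitz\<close> with this bound inserted.\<close>
  define M where "M = 1 / sqrt (2 * pi * 1) * sqrt (2 * c)"
  have F_bound: "cmod (F n x) \<le> M" for n x
  proof -
    have "cmod (F n x) \<le> 1 / sqrt (2 * pi * 1) * (LINT p|lebesgue. cmod (indicator {-c..c} p * u n p))"
      unfolding F by (intro ft_bound) auto
    also have "\<dots> \<le> M" unfolding M_def by (intro mult_left_mono u_int) auto
    finally show ?thesis .
  qed
  define K where "K = 1 / sqrt (2 * pi * 1) * (c / 1 * sqrt (2 * c))"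
  have K: "K > 0" using c by (simp add: K_def)
  have F_lip: "cmod (F n x - F n y) \<le> K * \<bar>x - y\<bar>" for n x y
  proof -
    have "cmod (F n x - F n y) \<le> 1 / sqrt (2 * pi * 1) * (c / 1 * (LINT p|lebesgue. cmod (indicator {-c..c} p * u n p))) * \<bar>- x - - y\<bar>"
      unfolding F by (intro ft_lipschitz int) (auto simp: indicator_def)
    also have "\<dots> \<le> K * \<bar>- x - - y\<bar>"
      unfolding K_def using c by (intro mult_right_mono mult_left_mono u_int) auto
    finally show ?thesis by (simp add: abs_minus_commute)
  qed
  obtain g k where g: "continuous_on {-1..1} g" and k: "strict_mono (k :: nat \<Rightarrow> nat)"
    and unif: "\<And>e. 0 < e \<Longrightarrow> \<exists>N. \<forall>n x. n \<ge> N \<and> x \<in> {-1..1} \<longrightarrow> norm (F (k n) x - g x) < e"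
  proof (rule Arzela_Ascoli[of "{-1..1::real}" F M])
    show "compact {-1..1::real}" by simp
    show "norm (F n x) \<le> M" for n x by (rule F_bound)
    fix x e :: real assume "0 < e"
    show "\<exists>d>0. \<forall>n y. y \<in> {-1..1} \<and> norm (x - y) < d \<longrightarrow> norm (F n x - F n y) < e"
    proof (intro exI[of _ "e / K"] conjI allI impI)
      fix n y assume "y \<in> {-1..1} \<and> norm (x - y) < e / K"
      then have "K * \<bar>x - y\<bar> < e" using K by (simp add: field_simps)
      then show "norm (F n x - F n y) < e" using F_lip[of n x y] by linarith
    qed (use K \<open>0 < e\<close> in simp)
  qed blast
  have lim: "(\<lambda>n. F (k n) x) \<longlonglongrightarrow> g x" if "x \<in> {-1..1}" for x
  proof (rule LIMSEQ_I)
    fix e :: real assume "0 < e"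
    then show "\<exists>N. \<forall>n\<ge>N. norm (F (k n) x - g x) < e" using unif[of e] that by blast
  qed
  have "(\<lambda>n. mk (cut {-1..1} (F (k n)))) \<longlonglongrightarrow> mk (cut {-1..1} g)"
  proof (rule l2_dominated_convergence[where w="\<lambda>x. indicator {-1..1} x * of_real M"])
    show m: "(cut {-1..1} (F (k n))) \<in> borel_measurable lebesgue" for n
      unfolding F_def by (intro L2_measurable L2_indicator L2_prolate_fun) auto
    have l: "(\<lambda>n. indicator {-1..1} x * F (k n) x) \<longlonglongrightarrow> indicator {-1..1} x * g x" for x
      using lim[of x] by (cases "x \<in> {-1..1}") auto
    then show "AE x in lebesgue. (\<lambda>n. indicator {-1..1} x * F (k n) x) \<longlonglongrightarrow> indicator {-1..1} x * g x" by simp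
    show "(cut {-1..1} g) \<in> borel_measurable lebesgue"
      by (rule borel_measurable_LIMSEQ_metric[OF m l])
    show "AE x in lebesgue. cmod (indicator {-1..1} x * F (k n) x) \<le> cmod (indicator {-1..1} x * of_real M)" for n
      using F_bound order.trans[OF F_bound abs_ge_self] by (intro AE_I2) (auto simp: indicator_def)
    show "L2 (\<lambda>x. indicator {-1..1} x * complex_of_real M)"
      by (intro L2_indicator_const) auto
  qed
  moreover have "prolate_op c (X (k n)) = mk (cut {-1..1} (F (k n)))" for n
    using prolate_op_mk[OF L2_fn, of c "X (k n)"] by (simp add: F_def)
  ultimately have "(\<lambda>n. prolate_op c (X (k n))) \<longlonglongrightarrow> mk (cut {-1..1} g)" by simp
  then show ?thesis using k by blast
qed

text \<open>A nonzero coefficient of positive degree would make the zero at 0 isolated, whereas real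
  zeros accumulate there.\<close>

lemma powser_zero_coeffs:
  fixes a :: "nat \<Rightarrow> complex"
  assumes sums: "\<And>z. (\<lambda>n. a n * z ^ n) sums f z" and "d > 0" and zero: "\<And>t::real. \<bar>t\<bar> < d \<Longrightarrow> f (of_real t) = 0"
  shows "f z = 0"
proof -
  have f0: "f 0 = 0" using zero[of 0] \<open>d > 0\<close> by simp
  have "a m = 0" if "m > 0" for m
  proof (rule ccontr)
    assume "a m \<noteq> 0"
    obtain s where s: "s > 0" "\<And>z. z \<in> cball 0 s - {0} \<Longrightarrow> f z \<noteq> 0"
      using powser_0_nonzero[of 1 0 a f m] sums f0 \<open>a m \<noteq> 0\<close> \<open>m > 0\<close> by auto
    define t where "t = min s (d / 2)"
    have "f (of_real t) \<noteq> 0" using s \<open>d > 0\<close> by (intro s(2)) (auto simp: t_def)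
    moreover have "f (of_real t) = 0" using s \<open>d > 0\<close> by (intro zero) (auto simp: t_def)
    ultimately show False by simp
  qed
  moreover have "a 0 = 0" using sums[of 0] f0 by (simp add: powser_sums_zero_iff)
  ultimately have "a = (\<lambda>_. 0)" by (metis gr0I)
  then have "(\<lambda>n. 0) sums f z" using sums[of z] by simp
  then show ?thesis by (rule sums_unique2[OF _ sums_zero])
qed

text \<open>The transform extends to an entire function whose Taylor coefficients are moments of the
  compactly supported integrand, so zeros on an interval force it to vanish.\<close>

lemma ft_compact_support_analytic:
  assumes g: "integrable lebesgue g" and supp: "\<And>x. \<bar>x\<bar> > 1 \<Longrightarrow> g x = 0"
    and "a < b" and zero: "\<And>p. p \<in> {a<..<b} \<Longrightarrow> ft 1 g p = 0"
  shows "ft 1 g p = 0"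
proof -
  \<comment> \<open>Expanding at the midpoint puts the interval of zeros symmetrically around 0; the
    character at \<open>p0\<close> is absorbed into \<open>G\<close>.\<close>
  define p0 where "p0 = (a + b) / 2"
  define G where "G = (\<lambda>x. exp (- (\<i> * of_real (p0 * x))) * g x)"
  define U where "U = (\<lambda>z. LINT x|lebesgue. exp (- (\<i> * z * of_real x)) * G x)"
  define A where "A = (\<lambda>n. LINT x|lebesgue. (- (\<i> * of_real x)) ^ n /\<^sub>R fact n * G x)"
  note [measurable] = borel_measurable_integrable[OF g]
  have G: "integrable lebesgue G"
    using ft_integrable[OF g, of p0 1] by (simp add: G_def)
  note [measurable] = borel_measurable_integrable[OF G]
  have cG: "cmod (G x) = cmod (g x)" for x by (simp only: G_def norm_mult cmod_exp_i mult_1)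
  have U_ft: "ft 1 g (p0 + t) = of_real (1 / sqrt (2 * pi)) * U (of_real t)" for t
  proof -
    have "exp (- (\<i> * of_real ((p0 + t) * x / 1))) * g x = exp (- (\<i> * of_real t * of_real x)) * G x" for x
      unfolding G_def mult.assoc[symmetric] exp_add[symmetric] by (simp add: algebra_simps)
    then show ?thesis unfolding ft_def U_def by simp
  qed
  have sums: "(\<lambda>n. A n * z ^ n) sums U z" for z
  proof -
    let ?f = "\<lambda>n x. (- (\<i> * z * of_real x)) ^ n /\<^sub>R fact n * G x"
    \<comment> \<open>Where \<open>g\<close> is nonzero, |x| is at most 1, so the terms are
      dominated by those of an exponential series in |z| times |g x|, and sum and integral may be
      exchanged.\<close>
    have nf: "norm (?f n x) \<le> cmod z ^ n /\<^sub>R fact n * cmod (g x)" for n x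
    proof (cases "\<bar>x\<bar> \<le> 1")
      case True
      then have "cmod z * \<bar>x\<bar> \<le> cmod z" by (simp add: mult_left_le)
      then have "(cmod z * \<bar>x\<bar>) ^ n \<le> cmod z ^ n" by (intro power_mono) auto
      then show ?thesis by (simp add: norm_mult norm_power cG mult_right_mono)
    qed (use supp cG[of x] in \<open>auto simp: norm_mult\<close>)
    have int: "integrable lebesgue (?f n)" for n
    proof (rule Bochner_Integration.integrable_bound)
      show "integrable lebesgue (\<lambda>x. cmod z ^ n /\<^sub>R fact n * cmod (g x))" using g by simp
      show "?f n \<in> borel_measurable lebesgue" by measurable
      show "AE x in lebesgue. norm (?f n x) \<le> norm (cmod z ^ n /\<^sub>R fact n * cmod (g x))"
        using nf by (intro AE_I2 order.trans[OF nf]) simp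
    qed
    have exp_sums: "(\<lambda>n. ?f n x) sums (exp (- (\<i> * z * of_real x)) * G x)" for x
      by (intro sums_mult2 exp_converges)
    have "(\<lambda>n. integral\<^sup>L lebesgue (?f n)) sums (LINT x|lebesgue. (\<Sum>n. ?f n x))"
    proof (rule sums_integral)
      show "AE x in lebesgue. summable (\<lambda>n. norm (?f n x))"
      proof (intro AE_I2)
        fix x
        have "summable (\<lambda>n. cmod z ^ n /\<^sub>R fact n * cmod (g x))"
          by (intro summable_mult2 summable_exp_generic)
        then show "summable (\<lambda>n. norm (?f n x))"
          by (rule summable_comparison_test'[where N=0]) (use nf in simp)
      qed
      show "summable (\<lambda>n. LINT x|lebesgue. norm (?f n x))"
      proof (rule summable_comparison_test'[where N=0])
        show "summable (\<lambda>n. cmod z ^ n /\<^sub>R fact n * (LINT x|lebesgue. cmod (g x)))"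
          by (intro summable_mult2 summable_exp_generic)
        fix n
        have "(LINT x|lebesgue. norm (?f n x)) \<le> (LINT x|lebesgue. cmod z ^ n /\<^sub>R fact n * cmod (g x))"
          using g int by (intro integral_mono nf integrable_norm) auto
        then show "norm (LINT x|lebesgue. norm (?f n x)) \<le> cmod z ^ n /\<^sub>R fact n * (LINT x|lebesgue. cmod (g x))"
          by (simp add: Bochner_Integration.integral_nonneg)
      qed
    qed (rule int)
    moreover have "integral\<^sup>L lebesgue (?f n) = A n * z ^ n" for n
    proof -
      have "?f n x = ((- (\<i> * of_real x)) ^ n /\<^sub>R fact n * G x) * z ^ n" for x
      proof -
        have "(- (\<i> * z * of_real x)) ^ n = (- (\<i> * of_real x)) ^ n * z ^ n"
          unfolding power_mult_distrib[symmetric] by (simp add: mult_ac)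
        then show ?thesis by (simp add: mult_ac)
      qed
      then show ?thesis unfolding A_def by (simp only: integral_mult_left_zero)
    qed
    moreover have "(\<Sum>n. ?f n x) = exp (- (\<i> * z * of_real x)) * G x" for x
      using exp_sums[of x] by (rule sums_unique[symmetric])
    ultimately show ?thesis unfolding U_def by simp
  qed
  have "U z = 0" for z
  proof (rule powser_zero_coeffs[OF sums])
    show "(b - a) / 2 > 0" using \<open>a < b\<close> by simp
    fix t :: real assume t: "\<bar>t\<bar> < (b - a) / 2"
    have "a < p0 + t" "p0 + t < b"
      using t unfolding p0_def by (simp_all add: abs_less_iff field_simps)
    then have "of_real (1 / sqrt (2 * pi)) * U (of_real t) = 0"
      unfolding U_ft[symmetric] by (intro zero) auto
    then show "U (of_real t) = 0" by simp
  qed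
  then show ?thesis using U_ft[of "p - p0"] by simp
qed

text \<open>The transform is continuous, so vanishing almost everywhere on \<open>[a, b]\<close>
  means vanishing everywhere inside; analyticity spreads this to the whole line, and Plancherel
  returns it to \<open>f\<close>.\<close>

lemma band_vanish_imp_zero:
  assumes f: "proj {-1..1} f = f" and "a < b" and zero: "proj {a..b} (fourier 1 f) = 0"
  shows "f = 0"
proof -
  let ?g = "cut {-1..1} (fn f)"
  have int: "integrable lebesgue ?g" by (intro integrable_indicator_L2) auto
  have L2: "L2 (ft 1 ?g)" by (intro L2_ft_Icc) auto
  have F: "fourier 1 f = mk (ft 1 ?g)"
    using fourier_mk_interval[of 1 "fn f" "-1" 1] f by (simp add: proj_def)
  have "AE p in lebesgue. indicator {a..b} p * ft 1 ?g p = 0"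
  proof -
    have "AE p in lebesgue. fn (proj {a..b} (mk (ft 1 ?g))) p = indicator {a..b} p * fn (mk (ft 1 ?g)) p"
      by (intro fn_proj) auto
    with fn_mk[OF L2] fn_zero zero[unfolded F] show ?thesis
      by (auto elim: eventually_elim2)
  qed
  then have AE0: "AE p in lebesgue. p \<in> {a<..<b} \<longrightarrow> ft 1 ?g p = 0"
    by eventually_elim (auto simp: indicator_def)
  have cont: "continuous_on UNIV (ft 1 ?g)"
  proof -
    define K where "K = 1 / sqrt (2 * pi * 1) * (1 / 1 * (LINT x|lebesgue. cmod (?g x)))"
    have "cmod (ft 1 ?g p - ft 1 ?g q) \<le> K * \<bar>p - q\<bar>" for p q
      unfolding K_def by (intro ft_lipschitz int) (auto simp: indicator_def)
    moreover have "K \<ge> 0" by (simp add: K_def Bochner_Integration.integral_nonneg)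
    ultimately have "K-lipschitz_on UNIV (ft 1 ?g)" by (intro lipschitz_onI) (auto simp: dist_norm)
    then show ?thesis by (rule lipschitz_on_continuous_on)
  qed
  have zero': "ft 1 ?g p = 0" if p: "p \<in> {a<..<b}" for p
  proof (rule ccontr)
    assume "ft 1 ?g p \<noteq> 0"
    have op: "open {q \<in> {a<..<b}. ft 1 ?g q \<noteq> 0}"
    proof -
      have "open (ft 1 ?g -` (- {0}))" using cont by (intro open_vimage) auto
      then have "open ({a<..<b} \<inter> ft 1 ?g -` (- {0}))" by (intro open_Int) auto
      then show ?thesis by (simp add: vimage_def Int_def conj_commute)
    qed
    have eq: "{q \<in> {a<..<b}. ft 1 ?g q \<noteq> 0} = {q \<in> space lebesgue. \<not> (q \<in> {a<..<b} \<longrightarrow> ft 1 ?g q = 0)}"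
      by auto
    have "{q \<in> {a<..<b}. ft 1 ?g q \<noteq> 0} \<in> sets lborel" unfolding sets_lborel by (rule borel_open[OF op])
    then have "{q \<in> {a<..<b}. ft 1 ?g q \<noteq> 0} \<in> sets lebesgue" by (rule sets_completionI_sets)
    then have "{q \<in> {a<..<b}. ft 1 ?g q \<noteq> 0} \<in> null_sets lebesgue"
      using AE0 unfolding eq by (rule AE_iff_null[THEN iffD1])
    then have "negligible {q \<in> {a<..<b}. ft 1 ?g q \<noteq> 0}" by (simp add: negligible_iff_null_sets)
    with op have "{q \<in> {a<..<b}. ft 1 ?g q \<noteq> 0} = {}" using open_not_negligible by blast
    then show False using p \<open>ft 1 ?g p \<noteq> 0\<close> by blast
  qed
  have "?g x = 0" if "\<bar>x\<bar> > 1" for x using that by (auto simp: indicator_def)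
  then have "ft 1 ?g p = 0" for p
    using ft_compact_support_analytic[OF int _ \<open>a < b\<close> zero'] by blast
  then have "ft 1 ?g = (\<lambda>p. 0)" by (intro ext)
  then have "fourier 1 f = 0" unfolding F zero_l2_def by (rule arg_cong)
  then have "norm f = 0" using norm_fourier[of 1 f] by simp
  then show ?thesis by simp
qed

section \<open>The largest eigenvalue\<close>

lemma L2_on_iff_UNIV:
  assumes "S \<in> sets lebesgue"
  shows "L2_on S f \<longleftrightarrow> L2 (cut S f)"
proof -
  have "f \<in> borel_measurable (lebesgue_on S) \<longleftrightarrow> (cut S f) \<in> borel_measurable lebesgue"
    using assms by (simp add: borel_measurable_restrict_space_iff scaleR_conv_of_real of_real_indicator)
  moreover have "integrable (lebesgue_on S) (\<lambda>x. (cmod (f x))\<^sup>2) \<longleftrightarrow> integrable lebesgue (\<lambda>x. (cmod (indicator S x * f x))\<^sup>2)"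
  proof -
    have "(cmod (indicator S x * f x))\<^sup>2 = indicator S x *\<^sub>R (cmod (f x))\<^sup>2" for x by (simp add: indicator_def)
    then show ?thesis using assms by (simp add: integrable_restrict_space)
  qed
  ultimately show ?thesis by (simp add: L2_on_def lebesgue_on_UNIV_eq)
qed

lemma prolate_operator_indicator:
  "prolate_operator c (cut {-1..1} f) = prolate_operator c f"
  unfolding prolate_operator_def
  by (intro ext Bochner_Integration.integral_cong refl) (auto simp: space_restrict_space)

text \<open>An eigenfunction is constrained on \<open>[-1, 1]\<close> only; cutting to that interval
  makes it a vector of \<open>l2\<close>.\<close>

lemma prolate_eigenfunction_mk:
  assumes c: "c > 0" and f: "prolate_eigenfunction c m f"
  defines "g \<equiv> mk (cut {-1..1} f)"
  shows "L2 (cut {-1..1} f)" "g \<noteq> 0" "prolate_op c g = m *\<^sub>R g" "proj {-1..1} g = g"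
proof -
  let ?F = "cut {-1..1} f"
  show L2: "L2 ?F" using f by (simp add: prolate_eigenfunction_def L2_on_iff_UNIV[symmetric])
  show "g \<noteq> 0"
  proof
    assume "g = 0"
    with fn_mk[OF L2] fn_zero have "AE x in lebesgue. ?F x = 0"
      unfolding g_def by (auto elim: eventually_elim2)
    then have "AE x in lebesgue. x \<in> {-1..1} \<longrightarrow> f x = 0" by eventually_elim (auto simp: indicator_def)
    then have "AE x in lebesgue_on {-1..1}. f x = 0" by (subst AE_restrict_space_iff) auto
    then show False using f by (simp add: prolate_eigenfunction_def)
  qed
  show "proj {-1..1} g = g"
    unfolding g_def using L2 by (simp add: proj_mk indicator_inter_arith[symmetric] mult.assoc[symmetric])
  have "AE x in lebesgue. x \<in> {-1..1} \<longrightarrow> prolate_operator c f x = of_real m * f x"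
    using f by (subst (asm) prolate_eigenfunction_def, subst (asm) (2) AE_restrict_space_iff) auto
  then have AE: "AE x in lebesgue. indicator {-1..1} x * prolate_operator c f x = m *\<^sub>R ?F x"
    by eventually_elim (auto simp: indicator_def scaleR_conv_of_real)
  have "prolate_op c g = mk (\<lambda>x. indicator {-1..1} x * prolate_fun c ?F x)"
    unfolding g_def by (rule prolate_op_mk[OF L2])
  also have "\<dots> = mk (\<lambda>x. m *\<^sub>R ?F x)"
  proof (rule mk_eqI)
    show "L2 (\<lambda>x. indicator {-1..1} x * prolate_fun c ?F x)"
      by (intro L2_indicator L2_prolate_fun L2) auto
    show "L2 (\<lambda>x. m *\<^sub>R ?F x)" by (intro L2_scaleR L2)
    show "AE x in lebesgue. indicator {-1..1} x * prolate_fun c ?F x = m *\<^sub>R ?F x"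
      using AE unfolding prolate_fun_eq_operator[OF c L2] prolate_operator_indicator .
  qed
  also have "\<dots> = m *\<^sub>R g" unfolding g_def by (rule mk_scaleR[OF L2])
  finally show "prolate_op c g = m *\<^sub>R g" .
qed

text \<open>For a nonzero eigenvalue the eigenvector vanishes outside \<open>[-1, 1]\<close>, so it
  cannot become zero when restricted to that interval.\<close>

lemma prolate_eigenfunction_fn:
  assumes c: "c > 0" and f: "f \<noteq> 0" "prolate_op c f = m *\<^sub>R f" "m \<noteq> 0"
  shows "prolate_eigenfunction c m (fn f)"
  unfolding prolate_eigenfunction_def
proof (intro conjI notI)
  show "L2_on {-1..1} (fn f)" by (subst L2_on_iff_UNIV) (simp_all add: L2_indicator)
  have AE: "AE x in lebesgue. indicator {-1..1} x * prolate_operator c (fn f) x = m *\<^sub>R fn f x"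
    using AE_fn_prolate_op[OF c, of f] fn_scaleR[of m f] unfolding f(2)
    by eventually_elim (simp only:)
  then have "AE x in lebesgue. x \<in> {-1..1} \<longrightarrow> prolate_operator c (fn f) x = of_real m * fn f x"
    by (rule eventually_mono) (auto simp: indicator_def scaleR_conv_of_real)
  then show "AE x in lebesgue_on {-1..1}. prolate_operator c (fn f) x = of_real m * fn f x"
    by (subst AE_restrict_space_iff) auto
  assume "AE x in lebesgue_on {-1..1}. fn f x = 0"
  then have "AE x in lebesgue. x \<in> {-1..1} \<longrightarrow> fn f x = 0" by (subst (asm) AE_restrict_space_iff) auto
  with AE have "AE x in lebesgue. fn f x = 0"
  proof eventually_elim
    case (elim x)
    then show ?case using f(3) by (cases "x \<in> {-1..1}") simp_all
  qed
  with fn_zero have "AE x in lebesgue. fn f x = fn 0 x" by eventually_elim simp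
  then have "f = 0" by (rule l2_eqI)
  with f show False by simp
qed

lemma nonzero_in_unit_interval:
  obtains f where "f \<noteq> 0" "proj {-1..1} f = f"
proof
  let ?f = "\<lambda>x::real. indicator {-1..1} x * (1 :: complex)"
  have L2: "L2 ?f" by (intro L2_indicator_const) auto
  show "proj {-1..1} (mk ?f) = mk ?f"
    using L2 by (simp add: proj_mk indicator_inter_arith[symmetric] mult.assoc[symmetric])
  have "(norm (mk ?f))\<^sup>2 = (LINT x|lebesgue. indicator {-1..1::real} x)"
    unfolding norm_mk_sq[OF L2] by (intro Bochner_Integration.integral_cong) (auto simp: indicator_def)
  then have "(norm (mk ?f))\<^sup>2 = 2" by simp
  then show "mk ?f \<noteq> 0" by auto
qed

lemma band_op_nonzero:
  assumes "c > 0" "f \<noteq> 0" "proj {-1..1} f = f"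
  shows "band_op c f \<noteq> 0"
  using band_vanish_imp_zero[of f "-c" c] assms by (auto simp: band_op_def)

text \<open>The greatest eigenvalue in the definition of \<open>lambda0\<close> exists: the maximal
  Rayleigh quotient is an eigenvalue, and each eigenvalue is a Rayleigh quotient. Hence
  \<open>lambda0 c\<close> is the squared operator norm of \<open>band_op c\<close>.\<close>

lemma lambda0_eigenvalue:
  assumes c: "c > 0"
  obtains f where "f \<noteq> 0" "prolate_op c f = lambda0 c *\<^sub>R f" "lambda0 c > 0"
    "\<forall>g. (norm (band_op c g))\<^sup>2 \<le> lambda0 c * (norm g)\<^sup>2"
proof -
  have inner: "prolate_op c f \<bullet> f = (norm (band_op c f))\<^sup>2" for f
    by (simp add: inner_prolate_op power2_norm_eq_inner)
  obtain f0 where f0: "f0 \<noteq> 0" "proj {-1..1} f0 = f0" by (rule nonzero_in_unit_interval)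
  have sym: "prolate_op c f \<bullet> g = f \<bullet> prolate_op c g" for f g
    using inner_prolate_op[of c f g] inner_prolate_op[of c g f] by (simp add: inner_commute)
  have psd: "0 \<le> prolate_op c f \<bullet> f" for f by (simp add: inner)
  have nz: "prolate_op c f0 \<bullet> f0 > 0" using band_op_nonzero[OF c f0] by (simp add: inner)
  obtain m f where m: "m > 0" "f \<noteq> 0" "prolate_op c f = m *\<^sub>R f" "\<forall>g. prolate_op c g \<bullet> g \<le> m * (norm g)\<^sup>2"
    by (rule compact_selfadjoint_max_eigenvalue[OF bounded_linear_prolate_op sym psd prolate_op_compact[OF c] nz])
  have "lambda0 c = m"
    unfolding lambda0_def
  proof (rule Greatest_equality)
    show "\<exists>f. prolate_eigenfunction c m f" using prolate_eigenfunction_fn[OF c m(2,3)] m(1) by auto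
    fix m' assume "\<exists>f. prolate_eigenfunction c m' f"
    then obtain f' where f': "prolate_eigenfunction c m' f'" ..
    define g where "g = mk (\<lambda>x. indicator {-1..1} x * f' x)"
    have g: "g \<noteq> 0" "prolate_op c g = m' *\<^sub>R g" using prolate_eigenfunction_mk[OF c f'] by (simp_all add: g_def)
    have "m' * (norm g)\<^sup>2 \<le> m * (norm g)\<^sup>2" using m(4)[rule_format, of g] g by (simp add: power2_norm_eq_inner)
    then show "m' \<le> m" using g(1) by simp
  qed
  then show thesis using that[of f] m by (auto simp: inner)
qed

lemma lambda0_pos: "c > 0 \<Longrightarrow> lambda0 c > 0"
  by (rule lambda0_eigenvalue)

lemma band_op_le_lambda0: "c > 0 \<Longrightarrow> (norm (band_op c g))\<^sup>2 \<le> lambda0 c * (norm g)\<^sup>2"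
  by (rule lambda0_eigenvalue) auto

lemma eigenvector_band_op:
  assumes "prolate_op c f = m *\<^sub>R f"
  shows "(norm (band_op c f))\<^sup>2 = m * (norm f)\<^sup>2"
  using inner_prolate_op[of c f f] assms by (simp add: power2_norm_eq_inner)

lemma eigenvector_proj:
  assumes "prolate_op c f = m *\<^sub>R f" "m \<noteq> 0"
  shows "proj {-1..1} f = f"
proof -
  have "proj {-1..1} (m *\<^sub>R f) = m *\<^sub>R f"
    unfolding assms(1)[symmetric] by (simp add: prolate_op_def proj_proj)
  then show ?thesis using assms(2) by (simp add: proj_scaleR)
qed

lemma prolate_eigenfunction_lambda0:
  assumes "c > 0"
  obtains f where "prolate_eigenfunction c (lambda0 c) f"
proof (rule lambda0_eigenvalue[OF assms])
  fix f assume "f \<noteq> 0" "prolate_op c f = lambda0 c *\<^sub>R f" "lambda0 c > 0"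
  then show thesis using that[OF prolate_eigenfunction_fn[OF assms]] by simp
qed

lemma lambda0_attained:
  assumes c: "c > 0"
  obtains f where "f \<noteq> 0" "proj {-1..1} f = f" "(norm (band_op c f))\<^sup>2 = lambda0 c * (norm f)\<^sup>2"
proof (rule lambda0_eigenvalue[OF c])
  fix f assume f: "f \<noteq> 0" "prolate_op c f = lambda0 c *\<^sub>R f" "lambda0 c > 0"
  show thesis by (rule that[OF f(1) eigenvector_proj[OF f(2)] eigenvector_band_op[OF f(2)]]) (use f(3) in auto)
qed

section \<open>Monotonicity, continuity and range of the largest eigenvalue\<close>

lemma norm_proj_Un:
  assumes "X \<in> sets lebesgue" "Y \<in> sets lebesgue" "X \<inter> Y = {}"
  shows "(norm (proj (X \<union> Y) f))\<^sup>2 = (norm (proj X f))\<^sup>2 + (norm (proj Y f))\<^sup>2"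
proof -
  have "integrable lebesgue (\<lambda>x. indicator Z x * (fn f x \<bullet> fn f x))" if "Z \<in> sets lebesgue" for Z
    using integrable_mult_indicator[OF that integrable_L2_inner[OF L2_fn[of f] L2_fn[of f]]] by simp
  then show ?thesis
    using assms by (simp add: inner_proj_self[symmetric] inner_proj indicator_disj_union[OF assms(3)] distrib_right)
qed

lemma norm_band_op_split:
  assumes "0 < c" "c \<le> d"
  shows "(norm (band_op d f))\<^sup>2 = (norm (band_op c f))\<^sup>2 + (norm (proj ({-d..d} - {-c..c}) (fourier 1 (proj {-1..1} f))))\<^sup>2"
proof -
  have eq: "{-d..d} = {-c..c} \<union> ({-d..d} - {-c..c})" using assms by auto
  show ?thesis
    unfolding band_op_def by (subst eq, rule norm_proj_Un) auto
qed

text \<open>The maximiser for \<open>c\<close> serves as a trial vector for \<open>d\<close>; by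
  \<open>band_vanish_imp_zero\<close> its transform has some energy in the added band.\<close>

lemma lambda0_strict_mono:
  assumes c: "0 < c" "c < d"
  shows "lambda0 c < lambda0 d"
proof (rule lambda0_attained[OF c(1)])
  fix f assume f: "f \<noteq> 0" "proj {-1..1} f = f" "(norm (band_op c f))\<^sup>2 = lambda0 c * (norm f)\<^sup>2"
  \<comment> \<open>Starting at the midpoint keeps this closed interval wholly inside the added set
    \<open>{-d..d} - {-c..c}\<close>.\<close>
  have "proj {(c + d) / 2..d} (fourier 1 f) \<noteq> 0"
    using band_vanish_imp_zero[OF f(2), of "(c + d) / 2" d] f(1) c by auto
  moreover have "proj {(c + d) / 2..d} (fourier 1 f) = proj {(c + d) / 2..d} (proj ({-d..d} - {-c..c}) (fourier 1 f))"
  proof -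
    have "{(c + d) / 2..d} \<inter> ({-d..d} - {-c..c}) = {(c + d) / 2..d}" using c by auto
    then show ?thesis by (simp add: proj_proj)
  qed
  ultimately have "proj ({-d..d} - {-c..c}) (fourier 1 f) \<noteq> 0"
    using proj_scaleR[of "{(c + d) / 2..d}" 0 0] by auto
  then have "(norm (band_op d f))\<^sup>2 > lambda0 c * (norm f)\<^sup>2"
    using norm_band_op_split[of c d f] c f by simp
  then have "lambda0 c * (norm f)\<^sup>2 < lambda0 d * (norm f)\<^sup>2"
    using band_op_le_lambda0[of d f] c by linarith
  then show ?thesis using f(1) by simp
qed

lemma lambda0_mono: "0 < c \<Longrightarrow> c \<le> d \<Longrightarrow> lambda0 c \<le> lambda0 d"
  using lambda0_strict_mono[of c d] by (cases "c = d") auto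

lemma norm_band_op_le: "norm (band_op c f) \<le> norm f"
proof -
  have "norm (band_op c f) \<le> norm (fourier 1 (proj {-1..1} f))"
    unfolding band_op_def by (rule norm_proj_le) auto
  also have "\<dots> \<le> norm f" by (simp add: norm_fourier norm_proj_le)
  finally show ?thesis .
qed

text \<open>The isometry by itself gives only the bound 1. Taken at \<open>c + 1\<close>, it becomes
  strict at \<open>c\<close> by strict monotonicity.\<close>

lemma lambda0_less_1:
  assumes c: "c > 0"
  shows "lambda0 c < 1"
proof -
  have "lambda0 (c + 1) \<le> 1"
  proof (rule lambda0_attained[of "c + 1"])
    fix f assume f: "f \<noteq> 0" "(norm (band_op (c + 1) f))\<^sup>2 = lambda0 (c + 1) * (norm f)\<^sup>2"
    have "(norm (band_op (c + 1) f))\<^sup>2 \<le> (norm f)\<^sup>2" by (intro power_mono norm_band_op_le) auto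
    then show ?thesis using f by simp
  qed (use c in auto)
  then show ?thesis using lambda0_strict_mono[of c "c + 1"] c by simp
qed

text \<open>The maximiser for \<open>d\<close> serves as a trial vector for \<open>c\<close>. The
  lost band has measure 2 (d - c), the position interval has length 2, and
  \<open>hilbert_schmidt_bound\<close> turns their product into the constant after division by 2
  pi.\<close>

lemma lambda0_Lipschitz:
  assumes c: "0 < c" "c \<le> d"
  shows "lambda0 d - lambda0 c \<le> 2 / pi * (d - c)"
proof (rule lambda0_attained[of d])
  fix f assume f: "f \<noteq> 0" "proj {-1..1} f = f" "(norm (band_op d f))\<^sup>2 = lambda0 d * (norm f)\<^sup>2"
  let ?Y = "{-d..d} - {-c..c}"
  have Y: "emeasure lebesgue ?Y < \<infinity>"
    by (rule le_less_trans[OF emeasure_mono emeasure_Icc_finite(1)[of "-d" d]]) auto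
  have "(norm (proj ?Y (fourier 1 (proj {-1..1} f))))\<^sup>2 \<le> measure lebesgue {-1..1::real} * measure lebesgue ?Y / (2 * pi * 1) * (norm (proj {-1..1} f))\<^sup>2"
    by (intro hilbert_schmidt_bound Y) auto
  also have "measure lebesgue ?Y = measure lebesgue {-d..d} - measure lebesgue {-c..c}"
    using c by (intro measure_Diff) auto
  finally have *: "(norm (proj ?Y (fourier 1 (proj {-1..1} f))))\<^sup>2 \<le> 2 / pi * (d - c) * (norm f)\<^sup>2"
    using c f(2) by (simp add: field_simps)
  have "lambda0 d * (norm f)\<^sup>2 = (norm (band_op c f))\<^sup>2 + (norm (proj ?Y (fourier 1 (proj {-1..1} f))))\<^sup>2"
    using norm_band_op_split[OF c, of f] f by simp
  also have "\<dots> \<le> (lambda0 c + 2 / pi * (d - c)) * (norm f)\<^sup>2"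
    using band_op_le_lambda0[OF c(1), of f] * by (simp only: distrib_right)
  finally show ?thesis using f(1) by simp
qed (use c in auto)

text \<open>The same estimate for the whole band \<open>[-c, c]\<close>. It makes
  \<open>lambda0\<close> small near 0, as \<open>lambda0_surj\<close> requires.\<close>

lemma lambda0_le_linear:
  assumes c: "c > 0"
  shows "lambda0 c \<le> 2 / pi * c"
proof (rule lambda0_attained[OF c])
  fix f assume f: "f \<noteq> 0" "proj {-1..1} f = f" "(norm (band_op c f))\<^sup>2 = lambda0 c * (norm f)\<^sup>2"
  have "(norm (band_op c f))\<^sup>2 \<le> measure lebesgue {-1..1::real} * measure lebesgue {-c..c} / (2 * pi * 1) * (norm (proj {-1..1} f))\<^sup>2"
    unfolding band_op_def by (intro hilbert_schmidt_bound) auto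
  also have "\<dots> = 2 / pi * c * (norm f)\<^sup>2" using c f(2) by simp
  finally have "lambda0 c * (norm f)\<^sup>2 \<le> 2 / pi * c * (norm f)\<^sup>2" using f(3) by simp
  then show ?thesis by (rule mult_right_le_imp_le) (use f(1) in simp)
qed

lemma continuous_on_lambda0: "continuous_on {0<..} lambda0"
proof -
  have "(2 / pi)-lipschitz_on {0<..} lambda0"
  proof (rule lipschitz_onI)
    fix c d :: real assume "c \<in> {0<..}" "d \<in> {0<..}"
    then show "dist (lambda0 c) (lambda0 d) \<le> 2 / pi * dist c d"
      using lambda0_Lipschitz[of c d] lambda0_Lipschitz[of d c] lambda0_mono[of c d] lambda0_mono[of d c]
      by (cases "c \<le> d") (auto simp: dist_real_def)
  qed simp
  then show ?thesis by (rule lipschitz_on_continuous_on)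
qed

text \<open>Any fixed vector has almost all of its momentum energy in some bounded band, so a trial
  vector that is no maximiser suffices.\<close>

lemma lambda0_approaches_1:
  assumes "y < 1"
  obtains c where "c > 0" "lambda0 c > y"
proof (rule nonzero_in_unit_interval)
  fix f assume f: "f \<noteq> 0" "proj {-1..1} f = f"
  have "((\<lambda>R. (norm (proj {-R..R} (fourier 1 f)))\<^sup>2) \<longlongrightarrow> (norm (fourier 1 f))\<^sup>2) at_top"
    by (intro tendsto_intros proj_tendsto)
  then have "((\<lambda>R. (norm (band_op R f))\<^sup>2) \<longlongrightarrow> (norm f)\<^sup>2) at_top"
    by (simp add: band_op_def f norm_fourier)
  moreover have "y * (norm f)\<^sup>2 < (norm f)\<^sup>2" using assms f by simp
  ultimately have "eventually (\<lambda>R. (norm (band_op R f))\<^sup>2 > y * (norm f)\<^sup>2) at_top"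
    by (rule order_tendstoD)
  then obtain c where c: "c > 0" "(norm (band_op c f))\<^sup>2 > y * (norm f)\<^sup>2"
    using eventually_happens'[OF trivial_limit_at_top_linorder eventually_conj[OF eventually_gt_at_top[of 0]]] by blast
  have "y * (norm f)\<^sup>2 < lambda0 c * (norm f)\<^sup>2" using c band_op_le_lambda0[of c f] by linarith
  then show thesis using that[of c] c f by simp
qed

lemma lambda0_surj:
  assumes "0 < y" "y < 1"
  obtains c where "c > 0" "lambda0 c = y"
proof -
  obtain d where d: "d > 0" "lambda0 d > y" by (rule lambda0_approaches_1[OF assms(2)])
  \<comment> \<open>At or below \<open>y * pi / 2\<close> the linear bound keeps
    \<open>lambda0\<close> at most \<open>y\<close>; the minimum with \<open>d\<close> orders the
    endpoints for the intermediate value theorem.\<close>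
  define a where "a = min d (y * pi / 2)"
  have a: "a > 0" "a \<le> d" using assms d by (auto simp: a_def)
  have "lambda0 a \<le> 2 / pi * (y * pi / 2)"
    using lambda0_le_linear[OF a(1)] by (rule order.trans) (intro mult_left_mono, auto simp: a_def)
  then have "lambda0 a \<le> y" by simp
  moreover have "continuous_on {a..d} lambda0"
    using a by (intro continuous_on_subset[OF continuous_on_lambda0]) auto
  ultimately obtain c where "a \<le> c" "c \<le> d" "lambda0 c = y"
    using IVT'[of lambda0 a y d] d a by auto
  then show thesis using that[of c] a by linarith
qed

lemma inj_on_lambda0: "inj_on lambda0 {0<..}"
  by (intro linorder_inj_onI') (metis greaterThan_iff lambda0_strict_mono less_irrefl)

lemma lambda0_inv_lambda0:
  assumes "c > 0"
  shows "lambda0_inv (lambda0 c) = ennreal c"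
  using assms lambda0_less_1[OF assms] inj_on_lambda0 by (simp add: lambda0_inv_def)

section \<open>Rescaling and Slepian functions\<close>

lemma L2_affine:
  assumes f: "L2 f" and "l \<noteq> 0"
  shows "L2 (\<lambda>u. f (x0 + l * u))"
proof -
  have "(\<lambda>u. x0 + l * u) \<in> lebesgue \<rightarrow>\<^sub>M lebesgue"
    using lebesgue_affine_measurable[where c="\<lambda>x::real. l" and t=x0] assms(2) by simp
  then have "(\<lambda>u. f (x0 + l * u)) \<in> borel_measurable lebesgue"
    by (rule measurable_compose) (rule L2_measurable[OF f])
  moreover have "integrable lebesgue (\<lambda>x. (cmod (f x))\<^sup>2)" using f by (simp add: L2_iff)
  then have "integrable lebesgue (\<lambda>u. (cmod (f (x0 + l * u)))\<^sup>2)"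
    by (rule lebesgue_integrable_real_affine) fact
  ultimately show ?thesis by (simp add: L2_iff)
qed

text \<open>Translations in position and momentum and dilations carry the interval \<open>[x0 - l, x0 + l]\<close> to
  \<open>[-1, 1]\<close> and the momentum interval \<open>[p0 - w, p0 + w]\<close> to \<open>[-c, c]\<close> with \<open>c = w l / h\<close>.\<close>

lemma
  fixes f :: "real \<Rightarrow> complex" and x0 p0 w :: real
  assumes h: "h > 0" and l: "l > 0" and f: "L2 f"
  defines "g \<equiv> \<lambda>u. exp (- (\<i> * of_real (p0 * (l * u) / h))) * f (x0 + l * u)"
  shows rescale_L2: "L2 g"
    and rescale_norm: "(norm (mk (cut {x0-l..x0+l} f)))\<^sup>2 = l * (norm (mk (cut {-1..1} g)))\<^sup>2"
    and rescale_band: "(norm (proj {p0-w..p0+w} (fourier h (mk (cut {x0-l..x0+l} f)))))\<^sup>2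
      = l * (norm (proj {-(w * l / h)..w * l / h} (fourier 1 (mk (cut {-1..1} g)))))\<^sup>2"
proof -
  let ?F = "cut {x0-l..x0+l} f" and ?G = "cut {-1..1} g"
  show g: "L2 g"
    unfolding g_def by (rule L2_mult[where B=1, OF L2_affine[OF f]]) (use l in auto)
  have F: "L2 ?F" "L2 (ft h ?F)" and G: "L2 ?G" "L2 (ft 1 ?G)"
    using f g h by (auto intro: L2_indicator L2_ft_Icc)
  have ind: "indicator {x0-l..x0+l} (x0 + l * u) = (indicator {-1..1} u :: 'a::zero_neq_one)" for u
  proof -
    have "x0 + l * u \<in> {x0-l..x0+l} \<longleftrightarrow> u \<in> {-1..1}"
    proof -
      have "x0 - l \<le> x0 + l * u \<longleftrightarrow> l * (-1) \<le> l * u" "x0 + l * u \<le> x0 + l \<longleftrightarrow> l * u \<le> l * 1" by auto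
      then show ?thesis using l by (simp only: mult_le_cancel_left_pos atLeastAtMost_iff)
    qed
    then show ?thesis by (simp add: indicator_def)
  qed
  have cg: "cmod (g u) = cmod (f (x0 + l * u))" for u unfolding g_def norm_mult cmod_exp_i by simp
  show "(norm (mk ?F))\<^sup>2 = l * (norm (mk ?G))\<^sup>2"
  proof -
    have "(norm (mk ?F))\<^sup>2 = \<bar>l\<bar> *\<^sub>R (LINT u|lebesgue. (cmod (?F (x0 + l * u)))\<^sup>2)"
      unfolding norm_mk_sq[OF F(1)] using l by (intro lebesgue_integral_real_affine) auto
    also have "(LINT u|lebesgue. (cmod (?F (x0 + l * u)))\<^sup>2) = (norm (mk ?G))\<^sup>2"
      unfolding norm_mk_sq[OF G(1)] by (simp only: ind norm_mult cg)
    finally show ?thesis using l by simp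
  qed
  \<comment> \<open>The shift by \<open>x0\<close> contributes a phase, which the modulus removes.
    The squared Jacobian gives \<open>l\<^sup>2\<close>, and the normalisations for \<open>h\<close>
    and for 1 differ by the factor \<open>1 / h\<close> after squaring.\<close>
  have ft: "(cmod (ft h ?F (p0 + h / l * r)))\<^sup>2 = l\<^sup>2 / h * (cmod (ft 1 ?G r))\<^sup>2" for r
  proof -
    let ?p = "p0 + h / l * r"
    have "(LINT x|lebesgue. exp (- (\<i> * of_real (?p * x / h))) * ?F x) =
        \<bar>l\<bar> *\<^sub>R (LINT u|lebesgue. exp (- (\<i> * of_real (?p * (x0 + l * u) / h))) * ?F (x0 + l * u))"
      using l by (intro lebesgue_integral_real_affine) auto
    also have "(LINT u|lebesgue. exp (- (\<i> * of_real (?p * (x0 + l * u) / h))) * ?F (x0 + l * u)) =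
        (LINT u|lebesgue. exp (- (\<i> * of_real (?p * x0 / h))) * (exp (- (\<i> * of_real (r * u / 1))) * ?G u))"
    proof (intro Bochner_Integration.integral_cong refl)
      fix u
      have "?p * (x0 + l * u) / h = ?p * x0 / h + r * u / 1 + p0 * (l * u) / h"
        using h l by (simp add: field_simps)
      then have "exp (- (\<i> * of_real (?p * (x0 + l * u) / h))) =
          exp (- (\<i> * of_real (?p * x0 / h)) + - (\<i> * of_real (r * u / 1)) + - (\<i> * of_real (p0 * (l * u) / h)))"
        by (simp only: of_real_add distrib_left minus_add_distrib)
      then have "exp (- (\<i> * of_real (?p * (x0 + l * u) / h))) =
          exp (- (\<i> * of_real (?p * x0 / h))) * exp (- (\<i> * of_real (r * u / 1))) * exp (- (\<i> * of_real (p0 * (l * u) / h)))"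
        by (simp only: exp_add)
      then show "exp (- (\<i> * of_real (?p * (x0 + l * u) / h))) * ?F (x0 + l * u) =
          exp (- (\<i> * of_real (?p * x0 / h))) * (exp (- (\<i> * of_real (r * u / 1))) * ?G u)"
        unfolding ind g_def by (simp only: mult_ac)
    qed
    also have "\<dots> = exp (- (\<i> * of_real (?p * x0 / h))) * (LINT u|lebesgue. exp (- (\<i> * of_real (r * u / 1))) * ?G u)"
      by (rule integral_mult_right_zero)
    finally have "cmod (ft h ?F ?p) = \<bar>1 / sqrt (2 * pi * h)\<bar> * (\<bar>l\<bar> * cmod (LINT u|lebesgue. exp (- (\<i> * of_real (r * u / 1))) * ?G u))"
      unfolding ft_def norm_mult norm_of_real by (simp only: norm_scaleR norm_mult cmod_exp_i abs_idempotent mult_1)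
    moreover have "cmod (ft 1 ?G r) = \<bar>1 / sqrt (2 * pi * 1)\<bar> * cmod (LINT u|lebesgue. exp (- (\<i> * of_real (r * u / 1))) * ?G u)"
      unfolding ft_def norm_mult norm_of_real ..
    ultimately show ?thesis
      using h l by (simp add: power_mult_distrib power_divide)
  qed
  let ?c = "w * l / h"
  have ind2: "indicator {p0-w..p0+w} (p0 + h / l * r) = (indicator {-?c..?c} r :: real)" for r
  proof -
    have "p0 + h / l * r \<in> {p0-w..p0+w} \<longleftrightarrow> r \<in> {-?c..?c}"
      using h l by (auto simp: field_simps)
    then show ?thesis by (simp add: indicator_def)
  qed
  have "(norm (proj {p0-w..p0+w} (fourier h (mk ?F))))\<^sup>2 = (LINT p|lebesgue. indicator {p0-w..p0+w} p * (cmod (ft h ?F p))\<^sup>2)"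
    unfolding fourier_mk_interval[OF h f] by (rule norm_proj_mk_sq[OF _ F(2)]) auto
  also have "\<dots> = \<bar>h / l\<bar> *\<^sub>R (LINT r|lebesgue. indicator {p0-w..p0+w} (p0 + h / l * r) * (cmod (ft h ?F (p0 + h / l * r)))\<^sup>2)"
    using h l by (intro lebesgue_integral_real_affine) auto
  also have "(LINT r|lebesgue. indicator {p0-w..p0+w} (p0 + h / l * r) * (cmod (ft h ?F (p0 + h / l * r)))\<^sup>2)
     = l\<^sup>2 / h * (LINT r|lebesgue. indicator {-?c..?c} r * (cmod (ft 1 ?G r))\<^sup>2)"
    unfolding ind2 ft integral_mult_right_zero[symmetric]
    by (intro Bochner_Integration.integral_cong refl) (simp only: mult_ac)
  also have "(LINT r|lebesgue. indicator {-?c..?c} r * (cmod (ft 1 ?G r))\<^sup>2) = (norm (proj {-?c..?c} (fourier 1 (mk ?G))))\<^sup>2"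
    unfolding fourier_mk_interval[OF zero_less_one g] by (rule norm_proj_mk_sq[OF _ G(2), symmetric]) auto
  finally show "(norm (proj {p0-w..p0+w} (fourier h (mk ?F))))\<^sup>2 = l * (norm (proj {-?c..?c} (fourier 1 (mk ?G))))\<^sup>2"
    using h l by (simp add: power2_eq_square)
qed

text \<open>The parameter is the product of the half-widths divided by \<open>h\<close>; the two
  halves account for the factor 4 in the denominator.\<close>

lemma interval_concentration:
  assumes h: "h > 0" and "a < b" "p < q"
  shows "(norm (proj {p..q} (fourier h (proj {a..b} f))))\<^sup>2 \<le> lambda0 ((b - a) * (q - p) / (4 * h)) * (norm (proj {a..b} f))\<^sup>2"
proof -
  define x0 l p0 w where "x0 = (a + b) / 2" and "l = (b - a) / 2" and "p0 = (p + q) / 2" and "w = (q - p) / 2"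
  have l: "l > 0" and w: "w > 0" using assms by (auto simp: l_def w_def)
  have ab: "{x0-l..x0+l} = {a..b}" and pq: "{p0-w..p0+w} = {p..q}"
    by (auto simp: x0_def l_def p0_def w_def field_simps)
  define g where "g = (\<lambda>u. exp (- (\<i> * of_real (p0 * (l * u) / h))) * fn f (x0 + l * u))"
  define G where "G = mk (cut {-1..1} g)"
  have g: "L2 g" unfolding g_def by (rule rescale_L2[OF h l L2_fn])
  have G: "proj {-1..1} G = G"
    unfolding G_def by (rule proj_mk_indicator[OF _ g]) simp
  define c where "c = w * l / h"
  have c: "c > 0" using l w h by (simp add: c_def)
  have "(norm (proj {p..q} (fourier h (proj {a..b} f))))\<^sup>2 = l * (norm (proj {-c..c} (fourier 1 G)))\<^sup>2"
    using rescale_band[OF h l L2_fn, of p0 w x0 f] unfolding ab pq by (simp add: proj_def c_def G_def g_def)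
  also have "\<dots> = l * (norm (band_op c G))\<^sup>2" by (simp add: band_op_def G)
  also have "\<dots> \<le> l * (lambda0 c * (norm G)\<^sup>2)" using l by (intro mult_left_mono band_op_le_lambda0 c) auto
  also have "\<dots> = lambda0 c * (norm (proj {a..b} f))\<^sup>2"
    using rescale_norm[OF h l L2_fn, of x0 f p0] unfolding ab by (simp add: proj_def G_def g_def)
  also have "c = (b - a) * (q - p) / (4 * h)" by (simp add: c_def w_def l_def)
  finally show ?thesis .
qed

section \<open>Leading Slepian functions as states\<close>

lemma quantum_state_iff: "quantum_state s \<longleftrightarrow> L2 s \<and> norm (mk s) = 1"
proof -
  have "norm (mk s) = 1 \<longleftrightarrow> (norm (mk s))\<^sup>2 = 1" using power2_eq_iff_nonneg[of "norm (mk s)" 1] by simp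
  then show ?thesis unfolding quantum_state_def using norm_mk_sq[of s] by auto
qed

lemma prolate_eigenfunction_cmult:
  assumes "prolate_eigenfunction c m f" "k \<noteq> 0"
  shows "prolate_eigenfunction c m (\<lambda>u. k * f u)"
proof -
  have "prolate_operator c (\<lambda>u. k * f u) u = k * prolate_operator c f u" for u
    unfolding prolate_operator_def integral_mult_right_zero[symmetric]
    by (intro Bochner_Integration.integral_cong refl) (simp only: mult_ac)
  then have "AE u in lebesgue_on {-1..1}. prolate_operator c (\<lambda>u. k * f u) u = of_real m * (k * f u)"
    using assms(1) unfolding prolate_eigenfunction_def by (auto elim!: eventually_mono)
  moreover have "L2 (\<lambda>x. k * (indicator {-1..1} x * f x))"
    using assms(1) unfolding prolate_eigenfunction_def by (intro L2_cmult) (simp add: L2_on_iff_UNIV[symmetric])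
  then have "L2_on {-1..1} (\<lambda>u. k * f u)"
    by (subst L2_on_iff_UNIV) (simp_all add: mult.left_commute)
  moreover have "\<not> (AE u in lebesgue_on {-1..1}. k * f u = 0)"
    using assms unfolding prolate_eigenfunction_def by simp
  ultimately show ?thesis unfolding prolate_eigenfunction_def by blast
qed

text \<open>The momentum interval has length \<open>4 * h * c / L\<close> because the half-widths
  \<open>L / 2\<close> and \<open>2 * h * c / L\<close> must multiply to \<open>h * c\<close>. The
  share of energy in it is then the eigenvalue, by \<open>eigenvector_band_op\<close>.\<close>

lemma slepian_rescale:
  assumes h: "h > 0" and c: "c > 0" and L: "L > 0" and f0: "prolate_eigenfunction c m f0"
  defines "s \<equiv> mk (\<lambda>x. if x \<in> {-L/2..L/2} then f0 (2 * x / L) else 0)"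
  shows "L2 (\<lambda>x. if x \<in> {-L/2..L/2} then f0 (2 * x / L) else 0)"
    "(norm s)\<^sup>2 = L / 2 * (norm (mk (cut {-1..1} f0)))\<^sup>2"
    "proj {-L/2..L/2} s = s"
    "(norm (proj {-(4 * h * c / L)/2..(4 * h * c / L)/2} (fourier h s)))\<^sup>2 = m * (norm s)\<^sup>2"
proof -
  define l where "l = L / 2"
  define w where "w = 2 * h * c / L"
  have l: "l > 0" using L by (simp add: l_def)
  let ?F0 = "cut {-1..1} f0"
  have F0: "L2 ?F0" by (rule prolate_eigenfunction_mk(1)[OF c f0])
  define G where "G = mk ?F0"
  have G: "prolate_op c G = m *\<^sub>R G" "proj {-1..1} G = G"
    unfolding G_def by (rule prolate_eigenfunction_mk(3)[OF c f0], rule prolate_eigenfunction_mk(4)[OF c f0])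
  \<comment> \<open>\<open>f0\<close> is constrained on \<open>[-1, 1]\<close> only, so it is cut
    before the dilation to make \<open>f\<close> square-integrable on the whole line.\<close>
  define f where "f = (\<lambda>x. ?F0 (0 + 1 / l * x))"
  have f: "L2 f" unfolding f_def by (rule L2_affine[OF F0]) (use l in auto)
  have Ll: "{-L/2..L/2} = {0-l..0+l}" by (simp add: l_def)
  have s_fun: "(\<lambda>x. if x \<in> {-L/2..L/2} then f0 (2 * x / L) else 0) = (cut {0-l..0+l} f)"
  proof
    fix x
    have "2 * x / L \<in> {-1..1}" if "x \<in> {0-l..0+l}" using that L by (auto simp: l_def field_simps)
    then show "(if x \<in> {-L/2..L/2} then f0 (2 * x / L) else 0) = indicator {0-l..0+l} x * f x"
      unfolding Ll by (simp add: f_def l_def indicator_def)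
  qed
  show L2: "L2 (\<lambda>x. if x \<in> {-L/2..L/2} then f0 (2 * x / L) else 0)"
    unfolding s_fun using f by (intro L2_indicator) auto
  show "proj {-L/2..L/2} s = s"
    unfolding s_def s_fun unfolding Ll by (rule proj_mk_indicator[OF _ f]) simp
  have g: "(\<lambda>u. indicator {-1..1} u * (exp (- (\<i> * of_real (0 * (l * u) / h))) * f (0 + l * u))) = ?F0"
    using l by (auto simp: f_def indicator_def)
  show s_norm: "(norm s)\<^sup>2 = L / 2 * (norm (mk ?F0))\<^sup>2"
    using rescale_norm[OF h l f, of 0 0, unfolded g] unfolding s_def s_fun l_def .
  have wlh: "w * l / h = c" using L h by (simp add: w_def l_def)
  have I: "{-(4 * h * c / L)/2..(4 * h * c / L)/2} = {0-w..0+w}" by (simp add: w_def)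
  have "(norm (proj {-(4 * h * c / L)/2..(4 * h * c / L)/2} (fourier h s)))\<^sup>2 = l * (norm (proj {-c..c} (fourier 1 G)))\<^sup>2"
    using rescale_band[OF h l f, of 0 w 0, unfolded g wlh] unfolding I s_def s_fun G_def .
  also have "\<dots> = l * (m * (norm G)\<^sup>2)"
    using eigenvector_band_op[OF G(1)] by (simp add: band_op_def G(2))
  also have "\<dots> = m * (norm s)\<^sup>2" unfolding s_norm G_def l_def by simp
  finally show "(norm (proj {-(4 * h * c / L)/2..(4 * h * c / L)/2} (fourier h s)))\<^sup>2 = m * (norm s)\<^sup>2" .
qed

lemma leading_slepian_exists:
  assumes c: "c > 0" and L: "L > 0"
  shows "\<exists>s. leading_slepian c L s"
proof -
  obtain f0 where f0: "prolate_eigenfunction c (lambda0 c) f0" by (rule prolate_eigenfunction_lambda0[OF c])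
  define N where "N = norm (mk (cut {-1..1} f0))"
  have N: "N > 0" using prolate_eigenfunction_mk(2)[OF c f0] by (simp add: N_def)
  \<comment> \<open>The dilation multiplies the squared norm by \<open>L / 2\<close>, which this
    factor compensates together with \<open>N\<close>.\<close>
  define k where "k = 1 / (sqrt (L / 2) * N)"
  have k: "k > 0" using L N by (simp add: k_def)
  let ?f = "\<lambda>u. complex_of_real k * f0 u"
  have f: "prolate_eigenfunction c (lambda0 c) ?f" using k by (intro prolate_eigenfunction_cmult f0) auto
  let ?s = "\<lambda>x. if x \<in> {-L/2..L/2} then ?f (2 * x / L) else 0"
  have "(\<lambda>x. indicator {-1..1} x * ?f x) = (\<lambda>x. k *\<^sub>R (indicator {-1..1} x * f0 x))"
    by (simp add: scaleR_conv_of_real mult.left_commute)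
  then have "norm (mk (\<lambda>x. indicator {-1..1} x * ?f x)) = k * N"
    using mk_scaleR[OF prolate_eigenfunction_mk(1)[OF c f0]] k by (simp add: N_def)
  \<comment> \<open>The norm of \<open>?s\<close> does not involve \<open>h\<close>, so the
    rescaling lemma is used with \<open>h = 1\<close>.\<close>
  then have "(norm (mk ?s))\<^sup>2 = L / 2 * (k * N)\<^sup>2"
    using slepian_rescale(2)[OF zero_less_one c L f] by simp
  also have "\<dots> = 1" using L N by (simp add: k_def power_divide power_mult_distrib)
  finally have "norm (mk ?s) = 1" using power2_eq_iff_nonneg[of "norm (mk ?s)" 1] by simp
  then have "quantum_state ?s" using slepian_rescale(1)[OF zero_less_one c L f] by (simp add: quantum_state_iff)
  moreover have "AE x in lebesgue. ?s x = (if x \<in> {-L/2..L/2} then complex_of_real k * f0 (2 * x / L) else 0)" by simp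
  ultimately show ?thesis unfolding leading_slepian_def using f0 by blast
qed

text \<open>Normalisation forces the factor \<open>k\<close> to be nonzero, so \<open>k * f0\<close>
  is itself an eigenfunction and \<open>slepian_rescale\<close> applies to it.\<close>

lemma leading_slepian_facts:
  assumes h: "h > 0" and c: "c > 0" and L: "L > 0" and s: "leading_slepian c L s"
  shows "L2 s" "norm (mk s) = 1" "proj {-L/2..L/2} (mk s) = mk s"
    "(norm (proj {-(4 * h * c / L)/2..(4 * h * c / L)/2} (fourier h (mk s))))\<^sup>2 = lambda0 c"
proof -
  have qs: "quantum_state s" using s by (simp add: leading_slepian_def)
  obtain f0 k where f0: "prolate_eigenfunction c (lambda0 c) f0"
    and sk: "AE x in lebesgue. s x = (if x \<in> {-L/2..L/2} then k * f0 (2 * x / L) else 0)"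
    using s unfolding leading_slepian_def by blast
  show L2: "L2 s" and n: "norm (mk s) = 1" using qs by (auto simp: quantum_state_iff)
  have "k \<noteq> 0"
  proof
    assume "k = 0"
    with sk have "AE x in lebesgue. s x = 0" by (auto elim: eventually_mono)
    then have "mk s = 0" unfolding zero_l2_def by (intro mk_eqI L2 L2_zero)
    with n show False by simp
  qed
  then have f: "prolate_eigenfunction c (lambda0 c) (\<lambda>u. k * f0 u)" by (intro prolate_eigenfunction_cmult f0)
  have eq: "mk s = mk (\<lambda>x. if x \<in> {-L/2..L/2} then k * f0 (2 * x / L) else 0)"
    by (intro mk_eqI L2 sk slepian_rescale(1)[OF h c L f])
  show "proj {-L/2..L/2} (mk s) = mk s" unfolding eq by (rule slepian_rescale(3)[OF h c L f])
  show "(norm (proj {-(4 * h * c / L)/2..(4 * h * c / L)/2} (fourier h (mk s))))\<^sup>2 = lambda0 c"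
    using slepian_rescale(4)[OF h c L f] n unfolding eq by simp
qed

section \<open>Confidence widths\<close>

text \<open>Since 0 * top = 0, a lower bound on all products of elements can be lost when one
  infimum is 0 and the other is infinite; the positivity assumptions exclude this.\<close>

lemma ennreal_Inf_mult_ge:
  fixes A B :: "ennreal set"
  assumes A: "Inf A > 0" and B: "Inf B > 0" and le: "\<And>a b. a \<in> A \<Longrightarrow> b \<in> B \<Longrightarrow> c \<le> a * b"
  shows "c \<le> Inf A * Inf B"
proof -
  \<comment> \<open>One factor is held fixed while the infimum is taken in the other, first over
    \<open>A\<close> and then over \<open>B\<close>. Dividing by \<open>t\<close> needs it positive
    and finite; an infinite \<open>t\<close> is settled by positivity of the infimum.\<close>
  have step: "c \<le> Inf S * t" if "\<And>a. a \<in> S \<Longrightarrow> c \<le> a * t" "Inf S > 0" "t > 0" for S and t :: ennreal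
  proof (cases "t = top")
    case True
    then show ?thesis using that(2) by (simp add: ennreal_mult_top)
  next
    case False
    have "c / t \<le> Inf S"
    proof (rule Inf_greatest)
      fix a assume "a \<in> S"
      then show "c / t \<le> a" using that(1,3) by (intro divide_le_posI_ennreal) (auto simp: mult.commute)
    qed
    then have "c / t * t \<le> Inf S * t" by (rule mult_right_mono) simp
    moreover have "t / t = 1" using that(3) False by (intro ennreal_divide_self) (auto simp: less_top)
    ultimately show ?thesis by (simp add: ennreal_divide_times)
  qed
  have "c \<le> Inf B * Inf A"
  proof (rule step)
    fix b assume b: "b \<in> B"
    then have "b > 0" using B Inf_lower[OF b] by simp
    then have "c \<le> Inf A * b" using le b A by (intro step) auto
    then show "c \<le> b * Inf A" by (simp add: mult.commute)
  qed (use A B in auto)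
  then show ?thesis by (simp add: mult.commute)
qed

lemma measure_product_bound_finite:
  assumes h: "h > 0" and \<psi>: "norm \<psi> = 1"
    and X: "X \<in> sets lebesgue" "emeasure lebesgue X < \<infinity>" and Y: "Y \<in> sets lebesgue" "emeasure lebesgue Y < \<infinity>"
    and s: "s \<le> (norm (proj X \<psi>))\<^sup>2" and t: "t \<le> (norm (proj Y (fourier h \<psi>)))\<^sup>2"
    and st: "0 < s" "0 < t" "s + t > 1" "s \<le> 1" "t \<le> 1"
  shows "2 * pi * h * confidence_bound s t \<le> measure lebesgue X * measure lebesgue Y"
proof -
  have "confidence_bound s t \<le> measure lebesgue X * measure lebesgue Y / (2 * pi * h)"
    by (rule concentration_bound[OF h \<psi> X(1) Y(1) s t st]) (use hilbert_schmidt_bound[OF h X Y] h in auto)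
  then show ?thesis using h by (simp add: field_simps)
qed

lemma norm_proj_Icc_tendsto: "((\<lambda>R. (norm (proj {-R..R} f))\<^sup>2) \<longlongrightarrow> (norm f)\<^sup>2) at_top"
  by (intro tendsto_intros proj_tendsto)

text \<open>A small set cannot carry confidence \<open>s\<close>: for \<open>h = 1\<close> some
  bounded momentum interval carries a complementary confidence, and the product bound against it
  leaves a fixed lower bound for the measure of \<open>X\<close>.\<close>

lemma confidence_width_pos:
  assumes \<psi>: "norm \<psi> = 1" and s: "0 < s" "s \<le> 1"
  obtains d where "d > 0" "\<And>X. X \<in> sets lebesgue \<Longrightarrow> s \<le> (norm (proj X \<psi>))\<^sup>2 \<Longrightarrow> ennreal d \<le> emeasure lebesgue X"
proof -
  \<comment> \<open>\<open>s + t = 1 + s / 2\<close> exceeds 1, while \<open>t < 1\<close> is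
    surpassed by a bounded interval.\<close>
  define t where "t = 1 - s / 2"
  have t: "0 < t" "t < 1" "s + t > 1" using s by (auto simp: t_def)
  have "((\<lambda>R. (norm (proj {-R..R} (fourier 1 \<psi>)))\<^sup>2) \<longlongrightarrow> 1) at_top"
    using norm_proj_Icc_tendsto[of "fourier 1 \<psi>"] \<psi> by (simp add: norm_fourier)
  then have "eventually (\<lambda>R. (norm (proj {-R..R} (fourier 1 \<psi>)))\<^sup>2 > t) at_top"
    using t by (intro order_tendstoD(1))
  then obtain R where R: "R > 0" "t < (norm (proj {-R..R} (fourier 1 \<psi>)))\<^sup>2"
    using eventually_happens'[OF trivial_limit_at_top_linorder eventually_conj[OF eventually_gt_at_top[of 0]]] by blast
  define d where "d = 2 * pi * 1 * confidence_bound s t / (2 * R)"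
  have d: "d > 0" using R confidence_bound_pos[of s t] s t by (simp add: d_def)
  show thesis
  proof (rule that[OF d])
    fix X assume X: "X \<in> sets lebesgue" "s \<le> (norm (proj X \<psi>))\<^sup>2"
    show "ennreal d \<le> emeasure lebesgue X"
    proof (cases "emeasure lebesgue X < \<infinity>")
      case True
      have "2 * pi * 1 * confidence_bound s t \<le> measure lebesgue X * measure lebesgue {-R..R}"
        by (rule measure_product_bound_finite[OF _ \<psi> X(1) True _ _ X(2)]) (use R s t in auto)
      then have "d \<le> measure lebesgue X" using R by (simp add: d_def field_simps)
      then have "ennreal d \<le> ennreal (measure lebesgue X)" by (rule ennreal_leI)
      also have "\<dots> = emeasure lebesgue X" using True by (intro emeasure_eq_ennreal_measure[symmetric]) auto
      finally show ?thesis .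
    qed (simp add: not_less top_unique)
  qed
qed

text \<open>A set of infinite measure makes the product infinite unless the other set is null, and
  \<open>confidence_width_pos\<close> excludes null sets in position and in momentum.\<close>

lemma measure_product_bound:
  assumes h: "h > 0" and \<psi>: "norm \<psi> = 1" and X: "X \<in> sets lebesgue" and Y: "Y \<in> sets lebesgue"
    and s: "s \<le> (norm (proj X \<psi>))\<^sup>2" and t: "t \<le> (norm (proj Y (fourier h \<psi>)))\<^sup>2"
    and st: "0 < s" "0 < t" "s + t > 1" "s \<le> 1" "t \<le> 1"
  shows "ennreal (2 * pi * h * confidence_bound s t) \<le> emeasure lebesgue X * emeasure lebesgue Y"
proof -
  have F\<psi>: "norm (fourier h \<psi>) = 1" using h \<psi> by (simp add: norm_fourier)
  obtain d where "d > 0" "ennreal d \<le> emeasure lebesgue X"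
    using confidence_width_pos[OF \<psi> st(1,4)] X s by metis
  then have X0: "emeasure lebesgue X \<noteq> 0" by auto
  obtain d' where "d' > 0" "ennreal d' \<le> emeasure lebesgue Y"
    using confidence_width_pos[OF F\<psi> st(2,5)] Y t by metis
  then have Y0: "emeasure lebesgue Y \<noteq> 0" by auto
  show ?thesis
  proof (cases "emeasure lebesgue X < \<infinity> \<and> emeasure lebesgue Y < \<infinity>")
    case True
    then have "ennreal (2 * pi * h * confidence_bound s t) \<le> ennreal (measure lebesgue X * measure lebesgue Y)"
      using measure_product_bound_finite[OF h \<psi> X _ Y _ s t st] by (intro ennreal_leI) auto
    also have "\<dots> = emeasure lebesgue X * emeasure lebesgue Y"
      using True emeasure_eq_ennreal_measure[of lebesgue X] emeasure_eq_ennreal_measure[of lebesgue Y]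
      by (simp add: ennreal_mult less_top)
    finally show ?thesis .
  next
    case False
    then have "emeasure lebesgue X * emeasure lebesgue Y = top"
      using X0 Y0 by (auto simp: ennreal_mult_eq_top_iff not_less top_unique)
    then show ?thesis by simp
  qed
qed

section \<open>Widths as infima over projections, and the uncertainty bounds\<close>

lemma integral_eq_norm_proj:
  assumes "X \<in> sets lebesgue" "L2 f"
  shows "(LINT x|lebesgue_on X. (cmod (f x))\<^sup>2) = (norm (proj X (mk f)))\<^sup>2"
  using assms by (simp add: norm_proj_mk_sq integral_restrict_space)

lemma confidence_width_eq:
  assumes "L2 f"
  shows "confidence_width s f = Inf {emeasure lebesgue X |X. X \<in> sets lebesgue \<and> s \<le> (norm (proj X (mk f)))\<^sup>2}"
  unfolding confidence_width_def using integral_eq_norm_proj[OF _ assms]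
  by (intro arg_cong[where f=Inf] Collect_cong ex_cong1) auto

lemma interval_width_eq:
  assumes "L2 f"
  shows "interval_width s f = Inf {ennreal (b - a) |a b. a \<le> b \<and> s \<le> (norm (proj {a..b} (mk f)))\<^sup>2}"
  unfolding interval_width_def using integral_eq_norm_proj[OF _ assms]
  by (intro arg_cong[where f=Inf] Collect_cong ex_cong1) auto

lemma interval_width_ge:
  assumes f: "L2 f" and d: "\<And>X. X \<in> sets lebesgue \<Longrightarrow> s \<le> (norm (proj X (mk f)))\<^sup>2 \<Longrightarrow> ennreal d \<le> emeasure lebesgue X"
  shows "ennreal d \<le> interval_width s f"
  unfolding interval_width_eq[OF f]
proof (rule Inf_greatest)
  fix z assume "z \<in> {ennreal (b - a) |a b. a \<le> b \<and> s \<le> (norm (proj {a..b} (mk f)))\<^sup>2}"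
  then obtain a b where z: "z = ennreal (b - a)" "a \<le> b" "s \<le> (norm (proj {a..b} (mk f)))\<^sup>2" by blast
  have "ennreal d \<le> emeasure lebesgue {a..b}" using z(3) by (intro d) auto
  then show "ennreal d \<le> z" using z by simp
qed

lemma interval_width_le:
  assumes "L2 f" "d > 0" "s \<le> (norm (proj {-d/2..d/2} (mk f)))\<^sup>2"
  shows "interval_width s f \<le> ennreal d"
  unfolding interval_width_eq[OF assms(1)]
proof (rule Inf_lower, rule CollectI, rule exI[of _ "-d/2"], rule exI[of _ "d/2"])
  show "ennreal d = ennreal (d/2 - -d/2) \<and> -d/2 \<le> d/2 \<and> s \<le> (norm (proj {-d/2..d/2} (mk f)))\<^sup>2"
    using assms by simp
qed

lemma widths_pos:
  assumes f: "L2 f" "norm (mk f) = 1" and s: "0 < s" "s \<le> 1"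
  shows "confidence_width s f > 0" "interval_width s f > 0"
proof -
  obtain d where d: "d > 0" "\<And>X. X \<in> sets lebesgue \<Longrightarrow> s \<le> (norm (proj X (mk f)))\<^sup>2 \<Longrightarrow> ennreal d \<le> emeasure lebesgue X"
    using confidence_width_pos[OF f(2) s] by metis
  have "ennreal d \<le> confidence_width s f"
    unfolding confidence_width_eq[OF f(1)] using d(2) by (intro Inf_greatest) blast
  moreover have "ennreal d \<le> interval_width s f" by (rule interval_width_ge[OF f(1) d(2)])
  ultimately show "confidence_width s f > 0" "interval_width s f > 0"
    using d(1) by (auto intro: less_le_trans[of 0 "ennreal d"])
qed

lemma quantum_state_momentum:
  assumes "h > 0" "quantum_state \<psi>"
  shows "L2 \<psi>" "norm (mk \<psi>) = 1" "L2 (momentum_wave h \<psi>)"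
    "mk (momentum_wave h \<psi>) = fourier h (mk \<psi>)" "norm (mk (momentum_wave h \<psi>)) = 1"
  using assms momentum_wave[of h \<psi>] by (auto simp: quantum_state_iff norm_fourier)

theorem confidence_uncertainty:
  assumes h: "h > 0" and \<psi>: "quantum_state \<psi>" and st: "0 < s" "0 < t" "s + t > 1" "s \<le> 1" "t \<le> 1"
  shows "ennreal (2 * pi * h * confidence_bound s t) \<le> Delta_c_x s \<psi> * Delta_c_p h t \<psi>"
proof -
  note q = quantum_state_momentum[OF h \<psi>]
  show ?thesis
    unfolding confidence_width_eq[OF q(1)] confidence_width_eq[OF q(3)]
  proof (rule ennreal_Inf_mult_ge)
    show "0 < Inf {emeasure lebesgue X |X. X \<in> sets lebesgue \<and> s \<le> (norm (proj X (mk \<psi>)))\<^sup>2}"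
      using widths_pos(1)[OF q(1,2) st(1,4)] unfolding confidence_width_eq[OF q(1)] .
    show "0 < Inf {emeasure lebesgue X |X. X \<in> sets lebesgue \<and> t \<le> (norm (proj X (mk (momentum_wave h \<psi>))))\<^sup>2}"
      using widths_pos(1)[OF q(3,5) st(2,5)] unfolding confidence_width_eq[OF q(3)] .
  qed (use measure_product_bound[OF h q(2) _ _ _ _ st] in \<open>auto simp: q(4)\<close>)
qed

lemma interval_product_bound:
  assumes h: "h > 0" and \<psi>: "norm \<psi> = 1"
    and s: "s \<le> (norm (proj {a..b} \<psi>))\<^sup>2" and t: "t \<le> (norm (proj {p..q} (fourier h \<psi>)))\<^sup>2"
    and st: "0 < s" "0 < t" "s + t > 1" "s \<le> 1" "t \<le> 1" and "a \<le> b" "p \<le> q"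
  shows "a < b" "p < q" "confidence_bound s t \<le> lambda0 ((b - a) * (q - p) / (4 * h))"
proof -
  \<comment> \<open>The measure bound first rules out degenerate intervals, so that
    \<open>lambda0\<close> receives a positive argument.\<close>
  have "2 * pi * h * confidence_bound s t \<le> measure lebesgue {a..b} * measure lebesgue {p..q}"
    by (rule measure_product_bound_finite[OF h \<psi> _ _ _ _ s t st]) auto
  moreover have "2 * pi * h * confidence_bound s t > 0" using h confidence_bound_pos[of s t] st by simp
  ultimately have "(b - a) * (q - p) > 0" using \<open>a \<le> b\<close> \<open>p \<le> q\<close> by simp
  then show ab: "a < b" "p < q" using \<open>a \<le> b\<close> \<open>p \<le> q\<close> by (auto simp: zero_less_mult_iff)
  show "confidence_bound s t \<le> lambda0 ((b - a) * (q - p) / (4 * h))"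
  proof (rule concentration_bound[OF h \<psi> _ _ s t st])
    show "(norm (proj {p..q} (fourier h (proj {a..b} \<psi>))))\<^sup>2 \<le> lambda0 ((b - a) * (q - p) / (4 * h)) * (norm (proj {a..b} \<psi>))\<^sup>2"
      by (rule interval_concentration[OF h ab])
    show "0 \<le> lambda0 ((b - a) * (q - p) / (4 * h))" using ab h by (intro less_imp_le lambda0_pos) auto
  qed auto
qed

text \<open>Strict monotonicity inverts the implicit bound for each admissible pair of intervals. If
  \<open>confidence_bound s t = 1\<close>, no pair is admissible; an empty set of widths has infimum
  top, in agreement with \<open>lambda0_inv 1\<close>.\<close>

theorem interval_uncertainty:
  assumes h: "h > 0" and \<psi>: "quantum_state \<psi>" and st: "0 < s" "0 < t" "s + t > 1" "s \<le> 1" "t \<le> 1"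
  shows "ennreal (4 * h) * lambda0_inv (confidence_bound s t) \<le> Delta_I_x s \<psi> * Delta_I_p h t \<psi>"
proof -
  note q = quantum_state_momentum[OF h \<psi>]
  show ?thesis
    unfolding interval_width_eq[OF q(1)] interval_width_eq[OF q(3)]
  proof (rule ennreal_Inf_mult_ge)
    show "0 < Inf {ennreal (b - a) |a b. a \<le> b \<and> s \<le> (norm (proj {a..b} (mk \<psi>)))\<^sup>2}"
      using widths_pos(2)[OF q(1,2) st(1,4)] unfolding interval_width_eq[OF q(1)] .
    show "0 < Inf {ennreal (b - a) |a b. a \<le> b \<and> t \<le> (norm (proj {a..b} (mk (momentum_wave h \<psi>))))\<^sup>2}"
      using widths_pos(2)[OF q(3,5) st(2,5)] unfolding interval_width_eq[OF q(3)] .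
    fix y z
    assume "y \<in> {ennreal (b - a) |a b. a \<le> b \<and> s \<le> (norm (proj {a..b} (mk \<psi>)))\<^sup>2}"
    then obtain a b where y: "y = ennreal (b - a)" "a \<le> b" "s \<le> (norm (proj {a..b} (mk \<psi>)))\<^sup>2" by blast
    assume "z \<in> {ennreal (b - a) |a b. a \<le> b \<and> t \<le> (norm (proj {a..b} (mk (momentum_wave h \<psi>))))\<^sup>2}"
    then obtain p r where z: "z = ennreal (r - p)" "p \<le> r" "t \<le> (norm (proj {p..r} (fourier h (mk \<psi>))))\<^sup>2"
      unfolding q(4) by blast
    note b = interval_product_bound[OF h q(2) y(3) z(3) st y(2) z(2)]
    define d where "d = (b - a) * (r - p) / (4 * h)"
    have d: "d > 0" using b(1,2) h by (simp add: d_def)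
    \<comment> \<open>A pair of bounded intervals is at hand, so the bound is below 1 and
      \<open>lambda0_inv\<close> is finite.\<close>
    have "confidence_bound s t < 1" using b(3) lambda0_less_1[OF d] by (simp add: d_def)
    moreover have "confidence_bound s t > 0" using confidence_bound_pos st by simp
    ultimately obtain c where c: "c > 0" "lambda0 c = confidence_bound s t" by (metis lambda0_surj)
    have "c \<le> d"
      using lambda0_strict_mono[of d c] d b(3) c by (auto simp: d_def not_less[symmetric])
    have "ennreal (4 * h) * lambda0_inv (confidence_bound s t) = ennreal (4 * h * c)"
      using lambda0_inv_lambda0[OF c(1)] c(2) h c(1) by (simp add: ennreal_mult)
    also have "\<dots> \<le> ennreal ((b - a) * (r - p))"
      using \<open>c \<le> d\<close> h by (intro ennreal_leI) (simp add: d_def field_simps)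
    also have "\<dots> = y * z" using y(1) z(1) b(1,2) by (simp add: ennreal_mult)
    finally show "ennreal (4 * h) * lambda0_inv (confidence_bound s t) \<le> y * z" .
  qed
qed

text \<open>Monotonicity of \<open>lambda0\<close> undoes the inversion; an infinite product is read
  as the value 1, which no \<open>y\<close> in range exceeds.\<close>

lemma lambda0_ext_ge:
  assumes "h > 0" and z: "ennreal (4 * h) * lambda0_inv y \<le> z" and y: "0 < y" "y \<le> 1"
  shows "y \<le> lambda0_ext (z / ennreal (4 * h))"
proof (cases "y = 1")
  case True
  then have "z = top" using z assms(1) by (simp add: lambda0_inv_def ennreal_mult_top top_unique)
  then show ?thesis using assms(1) True by (simp add: lambda0_ext_def ennreal_top_divide)
next
  case False
  then obtain c where c: "c > 0" "lambda0 c = y" using y by (metis lambda0_surj less_le)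
  have le: "ennreal (4 * h * c) \<le> z"
    using z lambda0_inv_lambda0[OF c(1)] c assms(1) by (simp add: ennreal_mult)
  show ?thesis
  proof (cases z)
    case (real r)
    then have r: "z / ennreal (4 * h) = ennreal (r / (4 * h))" using assms(1) by (simp add: divide_ennreal)
    have "4 * h * c \<le> r" using le real by simp
    then have "c \<le> r / (4 * h)" using assms(1) by (simp add: field_simps)
    then have "y \<le> lambda0 (r / (4 * h))" using lambda0_mono[OF c(1)] c(2) by simp
    then show ?thesis using r real assms(1) by (simp add: lambda0_ext_def)
  next
    case top
    then show ?thesis using assms(1) y by (simp add: lambda0_ext_def ennreal_top_divide)
  qed
qed

text \<open>At full position confidence the bound reduces to \<open>t\<close>. The Slepian function
  lies in an interval of length \<open>L\<close> and has momentum confidence exactly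
  \<open>lambda0 c = t\<close> in one of length \<open>4 * h * c / L\<close>, so the general lower
  bound is met.\<close>

lemma slepian_interval_confidence:
  assumes h: "h > 0" and c: "c > 0" and L: "L > 0" and s: "leading_slepian c L s"
    and t: "lambda0 c = confidence_bound 1 t" "0 < t" "t \<le> 1"
  shows "Delta_I_x 1 s * Delta_I_p h t s = ennreal (4 * h) * lambda0_inv (confidence_bound 1 t)"
proof (rule antisym)
  note f = leading_slepian_facts[OF h c L s]
  have qs: "quantum_state s" using f by (simp add: quantum_state_iff)
  note q = quantum_state_momentum[OF h qs]
  let ?W = "4 * h * c / L"
  have W: "?W > 0" using h c L by simp
  show "ennreal (4 * h) * lambda0_inv (confidence_bound 1 t) \<le> Delta_I_x 1 s * Delta_I_p h t s"
    using t by (intro interval_uncertainty h qs) auto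
  have "Delta_I_x 1 s \<le> ennreal L"
    by (rule interval_width_le[OF q(1) L]) (simp only: f power_one order_refl)
  moreover have "lambda0 c = t" using t by (simp add: confidence_bound_def)
  then have "Delta_I_p h t s \<le> ennreal ?W"
    by (intro interval_width_le[OF q(3) W]) (simp only: q(4) f(4) order_refl)
  ultimately have "Delta_I_x 1 s * Delta_I_p h t s \<le> ennreal L * ennreal ?W" by (intro mult_mono) auto
  also have "\<dots> = ennreal (4 * h) * lambda0_inv (confidence_bound 1 t)"
    using lambda0_inv_lambda0[OF c] t h c L by (simp add: ennreal_mult[symmetric])
  finally show "Delta_I_x 1 s * Delta_I_p h t s \<le> ennreal (4 * h) * lambda0_inv (confidence_bound 1 t)" .
qed

text \<open>Here \<open>s = cos\<^sup>2 a\<close>, \<open>t = cos\<^sup>2 b\<close>, and \<open>u\<close>, \<open>v\<close> make the angle \<open>a + b\<close>.\<close>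

lemma intermediate_unit_vector:
  fixes u v :: "'a::real_inner"
  assumes u: "norm u = 1" and v: "norm v = 1" and uv: "u \<bullet> v = sqrt (s * t) - sqrt ((1 - s) * (1 - t))"
    and st: "0 < s" "0 < t" "s \<le> 1" "t \<le> 1" "\<not> (s = 1 \<and> t = 1)"
  obtains \<alpha> \<beta> :: real where "norm (\<alpha> *\<^sub>R u + \<beta> *\<^sub>R v) = 1"
    "u \<bullet> (\<alpha> *\<^sub>R u + \<beta> *\<^sub>R v) = sqrt s" "v \<bullet> (\<alpha> *\<^sub>R u + \<beta> *\<^sub>R v) = sqrt t"
proof -
  define ca sa cb sb where "ca = sqrt s" and "sa = sqrt (1 - s)" and "cb = sqrt t" and "sb = sqrt (1 - t)"
  have sq: "ca * ca + sa * sa = 1" "cb * cb + sb * sb = 1"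
    using st by (simp_all add: ca_def sa_def cb_def sb_def)
  have pos: "ca > 0" "cb > 0" "sa \<ge> 0" "sb \<ge> 0" using st by (simp_all add: ca_def sa_def cb_def sb_def)
  \<comment> \<open>\<open>\<sigma>\<close> is sin (a + b), positive because the two angles are not
    both 0.\<close>
  define \<sigma> where "\<sigma> = sa * cb + ca * sb"
  have "sa > 0 \<or> sb > 0" using st by (auto simp: sa_def sb_def)
  then have \<sigma>: "\<sigma> > 0" using pos unfolding \<sigma>_def by (auto intro: add_pos_nonneg add_nonneg_pos)
  have uv': "u \<bullet> v = ca * cb - sa * sb" using uv by (simp add: ca_def sa_def cb_def sb_def real_sqrt_mult)
  have uu: "u \<bullet> u = 1" "v \<bullet> v = 1" using u v by (simp_all add: power2_norm_eq_inner[symmetric])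
  \<comment> \<open>Spherical interpolation: the weights are sin b / sin (a + b) and sin a / sin (a
    + b), which put \<open>w\<close> at angle \<open>a\<close> from \<open>u\<close> and
    \<open>b\<close> from \<open>v\<close>.\<close>
  define w where "w = (sb / \<sigma>) *\<^sub>R u + (sa / \<sigma>) *\<^sub>R v"
  have wu: "u \<bullet> w = ca"
  proof -
    have "sb + sa * (ca * cb - sa * sb) = ca * \<sigma> + sb * (1 - (ca * ca + sa * sa))"
      by (simp add: \<sigma>_def algebra_simps)
    then have "(sb + sa * (ca * cb - sa * sb)) / \<sigma> = ca" using \<sigma> sq by simp
    then show ?thesis unfolding w_def inner_add_right inner_scaleR_right uu uv' by (simp add: add_divide_distrib)
  qed
  have wv: "v \<bullet> w = cb"
  proof -
    have "sb * (ca * cb - sa * sb) + sa = cb * \<sigma> + sa * (1 - (cb * cb + sb * sb))"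
      by (simp add: \<sigma>_def algebra_simps)
    then have "(sb * (ca * cb - sa * sb) + sa) / \<sigma> = cb" using \<sigma> sq by simp
    then show ?thesis
      unfolding w_def inner_add_right inner_scaleR_right uu inner_commute[of v u] uv' by (simp add: add_divide_distrib)
  qed
  have "w \<bullet> w = sb / \<sigma> * (u \<bullet> w) + sa / \<sigma> * (v \<bullet> w)"
    by (subst (1) w_def) (simp add: inner_add_left)
  also have "\<dots> = (sa * cb + ca * sb) / \<sigma>" unfolding wu wv by (simp add: add_divide_distrib mult.commute)
  also have "\<dots> = 1" using \<sigma> by (simp add: \<sigma>_def)
  finally have "norm w = 1" by (simp add: norm_eq_sqrt_inner)
  then show thesis using that[of "sb / \<sigma>" "sa / \<sigma>"] wu wv by (simp add: w_def ca_def cb_def)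
qed

text \<open>The vector is taken between the transform of \<open>s\<close> and its normalised
  projection to the band, whose angle has cosine \<open>sqrt (lambda0 c)\<close>. Lower bounds for
  the two confidences suffice, since \<open>interval_uncertainty\<close> supplies the reverse
  inequality for the widths.\<close>

lemma slepian_band_combination:
  assumes h: "h > 0" and c: "c > 0" and L: "L > 0" and s: "leading_slepian c L s"
    and st: "0 < \<theta>x" "0 < \<theta>p" "\<theta>x + \<theta>p > 1" "\<theta>x \<le> 1" "\<theta>p \<le> 1" "\<not> (\<theta>x = 1 \<and> \<theta>p = 1)"
    and bound: "lambda0 c = confidence_bound \<theta>x \<theta>p"
  shows "\<exists>\<phi>. quantum_state \<phi> \<and> band_combination h (4 * h * c / L) s \<phi> \<and>
    Delta_I_x \<theta>x \<phi> * Delta_I_p h \<theta>p \<phi> = ennreal (4 * h) * lambda0_inv (confidence_bound \<theta>x \<theta>p)"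
proof -
  note f = leading_slepian_facts[OF h c L s]
  have qs: "quantum_state s" using f by (simp add: quantum_state_iff)
  note q = quantum_state_momentum[OF h qs]
  let ?W = "4 * h * c / L"
  let ?J = "{-?W/2..?W/2}" and ?I = "{-L/2..L/2}"
  have W: "?W > 0" using h c L by simp
  define S where "S = fourier h (mk s)"
  define r where "r = sqrt (\<theta>x * \<theta>p) - sqrt ((1 - \<theta>x) * (1 - \<theta>p))"
  have r: "r > 0" "r\<^sup>2 = lambda0 c"
    using confidence_root_pos[of \<theta>x \<theta>p] st bound by (auto simp: r_def confidence_bound_def)
  \<comment> \<open>\<open>proj ?J S\<close> has norm \<open>r\<close>, so \<open>v\<close> is a
    unit vector, and \<open>S \<bullet> v = r\<close> because the projection is orthogonal.\<close>
  define v where "v = (1 / r) *\<^sub>R proj ?J S"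
  have JS: "(norm (proj ?J S))\<^sup>2 = r\<^sup>2" using f(4) r(2) by (simp add: S_def)
  have nS: "norm S = 1" using f(2) h by (simp add: S_def norm_fourier)
  have "norm (proj ?J S) = r" using JS r(1) by (simp add: power2_eq_iff_nonneg)
  then have nv: "norm v = 1" using r(1) by (simp add: v_def)
  have Sv: "S \<bullet> v = r"
    using inner_proj_self[of ?J S] JS r(1) by (simp add: v_def inner_commute[of S] power2_eq_square)
  obtain \<alpha> \<beta> where w: "norm (\<alpha> *\<^sub>R S + \<beta> *\<^sub>R v) = 1" "S \<bullet> (\<alpha> *\<^sub>R S + \<beta> *\<^sub>R v) = sqrt \<theta>x"
      "v \<bullet> (\<alpha> *\<^sub>R S + \<beta> *\<^sub>R v) = sqrt \<theta>p"
    by (rule intermediate_unit_vector[OF nS nv Sv[unfolded r_def] st(1,2,4,5,6)])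
  define w where "w = \<alpha> *\<^sub>R S + \<beta> *\<^sub>R v"
  \<comment> \<open>Fourier inversion gives the state whose momentum wave function is
    \<open>w\<close>.\<close>
  define \<phi> where "\<phi> = fn (l2_cnj (fourier h (l2_cnj w)))"
  have \<phi>w: "fourier h (mk \<phi>) = w"
  proof -
    have "l2_cnj (fourier h (l2_cnj (fourier h (l2_cnj w)))) = l2_cnj w" by (rule l2_cnj_fourier_involution[OF h])
    then have "l2_cnj (l2_cnj (fourier h (l2_cnj (fourier h (l2_cnj w))))) = w" by simp
    then show ?thesis by (simp add: \<phi>_def)
  qed
  have L2\<phi>: "L2 \<phi>" by (simp add: \<phi>_def)
  have n\<phi>: "norm (mk \<phi>) = 1" using w(1) norm_fourier[OF h, of "mk \<phi>"] by (simp add: \<phi>w w_def)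
  have q\<phi>: "quantum_state \<phi>" using L2\<phi> n\<phi> by (simp add: quantum_state_iff)
  note q' = quantum_state_momentum[OF h q\<phi>]
  have sq_le: "x \<le> (norm z)\<^sup>2" if "sqrt x \<le> norm z" "0 < x" for x and z :: l2
    using power_mono[OF that(1), of 2] that(2) by simp
  \<comment> \<open>\<open>s\<close> lives in \<open>?I\<close>, so its inner product with
    \<open>\<phi>\<close> sees only the part of \<open>\<phi>\<close> in \<open>?I\<close>. For
    momentum, \<open>v\<close> is used in the same way with the band \<open>?J\<close>.\<close>
  have x: "\<theta>x \<le> (norm (proj ?I (mk \<phi>)))\<^sup>2"
  proof (rule sq_le)
    have "sqrt \<theta>x = S \<bullet> w" using w(2) by (simp add: w_def)
    also have "\<dots> = mk s \<bullet> mk \<phi>" unfolding S_def \<phi>w[symmetric] by (rule inner_fourier[OF h])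
    also have "\<dots> = mk s \<bullet> proj ?I (mk \<phi>)" using proj_selfadjoint[of ?I "mk s" "mk \<phi>"] f(3) by simp
    also have "\<dots> \<le> norm (mk s) * norm (proj ?I (mk \<phi>))" by (rule norm_cauchy_schwarz)
    finally show "sqrt \<theta>x \<le> norm (proj ?I (mk \<phi>))" using f(2) by simp
  qed fact
  have p: "\<theta>p \<le> (norm (proj ?J w))\<^sup>2"
  proof (rule sq_le)
    have "proj ?J v = v" by (simp add: v_def proj_scaleR proj_proj)
    then have "v \<bullet> w = v \<bullet> proj ?J w" using proj_selfadjoint[of ?J v w] by simp
    also have "\<dots> \<le> norm v * norm (proj ?J w)" by (rule norm_cauchy_schwarz)
    finally show "sqrt \<theta>p \<le> norm (proj ?J w)" using w(3) nv by (simp add: w_def)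
  qed fact
  have "Delta_I_x \<theta>x \<phi> \<le> ennreal L"
    by (rule interval_width_le[OF q'(1) L x])
  moreover have "Delta_I_p h \<theta>p \<phi> \<le> ennreal ?W"
    by (rule interval_width_le[OF q'(3) W]) (unfold q'(4) \<phi>w, rule p)
  ultimately have "Delta_I_x \<theta>x \<phi> * Delta_I_p h \<theta>p \<phi> \<le> ennreal L * ennreal ?W" by (intro mult_mono) auto
  also have "\<dots> = ennreal (4 * h) * lambda0_inv (confidence_bound \<theta>x \<theta>p)"
    using lambda0_inv_lambda0[OF c] bound h c L by (simp add: ennreal_mult[symmetric])
  finally have "Delta_I_x \<theta>x \<phi> * Delta_I_p h \<theta>p \<phi> = ennreal (4 * h) * lambda0_inv (confidence_bound \<theta>x \<theta>p)"
    using interval_uncertainty[OF h q\<phi> st(1-5)] by (rule antisym)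
  moreover have "band_combination h ?W s \<phi>"
    unfolding band_combination_def
  \<comment> \<open>\<open>v\<close> is \<open>proj ?J S\<close> divided by \<open>r\<close>, hence
    the coefficient \<open>\<beta> / r\<close>.\<close>
  proof (rule exI[of _ \<alpha>], rule exI[of _ "\<beta> / r"])
    have m\<phi>: "AE p in lebesgue. fn w p = momentum_wave h \<phi> p" using fn_mk[OF q'(3)] q'(4) \<phi>w by simp
    have ms: "AE p in lebesgue. fn S p = momentum_wave h s p" using fn_mk[OF q(3)] q(4) by (simp add: S_def)
    have fv: "AE p in lebesgue. fn v p = (1 / r) *\<^sub>R fn (proj ?J S) p" unfolding v_def by (rule fn_scaleR)
    have fJ: "AE p in lebesgue. fn (proj ?J S) p = indicator ?J p * fn S p" by (rule fn_proj) simp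
    have fw: "AE p in lebesgue. fn w p = fn (\<alpha> *\<^sub>R S) p + fn (\<beta> *\<^sub>R v) p" unfolding w_def by (rule fn_plus)
    show "AE p in lebesgue. momentum_wave h \<phi> p = of_real (\<alpha> + \<beta> / r * indicator ?J p) * momentum_wave h s p"
      using m\<phi> ms fv fJ fw fn_scaleR[of \<alpha> S] fn_scaleR[of \<beta> v]
    proof eventually_elim
      case (elim p)
      have "momentum_wave h \<phi> p = of_real \<alpha> * fn S p + of_real (\<beta> * (1 / r)) * (indicator ?J p * fn S p)"
        unfolding elim(1)[symmetric] elim(5) elim(6) elim(7) elim(3) elim(4)
        by (simp only: scaleR_conv_of_real of_real_mult mult.assoc)
      also have "\<dots> = of_real (\<alpha> + \<beta> / r * indicator ?J p) * fn S p"
        by (simp add: distrib_right of_real_indicator mult.assoc)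
      finally show ?case unfolding elim(2) .
    qed
  qed
  ultimately show ?thesis using q\<phi> by blast
qed

text \<open>The saturating parameter \<open>c\<close> is finite exactly when the confidences are not
  both 1, which explains the exclusion in the last conjunct. The length \<open>L\<close> stays free
  because only the product of the two widths is determined.\<close>

theorem theorem2:
  fixes hbar \<theta>x \<theta>p :: real and \<psi> :: "real \<Rightarrow> complex"
  assumes "hbar > 0"
    and "quantum_state \<psi>"
    and "\<theta>x \<in> {0<..1}" and "\<theta>p \<in> {0<..1}"
    and "\<theta>x + \<theta>p > 1"
  shows
    "Delta_c_x \<theta>x \<psi> * Delta_c_p hbar \<theta>p \<psi>
       \<ge> ennreal (2 * pi * hbar * confidence_bound \<theta>x \<theta>p)
     \<and>
     lambda0_ext (Delta_I_x \<theta>x \<psi> * Delta_I_p hbar \<theta>p \<psi> / ennreal (4 * hbar))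
       \<ge> confidence_bound \<theta>x \<theta>p
     \<and>
     Delta_I_x \<theta>x \<psi> * Delta_I_p hbar \<theta>p \<psi>
       \<ge> ennreal (4 * hbar) * lambda0_inv (confidence_bound \<theta>x \<theta>p)
     \<and>
     (\<not> (\<theta>x = 1 \<and> \<theta>p = 1) \<longrightarrow>
       (\<exists>c>0. lambda0_inv (confidence_bound \<theta>x \<theta>p) = ennreal c \<and>
         (\<forall>L>0.
           (\<exists>s. leading_slepian c L s) \<and>
           (\<forall>s. leading_slepian c L s \<longrightarrow>
             (\<theta>x = 1 \<longrightarrow>
               Delta_I_x \<theta>x s * Delta_I_p hbar \<theta>p s
                 = ennreal (4 * hbar) * lambda0_inv (confidence_bound \<theta>x \<theta>p)) \<and>
             (\<exists>\<phi>. quantum_state \<phi> \<and> band_combination hbar (4 * hbar * c / L) s \<phi> \<and>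
               Delta_I_x \<theta>x \<phi> * Delta_I_p hbar \<theta>p \<phi>
                 = ennreal (4 * hbar) * lambda0_inv (confidence_bound \<theta>x \<theta>p))))))"
proof -
  have st: "0 < \<theta>x" "0 < \<theta>p" "\<theta>x + \<theta>p > 1" "\<theta>x \<le> 1" "\<theta>p \<le> 1" using assms by auto
  have y: "0 < confidence_bound \<theta>x \<theta>p" "confidence_bound \<theta>x \<theta>p \<le> 1"
    using confidence_bound_pos[of \<theta>x \<theta>p] confidence_bound_le_1[of \<theta>x \<theta>p] st by auto
  note interval = interval_uncertainty[OF assms(1,2) st]
  have "\<exists>c>0. lambda0_inv (confidence_bound \<theta>x \<theta>p) = ennreal c \<and>
         (\<forall>L>0.
           (\<exists>s. leading_slepian c L s) \<and>
           (\<forall>s. leading_slepian c L s \<longrightarrow>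
             (\<theta>x = 1 \<longrightarrow>
               Delta_I_x \<theta>x s * Delta_I_p hbar \<theta>p s
                 = ennreal (4 * hbar) * lambda0_inv (confidence_bound \<theta>x \<theta>p)) \<and>
             (\<exists>\<phi>. quantum_state \<phi> \<and> band_combination hbar (4 * hbar * c / L) s \<phi> \<and>
               Delta_I_x \<theta>x \<phi> * Delta_I_p hbar \<theta>p \<phi>
                 = ennreal (4 * hbar) * lambda0_inv (confidence_bound \<theta>x \<theta>p))))"
    if not1: "\<not> (\<theta>x = 1 \<and> \<theta>p = 1)"
  proof -
    have "confidence_bound \<theta>x \<theta>p < 1"
      using y confidence_bound_eq_1_iff[of \<theta>x \<theta>p] st not1 by fastforce
    then obtain c where c: "c > 0" "lambda0 c = confidence_bound \<theta>x \<theta>p" using y(1) by (metis lambda0_surj)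
    show ?thesis
    proof (intro exI[of _ c] conjI allI impI)
      show "c > 0" by fact
      show "lambda0_inv (confidence_bound \<theta>x \<theta>p) = ennreal c" using lambda0_inv_lambda0[OF c(1)] c(2) by simp
      fix L :: real assume L: "L > 0"
      show "\<exists>s. leading_slepian c L s" by (rule leading_slepian_exists[OF c(1) L])
      fix s assume s: "leading_slepian c L s"
      show "\<exists>\<phi>. quantum_state \<phi> \<and> band_combination hbar (4 * hbar * c / L) s \<phi> \<and>
          Delta_I_x \<theta>x \<phi> * Delta_I_p hbar \<theta>p \<phi> = ennreal (4 * hbar) * lambda0_inv (confidence_bound \<theta>x \<theta>p)"
        by (rule slepian_band_combination[OF assms(1) c(1) L s st not1 c(2)])
      assume "\<theta>x = 1"
      then show "Delta_I_x \<theta>x s * Delta_I_p hbar \<theta>p s = ennreal (4 * hbar) * lambda0_inv (confidence_bound \<theta>x \<theta>p)"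
        using slepian_interval_confidence[OF assms(1) c(1) L s, of \<theta>p] c(2) st by simp
    qed
  qed
  then show ?thesis
    using confidence_uncertainty[OF assms(1,2) st] interval lambda0_ext_ge[OF assms(1) interval y] by blast
qed

end
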